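(* Let $W=W^{\mathsf{BC}}_n$ with $n\ge 2$. Then the $W$-graphs $\Gamma^{\mathbf m}(W)$ and $\Gamma^{\mathbf n}(W)$ are dual via the involution $\iota^{\mathsf{BC}}_n$ of $\mathcal G^{\mathsf{BC}}_n$; that is, for all $u,v\in\mathcal G^{\mathsf{BC}}_n$, $\omega^{\mathbf n}(\iota^{\mathsf{BC}}_n(u),\iota^{\mathsf{BC}}_n(v))=\omega^{\mathbf m}(v,u)$ and $\mathrm{Asc}^{\mathbf n}(\iota^{\mathsf{BC}}_n(v))=S\setminus\mathrm{Asc}^{\mathbf m}(v)$.
   Context: For $i>0$ let $s_i=(i,i+1)(-i,-i-1)$ and $s_0=(-1,1)$. $W^{\mathsf{BC}}_N$ is the group of permutations $w$ of $\{\pm1,\dots,\pm N\}$ with $w(-i)=-w(i)$, a Coxeter group with generators $S=\{s_0,\dots,s_{N-1}\}$ and length $\ell$. $\mathcal G^{\mathsf{BC}}_n$ is the set of $z\in W^{\mathsf{BC}}_{2n}$ with $z=z^{-1}$, $|z(i)|\ne i$ for all $i\in[2n]$, and no visible descent greater than $n$, where $i>0$ is a visible descent if $z(i+1)<\min\{i,z(i)\}$ or $z(i)<-i$. For $z\in\mathcal G^{\mathsf{BC}}_n$ (with $S$ the generators of $W^{\mathsf{BC}}_n$ and $\ell$ the length of $W^{\mathsf{BC}}_{2n}$): $\mathrm{Des}^=(z)=\{s\in S:sz=zs\}$, $\mathrm{Asc}^=(z)=\{s\in S:zsz\in\{s_i:i>n\}\}$, $\mathrm{Des}^<(z)=\{s:\ell(sz)<\ell(z)\}\setminus(\mathrm{Des}^=\sqcup\mathrm{Asc}^=)$,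 $\mathrm{Asc}^<(z)=\{s:\ell(sz)>\ell(z)\}\setminus(\mathrm{Des}^=\sqcup\mathrm{Asc}^=)$; $\mathrm{Asc}^{\mathbf m}(z)=\mathrm{Asc}^<(z)\sqcup\mathrm{Asc}^=(z)$, $\mathrm{Asc}^{\mathbf n}(z)=\mathrm{Asc}^<(z)\sqcup\mathrm{Des}^=(z)$. $\mathcal H$: Iwahori–Hecke algebra of $W$ over $\mathbb Z[x,x^{-1}]$, basis $H_w$, $H_sH_w=H_{sw}$ if $\ell(sw)>\ell(w)$ else $H_{sw}+(x-x^{-1})H_w$; bar operator: antilinear ($x\mapsto x^{-1}$) ring involution with $\overline{H_w}=(H_{w^{-1}})^{-1}$. $\mathcal M,\mathcal N$ are free modules with bases $M_z,N_z$ ($z\in\mathcal G^{\mathsf{BC}}_n$), with $H_sM_z=M_{szs}$, $M_{szs}+(x-x^{-1})M_z$, $-x^{-1}M_z$, $xM_z$ and $H_sN_z=N_{szs}$, $N_{szs}+(x-x^{-1})N_z$, $xN_z$, $-x^{-1}N_z$ according as $s\in\mathrm{Asc}^<(z),\mathrm{Des}^<(z),\mathrm{Asc}^=(z),\mathrm{Des}^=(z)$; each has the unique antilinear $\overline{\cdot}$ with $\overline{HA}=\overline H\,\overline A$ fixing basis elements $M_z$/$N_z$ with $\mathrm{Des}^<(z)=\varnothing$, and unique bases $\underline M_z$, $\underline N_z$ that are bar-invariant and lie in $M_z+\sum_{\ell(y)<\ell(z)}x^{-1}\mathbb Z[x^{-1}]M_y$ (resp. with $N$). With $\underline M_z=\sum_y\mathbf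 m_{yz}M_y$, $\underline N_z=\sum_y\mathbf n_{yz}N_y$ and $\mu^{\mathbf m}_{yz},\mu^{\mathbf n}_{yz}$ the $x^{-1}$-coefficients, set $\omega^{\mathbf m}(y,z)=\mu^{\mathbf m}_{yz}+\mu^{\mathbf m}_{zy}$ if $\mathrm{Asc}^{\mathbf m}(y)\not\subset\mathrm{Asc}^{\mathbf m}(z)$, else $0$; $\omega^{\mathbf n}$ likewise. $\Gamma^{\mathbf m}=(\mathcal G^{\mathsf{BC}}_n,\omega^{\mathbf m},\mathrm{Asc}^{\mathbf m})$, $\Gamma^{\mathbf n}=(\mathcal G^{\mathsf{BC}}_n,\omega^{\mathbf n},\mathrm{Asc}^{\mathbf n})$. Two $S$-labeled graphs $(V,\omega,I)$, $(V',\omega',I')$ are dual via a bijection $v\mapsto v'$ if $\omega'(u',v')=\overline{\omega(v,u)}$ and $I'(v')=S\setminus I(v)$. The map $w\mapsto\underline w$: for $w=w^{-1}\in W^{\mathsf{BC}}_n$ let $a_1>\dots>a_p$ be the $a\in[n]$ with $w(a)=-a$ and $b_1<\dots<b_q$ the $b\in[n]$ with $w(b)=b$, and set $\underline w=\prod_{i=1}^p(a_i,n+i)(-a_i,-n-i)\cdot\prod_{i=1}^q(b_i,n+p+i)(-b_i,-n-p-i)\cdot\prod_{i\in[n-p-q],\,i\text{ odd}}s_{n+p+q+i}\cdot w$. This is a bijection from $\{w\in W^{\mathsf{BC}}_n:w=w^{-1}\}$ onto $\mathcal G^{\mathsf{BC}}_n$. For $w\in W^{\mathsf{BC}}_n$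 let $-w$ be $i\mapsto-w(i)$; define $\iota^{\mathsf{BC}}_n(\underline w)=\underline{-w}$.
   Formalization: The product formula for w ↦ underline w is not an involution when some w(a) = −a (e.g. n = 2, w = s_0 gives a 4-cycle); it is corrected so that underline w exchanges a_i with −(n+i), all other values being as in the printed formula. *)

theory Defs
  imports Main "HOL-Library.Function_Algebras"
begin

type_synonym sperm = "int \<Rightarrow> int"

definition WBC :: "nat \<Rightarrow> sperm set" where
  "WBC N = {w. (\<forall>i. w (- i) = - w i)
              \<and> bij_betw w {i. 1 \<le> \<bar>i\<bar> \<and> \<bar>i\<bar> \<le> int N} {i. 1 \<le> \<bar>i\<bar> \<and> \<bar>i\<bar> \<le> int N}
              \<and> (\<forall>i. \<not> (1 \<le> \<bar>i\<bar> \<and> \<bar>i\<bar> \<le> int N) \<longrightarrow> w i = i)}"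

definition sgen :: "nat \<Rightarrow> sperm" where
  "sgen i = (if i = 0 then (\<lambda>j. if j = 1 then -1 else if j = -1 then 1 else j)
             else (\<lambda>j. if j = int i then int i + 1 else if j = int i + 1 then int i
                        else if j = - int i then - int i - 1 else if j = - int i - 1 then - int i
                        else j))"

definition Sgens :: "nat \<Rightarrow> sperm set" where
  "Sgens N = sgen ` {..<N}"

definition wordprod :: "nat list \<Rightarrow> sperm" where
  "wordprod ws = foldr (\<lambda>i acc. sgen i \<circ> acc) ws id"

definition len :: "nat \<Rightarrow> sperm \<Rightarrow> nat" where
  "len N w = (LEAST k. \<exists>ws. length ws = k \<and> set ws \<subseteq> {..<N} \<and> wordprod ws = w)"

definition visdesc :: "sperm \<Rightarrow> int \<Rightarrow> bool" where
  "visdesc z i \<longleftrightarrow> i > 0 \<and> (z (i + 1) < min i (z i) \<or> z i < - i)"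

definition GBC :: "nat \<Rightarrow> sperm set" where
  "GBC n = {z \<in> WBC (2 * n). z \<circ> z = id
              \<and> (\<forall>i::int. 1 \<le> i \<and> i \<le> 2 * int n \<longrightarrow> \<bar>z i\<bar> \<noteq> i)
              \<and> (\<forall>i::int. i > int n \<longrightarrow> \<not> visdesc z i)}"

definition DesEq :: "nat \<Rightarrow> sperm \<Rightarrow> sperm set" where
  "DesEq n z = {s \<in> Sgens n. s \<circ> z = z \<circ> s}"

definition AscEq :: "nat \<Rightarrow> sperm \<Rightarrow> sperm set" where
  "AscEq n z = {s \<in> Sgens n. z \<circ> s \<circ> z \<in> {sgen i | i. i > n}}"

definition DesLt :: "nat \<Rightarrow> sperm \<Rightarrow> sperm set" where
  "DesLt n z = {s \<in> Sgens n. len (2 * n) (s \<circ> z) < len (2 * n) z} - (DesEq n z \<union> AscEq n z)"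

definition AscLt :: "nat \<Rightarrow> sperm \<Rightarrow> sperm set" where
  "AscLt n z = {s \<in> Sgens n. len (2 * n) (s \<circ> z) > len (2 * n) z} - (DesEq n z \<union> AscEq n z)"

definition AscM :: "nat \<Rightarrow> sperm \<Rightarrow> sperm set" where
  "AscM n z = AscLt n z \<union> AscEq n z"

definition AscN :: "nat \<Rightarrow> sperm \<Rightarrow> sperm set" where
  "AscN n z = AscLt n z \<union> DesEq n z"

text \<open>A Laurent polynomial in Z[x,x^-1] is represented by its coefficient function
  (k \<mapsto> coefficient of x^k), which is required to have finite support where relevant.
  An element of M (resp. N) is represented by its coefficient function
  y \<mapsto> (coefficient of M_y, a Laurent polynomial).\<close>

type_synonym lpoly = "int \<Rightarrow> int"
type_synonym melt = "sperm \<Rightarrow> lpoly"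

definition lfin :: "lpoly \<Rightarrow> bool" where
  "lfin c \<longleftrightarrow> finite {k. c k \<noteq> 0}"

definition lmul :: "lpoly \<Rightarrow> lpoly \<Rightarrow> lpoly" where
  "lmul p q = (\<lambda>k. \<Sum>j\<in>{j. p j \<noteq> 0}. p j * q (k - j))"

definition lbar :: "lpoly \<Rightarrow> lpoly" where
  "lbar p = (\<lambda>k. p (- k))"

definition lone :: lpoly where "lone = (\<lambda>k. if k = 0 then 1 else 0)"
definition lx :: lpoly where "lx = (\<lambda>k. if k = 1 then 1 else 0)"
definition lxinv :: lpoly where "lxinv = (\<lambda>k. if k = -1 then 1 else 0)"

definition smul :: "lpoly \<Rightarrow> melt \<Rightarrow> melt" where
  "smul c A = (\<lambda>y. lmul c (A y))"

definition bas :: "sperm \<Rightarrow> melt" where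
  "bas z = (\<lambda>y. if y = z then lone else (\<lambda>_. 0))"

definition valid :: "nat \<Rightarrow> melt \<Rightarrow> bool" where
  "valid n A \<longleftrightarrow> (\<forall>y. y \<notin> GBC n \<longrightarrow> A y = (\<lambda>_. 0)) \<and> (\<forall>y. lfin (A y))"

datatype modkind = ModM | ModN

definition hbas :: "modkind \<Rightarrow> nat \<Rightarrow> sperm \<Rightarrow> sperm \<Rightarrow> melt" where
  "hbas k n s z =
     (if s \<in> AscLt n z then bas (s \<circ> z \<circ> s)
      else if s \<in> DesLt n z then bas (s \<circ> z \<circ> s) + smul (lx - lxinv) (bas z)
      else if s \<in> AscEq n z then (case k of ModM \<Rightarrow> smul (- lxinv) (bas z) | ModN \<Rightarrow> smul lx (bas z))
      else (case k of ModM \<Rightarrow> smul lx (bas z) | ModN \<Rightarrow> smul (- lxinv) (bas z)))"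

definition hact :: "modkind \<Rightarrow> nat \<Rightarrow> sperm \<Rightarrow> melt \<Rightarrow> melt" where
  "hact k n s A = (\<Sum>z\<in>GBC n. smul (A z) (hbas k n s z))"

text \<open>The bar operator: antilinear, compatible with the bar operator of the Hecke algebra
  (checked on the generators H_s, whose bar is H_s^-1 = H_s - (x - x^-1)), and fixing
  the basis elements indexed by z with Des^<(z) empty.\<close>
definition is_bar :: "modkind \<Rightarrow> nat \<Rightarrow> (melt \<Rightarrow> melt) \<Rightarrow> bool" where
  "is_bar k n f \<longleftrightarrow>
     (\<forall>A. valid n A \<longrightarrow> valid n (f A))
   \<and> (\<forall>A B. valid n A \<longrightarrow> valid n B \<longrightarrow> f (A + B) = f A + f B)
   \<and> (\<forall>c A. lfin c \<longrightarrow> valid n A \<longrightarrow> f (smul c A) = smul (lbar c) (f A))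
   \<and> (\<forall>s\<in>Sgens n. \<forall>A. valid n A \<longrightarrow>
         f (hact k n s A) = hact k n s (f A) - smul (lx - lxinv) (f A))
   \<and> (\<forall>z\<in>GBC n. DesLt n z = {} \<longrightarrow> f (bas z) = bas z)"

definition canon :: "modkind \<Rightarrow> nat \<Rightarrow> sperm \<Rightarrow> melt" where
  "canon k n = (THE C. (\<forall>z. z \<notin> GBC n \<longrightarrow> C z = (\<lambda>_ _. 0))
      \<and> (\<exists>f. is_bar k n f \<and>
           (\<forall>z\<in>GBC n. valid n (C z) \<and> f (C z) = C z \<and> C z z = lone
              \<and> (\<forall>y\<in>GBC n. y \<noteq> z \<longrightarrow>
                    (if len (2 * n) y < len (2 * n) z then (\<forall>j \<ge> 0. C z y j = 0)
                     else C z y = (\<lambda>_. 0))))))"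

definition mu :: "modkind \<Rightarrow> nat \<Rightarrow> sperm \<Rightarrow> sperm \<Rightarrow> int" where
  "mu k n y z = canon k n z y (-1)"

definition Asck :: "modkind \<Rightarrow> nat \<Rightarrow> sperm \<Rightarrow> sperm set" where
  "Asck k n z = (case k of ModM \<Rightarrow> AscM n z | ModN \<Rightarrow> AscN n z)"

definition omega :: "modkind \<Rightarrow> nat \<Rightarrow> sperm \<Rightarrow> sperm \<Rightarrow> int" where
  "omega k n y z = (if \<not> (Asck k n y \<subseteq> Asck k n z) then mu k n y z + mu k n z y else 0)"

definition InvBC :: "nat \<Rightarrow> sperm set" where
  "InvBC n = {w \<in> WBC n. w \<circ> w = id}"

text \<open>underline w: a_1 > ... > a_p are the a in [n] with w(a) = -a, b_1 < ... < b_q those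
  with w(b) = b.  underline w sends a_i to -(n+i), b_i to n+p+i, pairs n+p+q+i with
  n+p+q+i+1 for odd i, and agrees with w on the remaining elements of [n].\<close>
definition under :: "nat \<Rightarrow> sperm \<Rightarrow> sperm" where
  "under n w x =
    (let Aset = {a::int. 1 \<le> a \<and> a \<le> int n \<and> w a = - a};
         Bset = {b::int. 1 \<le> b \<and> b \<le> int n \<and> w b = b};
         Al = rev (sorted_list_of_set Aset);
         Bl = sorted_list_of_set Bset;
         p = int (length Al); q = int (length Bl);
         g = (\<lambda>y::int.
               if y \<le> int n then
                 (if y \<in> Aset then - (int n + int (card {a \<in> Aset. y \<le> a}))
                  else if y \<in> Bset then int n + p + int (card {b \<in> Bset. b \<le> y})
                  else w y)
               else (let j = y - int n in
                     if j \<le> p then - (Al ! nat (j - 1))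
                     else if j \<le> p + q then Bl ! nat (j - p - 1)
                     else if odd (j - p - q) then y + 1 else y - 1));
         y = \<bar>x\<bar>
     in if 1 \<le> y \<and> y \<le> 2 * int n then sgn x * g y else x)"

definition negw :: "nat \<Rightarrow> sperm \<Rightarrow> sperm" where
  "negw n w = (\<lambda>i. if 1 \<le> \<bar>i\<bar> \<and> \<bar>i\<bar> \<le> int n then - w i else i)"

definition iota :: "nat \<Rightarrow> sperm \<Rightarrow> sperm" where
  "iota n z = under n (negw n (THE w. w \<in> InvBC n \<and> under n w = z))"

end

theory Submission
  imports Defs "HOL-Library.Poly_Mapping" "HOL-Library.FuncSet"
begin

text \<open>Let \<open>\<delta> = x - x\<^sup>-\<^sup>1\<close>. Passing from \<open>z\<close> to \<open>\<iota>(z)\<close> exchanges strict ascents and strict descents and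
  preserves both kinds of weak ones. Hence, for the pairing of \<open>\<N>\<close> and \<open>\<M>\<close> which is linear in the
  second argument, semilinear for \<open>x \<mapsto> - x\<close> in the first one, and for which \<open>N\<^bsub>\<iota>(z)\<^esub>\<close> and \<open>M\<^sub>z\<close> are dual
  bases, the adjoint of \<open>H\<^sub>s\<close> is \<open>H\<^sub>s\<^sup>-\<^sup>1\<close>. It follows that the two bar operators are compatible with
  the pairing, as soon as this holds for the shortest element of each orbit; this element and, by
  \<open>\<iota>\<close>, the longest one are unique. So the values of the pairing on canonical basis elements are bar
  invariant and, up to the diagonal, lie in \<open>x\<^sup>-\<^sup>1\<int>[x\<^sup>-\<^sup>1]\<close>; they vanish off the diagonal, and the
  coefficient of \<open>x\<^sup>-\<^sup>1\<close> gives the equality of the \<open>\<mu>\<close>-coefficients.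

  The existence of the bar operators rests on an explicit formula. The braid relations hold in the
  modules, so there are operators \<open>bar(H\<^sub>w)\<close>. If \<open>z\<close> has no tail, which means \<open>z([n]) \<subseteq> \<plusminus>[n]\<close>, the bar
  operator maps the basis vector of \<open>z\<close> to a unit times \<open>bar(H\<^sub>z)\<close> applied to it. The general case is
  reduced to this one by parabolic induction.\<close>

section \<open>Signed permutations and their length\<close>

text \<open>The bar operator occurs in the statement only through its axioms, inside a definite
  description; so \<open>canon\<close> says nothing until an operator satisfying them is exhibited.
  The formula with \<open>bar(H_z)\<close> makes no sense for an element with a tail, which does not
  restrict to a member of W_n. Conjugation by a minimal coset representative \<open>u\<close> moves
  the tail to the last places of [n], where it is a mere shift. On the remaining places there is an
  involution \<open>h\<close> in W_n, and the operator used is the one indexed by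
  \<open>u h\<close>. The substitution x -> -x is forced by the weak letters: these are kept by
  \<open>iota\<close>, H_s acts on them by x in one module and by -x^-1 in the other, and the
  adjoint has to act by the inverse scalar. The condition on visible descents is used mainly through
  the shape which it forces beyond n: an element is determined by its values inside \<plusminus>[n]
  and the signs of those which leave it. This makes \<open>iota\<close> accessible without the
  formula that defines it.\<close>

lemma sgen_Suc: "0 < i \<Longrightarrow> sgen i j = (if j = int i then int i + 1 else if j = int i + 1 then int i
    else if j = - int i then - int i - 1 else if j = - int i - 1 then - int i else j)"
  by (simp add: sgen_def)

lemma sgen_0: "sgen 0 j = (if j = 1 then -1 else if j = -1 then 1 else j)"
  by (simp add: sgen_def)

lemma sgen_invol [simp]: "sgen i (sgen i j) = j"
  by (cases "i = 0") (auto simp: sgen_Suc sgen_0)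

lemma sgen_o_sgen [simp]: "sgen i \<circ> sgen i = id"
  by (auto simp: fun_eq_iff)

lemma o_sgen_cancel [simp]: "w \<circ> sgen i \<circ> sgen i = w"
  by (simp add: comp_assoc)

lemma sgen_o_cancel [simp]: "sgen i \<circ> (sgen i \<circ> w) = w"
  by (simp add: comp_assoc [symmetric])

lemma sgen_uminus [simp]: "sgen i (- j) = - sgen i j"
  by (cases "i = 0") (auto simp: sgen_Suc sgen_0)

lemma sgen_eq_iff [simp]: "sgen i a = sgen i b \<longleftrightarrow> a = b"
  by (metis sgen_invol)

lemma sgen_outside: "int i + 1 < \<bar>j\<bar> \<Longrightarrow> sgen i j = j"
  by (cases "i = 0") (auto simp: sgen_Suc sgen_0)

lemma sgen_abs_le_iff: "int i + 1 \<le> c \<Longrightarrow> \<bar>sgen i j\<bar> \<le> c \<longleftrightarrow> \<bar>j\<bar> \<le> c"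
  by (cases "i = 0") (auto simp: sgen_Suc sgen_0)

lemma sgen_zero_iff [simp]: "sgen i j = 0 \<longleftrightarrow> j = 0"
  by (cases "i = 0") (auto simp: sgen_Suc sgen_0)

lemma sgen_less_iff:
  assumes "0 < i" "\<not> (a = int i \<and> b = int i + 1)" "\<not> (a = int i + 1 \<and> b = int i)"
    "\<not> (a = - int i \<and> b = - int i - 1)" "\<not> (a = - int i - 1 \<and> b = - int i)"
  shows "sgen i a < sgen i b \<longleftrightarrow> a < b"
  using assms unfolding sgen_Suc[OF assms(1)] by (smt (verit) of_nat_0_less_iff)

lemma sgen0_less_iff:
  assumes "\<not> (a = 1 \<and> b = -1)" "\<not> (a = -1 \<and> b = 1)" "a \<noteq> 0" "b \<noteq> 0"
  shows "sgen 0 a < sgen 0 b \<longleftrightarrow> a < b"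
  using assms by (auto simp: sgen_0)

lemma inv_sgen [simp]: "inv (sgen i) = sgen i"
  by (rule inv_equality) auto

section \<open>The group of signed permutations\<close>

lemma WBC_uminus: "w \<in> WBC N \<Longrightarrow> w (- i) = - w i"
  by (simp add: WBC_def)

lemma WBC_0: "w \<in> WBC N \<Longrightarrow> w 0 = 0"
  using WBC_uminus[of w N 0] by simp

lemma WBC_outside: "w \<in> WBC N \<Longrightarrow> int N < \<bar>i\<bar> \<Longrightarrow> w i = i"
  by (simp add: WBC_def)

lemma WBC_bij: assumes "w \<in> WBC N" shows "bij w"
proof -
  let ?R = "{i. 1 \<le> \<bar>i\<bar> \<and> \<bar>i\<bar> \<le> int N}"
  have 1: "bij_betw w ?R ?R" using assms by (simp add: WBC_def)
  have 2: "bij_betw w (- ?R) (- ?R)"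
    using assms by (intro bij_betwI[where g = id]) (auto simp: WBC_def)
  have "bij_betw w (?R \<union> - ?R) (?R \<union> - ?R)"
    by (rule bij_betw_combine[OF 1 2]) auto
  then show ?thesis by simp
qed

lemma WBC_eq_iff: "w \<in> WBC N \<Longrightarrow> w a = w b \<longleftrightarrow> a = b"
  using WBC_bij by (metis bij_pointE)

lemma WBC_zero_iff: "w \<in> WBC N \<Longrightarrow> w a = 0 \<longleftrightarrow> a = 0"
  using WBC_eq_iff[of w N a 0] WBC_0[of w N] by simp

lemma WBC_abs_le_iff: assumes "w \<in> WBC N" shows "\<bar>w a\<bar> \<le> int N \<longleftrightarrow> \<bar>a\<bar> \<le> int N"
proof -
  let ?R = "{i. 1 \<le> \<bar>i\<bar> \<and> \<bar>i\<bar> \<le> int N}"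
  have 1: "bij_betw w ?R ?R" using assms by (simp add: WBC_def)
  show ?thesis
  proof
    assume "\<bar>w a\<bar> \<le> int N"
    show "\<bar>a\<bar> \<le> int N"
    proof (rule ccontr)
      assume "\<not> \<bar>a\<bar> \<le> int N"
      with WBC_outside[OF assms, of a] \<open>\<bar>w a\<bar> \<le> int N\<close> show False by simp
    qed
  next
    assume a: "\<bar>a\<bar> \<le> int N"
    show "\<bar>w a\<bar> \<le> int N"
    proof (cases "a = 0")
      case True then show ?thesis using WBC_0[OF assms] by simp
    next
      case False
      then have "a \<in> ?R" using a by auto
      then have "w a \<in> ?R" using 1 bij_betwE by blast
      then show ?thesis by simp
    qed
  qed
qed

lemma WBC_abs_eq_iff: "w \<in> WBC N \<Longrightarrow> \<bar>w a\<bar> = \<bar>w b\<bar> \<longleftrightarrow> \<bar>a\<bar> = \<bar>b\<bar>"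
  using WBC_eq_iff[of w N a b] WBC_eq_iff[of w N a "- b"] WBC_uminus[of w N b] by (simp add: abs_eq_iff)

lemma WBC_I:
  assumes "\<And>i. w (- i) = - w i" "bij w" "\<And>i. \<bar>i\<bar> > int N \<Longrightarrow> w i = i"
  shows "w \<in> WBC N"
proof -
  let ?R = "{i. 1 \<le> \<bar>i\<bar> \<and> \<bar>i\<bar> \<le> int N}"
  have w0: "w 0 = 0" using assms(1)[of 0] by simp
  have inj: "inj w" and surj: "surj w" using assms(2) by (auto simp: bij_def)
  have out: "w i = i" if "i \<notin> ?R" for i
    using that w0 assms(3)[of i] by (cases "i = 0") auto
  have "w ` ?R = ?R"
  proof
    show "w ` ?R \<subseteq> ?R"
    proof
      fix y assume "y \<in> w ` ?R"
      then obtain x where x: "y = w x" "x \<in> ?R" by blast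
      show "y \<in> ?R"
      proof (rule ccontr)
        assume y: "y \<notin> ?R"
        then have "w y = w x" using out[OF y] x by simp
        then have "y = x" using inj by (simp add: inj_eq)
        then show False using x y by simp
      qed
    qed
    show "?R \<subseteq> w ` ?R"
    proof
      fix y assume y: "y \<in> ?R"
      obtain x where x: "y = w x" using surj by (metis surjE)
      have "x \<in> ?R"
      proof (rule ccontr)
        assume "x \<notin> ?R"
        from out[OF this] this x y show False by simp
      qed
      then show "y \<in> w ` ?R" using x by simp
    qed
  qed
  then have "bij_betw w ?R ?R" using inj by (auto simp: bij_betw_def inj_on_def inj_def)
  then show ?thesis using assms(1) out by (simp add: WBC_def)
qed

lemma WBC_id: "id \<in> WBC N"
  by (rule WBC_I) auto

lemma WBC_comp: "v \<in> WBC N \<Longrightarrow> w \<in> WBC N \<Longrightarrow> v \<circ> w \<in> WBC N"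
  by (rule WBC_I) (auto simp: WBC_uminus WBC_outside intro: bij_comp WBC_bij)

lemma WBC_inv: assumes "w \<in> WBC N" shows "inv w \<in> WBC N"
proof (rule WBC_I)
  have b: "bij w" by (rule WBC_bij[OF assms])
  show "inv w (- i) = - inv w i" for i
    by (metis WBC_uminus[OF assms] b bij_inv_eq_iff)
  show "bij (inv w)" using b by (rule bij_imp_bij_inv)
  show "inv w i = i" if "int N < \<bar>i\<bar>" for i
    using WBC_outside[OF assms that] b by (metis bij_inv_eq_iff)
qed

lemma bij_sgen: "bij (sgen i)"
  by (rule involuntory_imp_bij) simp

lemma WBC_sgen: "i < N \<Longrightarrow> sgen i \<in> WBC N"
  by (rule WBC_I) (auto intro: bij_sgen sgen_outside)

lemma WBC_o_inv: "w \<in> WBC N \<Longrightarrow> w \<circ> inv w = id"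
  using WBC_bij[of w N] by (auto simp: fun_eq_iff bij_is_surj surj_f_inv_f)

text \<open>Right ascents: for i = 0 the comparison of w(-1) with w(1) becomes a sign condition. For
  involutions, left and right ascents coincide, so the same predicate serves for left multiplication
  in the index set.\<close>

definition asc :: "nat \<Rightarrow> sperm \<Rightarrow> bool" where
  "asc i w \<longleftrightarrow> (if i = 0 then 0 < w 1 else w (int i) < w (int i + 1))"

lemma asc_0: "asc 0 w \<longleftrightarrow> 0 < w 1"
  by (simp add: asc_def)

lemma asc_Suc: "0 < i \<Longrightarrow> asc i w \<longleftrightarrow> w (int i) < w (int i + 1)"
  by (simp add: asc_def)

lemma not_asc_0: "w \<in> WBC N \<Longrightarrow> \<not> asc 0 w \<longleftrightarrow> w 1 < 0"
  using WBC_zero_iff[of w N 1] by (auto simp: asc_0)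

lemma not_asc_Suc: "w \<in> WBC N \<Longrightarrow> 0 < i \<Longrightarrow> \<not> asc i w \<longleftrightarrow> w (int i + 1) < w (int i)"
  using WBC_eq_iff[of w N "int i" "int i + 1"] by (auto simp: asc_Suc)

lemma asc_o_sgen: "w \<in> WBC N \<Longrightarrow> asc i (w \<circ> sgen i) \<longleftrightarrow> \<not> asc i w"
  using not_asc_0[of w N] not_asc_Suc[of w N i] WBC_uminus[of w N 1]
  by (cases "i = 0") (simp_all add: asc_0 asc_Suc sgen_0 sgen_Suc)

definition invs :: "nat \<Rightarrow> sperm \<Rightarrow> (int \<times> int) set" where
  "invs N w = {(a, b). \<bar>a\<bar> \<le> int N \<and> \<bar>b\<bar> \<le> int N \<and> a \<noteq> 0 \<and> b \<noteq> 0 \<and> a < b \<and> w b < w a}"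

definition negs :: "nat \<Rightarrow> sperm \<Rightarrow> int set" where
  "negs N w = {a. 1 \<le> a \<and> a \<le> int N \<and> w a < 0}"

text \<open>Each positive root other than the roots of the coordinate reflections is represented by two
  pairs, each of those by one pair and one negated entry, so this is twice the number of inversions.\<close>
definition dlen :: "nat \<Rightarrow> sperm \<Rightarrow> nat" where
  "dlen N w = card (invs N w) + card (negs N w)"

lemma finite_invs: "finite (invs N w)"
  by (rule finite_subset[of _ "{- int N..int N} \<times> {- int N..int N}"]) (auto simp: invs_def)

lemma finite_negs: "finite (negs N w)"
  by (rule finite_subset[of _ "{1..int N}"]) (auto simp: negs_def)

text \<open>Applying s_i to both entries of a pair keeps their order unless s_i exchanges these
  entries; for s_0 this uses that 0 is excluded in \<open>invs\<close>. So the inversions of the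
  product are the transported ones together with (i, i+1) and (-i-1, -i); for i = 0 the gain is the
  pair (-1, 1) and the negated entry 1.\<close>

lemma dlen_o_sgen:
  assumes w: "w \<in> WBC N" and i: "i < N" and a: "asc i w"
  shows "dlen N (w \<circ> sgen i) = dlen N w + 2"
proof -
  let ?f = "\<lambda>(a, b). (sgen i a, sgen i b)"
  have inj: "inj ?f" by (auto simp: inj_def)
  have cf: "card (?f ` X) = card X" for X
    using inj by (metis card_image inj_on_subset subset_UNIV)
  have ff: "?f (?f p) = p" for p by (cases p) auto
  note le = sgen_abs_le_iff[of i "int N"]
  show ?thesis
  proof (cases "i = 0")
    case False
    have new: "invs N (w \<circ> sgen i) = ?f ` invs N w \<union> {(int i, int i + 1), (- int i - 1, - int i)}"
      (is "?L = ?R")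
    proof (intro set_eqI)
      fix p :: "int \<times> int"
      obtain a b where p: "p = (a, b)" by (cases p)
      have e: "p \<in> ?f ` invs N w \<longleftrightarrow> ?f p \<in> invs N w"
        by (metis (no_types, lifting) ff image_iff)
      consider "a = int i \<and> b = int i + 1" | "a = - int i - 1 \<and> b = - int i"
        | "a = int i + 1 \<and> b = int i" | "a = - int i \<and> b = - int i - 1"
        | "\<not> (a = int i \<and> b = int i + 1)" "\<not> (a = int i + 1 \<and> b = int i)"
    "\<not> (a = - int i \<and> b = - int i - 1)" "\<not> (a = - int i - 1 \<and> b = - int i)" by blast
      then show "p \<in> ?L \<longleftrightarrow> p \<in> ?R"
      proof cases
        case 1
        then show ?thesis using False a i p
          by (auto simp: invs_def asc_Suc sgen_Suc)
      next
        case 2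
        then show ?thesis using False a i p WBC_uminus[OF w, of "int i"] WBC_uminus[OF w, of "int i + 1"]
          by (auto simp: invs_def asc_Suc sgen_Suc)
      next
        case 3
        then show ?thesis unfolding Un_iff e using False a i p
          by (auto simp: invs_def asc_Suc sgen_Suc)
      next
        case 4
        then show ?thesis unfolding Un_iff e using False a i p WBC_uminus[OF w, of "int i"] WBC_uminus[OF w, of "int i + 1"]
          by (auto simp: invs_def asc_Suc sgen_Suc)
      next
        case 5
        have "a \<noteq> 0 \<and> b \<noteq> 0 \<longrightarrow> (sgen i a < sgen i b \<longleftrightarrow> a < b)"
          using sgen_less_iff[of i a b] 5 False by auto
        then show ?thesis unfolding Un_iff e using 5 p i le[of a] le[of b]
          by (auto simp: invs_def)
      qed
    qed
    have dis: "?f ` invs N w \<inter> {(int i, int i + 1), (- int i - 1, - int i)} = {}"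
    proof -
      have "p \<notin> ?f ` invs N w" if "p = (int i, int i + 1) \<or> p = (- int i - 1, - int i)" for p
      proof
        assume "p \<in> ?f ` invs N w"
        then have "?f p \<in> invs N w" by (metis (no_types, lifting) ff image_iff)
        with that False show False by (auto simp: invs_def sgen_Suc)
      qed
      then show ?thesis by blast
    qed
    have 1: "card (invs N (w \<circ> sgen i)) = card (invs N w) + 2"
      unfolding new using dis
      by (subst card_Un_disjoint) (auto simp: finite_invs cf)
    have "negs N (w \<circ> sgen i) = sgen i ` negs N w"
    proof (intro set_eqI)
      fix a :: int
      have e: "a \<in> sgen i ` negs N w \<longleftrightarrow> sgen i a \<in> negs N w"
        by (metis image_iff sgen_invol)
      show "a \<in> negs N (w \<circ> sgen i) \<longleftrightarrow> a \<in> sgen i ` negs N w"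
        unfolding e using i False by (auto simp: negs_def sgen_Suc)
    qed
    then have 2: "card (negs N (w \<circ> sgen i)) = card (negs N w)"
      by (simp add: card_image inj_on_def)
    show ?thesis using 1 2 by (simp add: dlen_def)
  next
    case True
    have new: "invs N (w \<circ> sgen i) = ?f ` invs N w \<union> {(- 1, 1)}"
      (is "?L = ?R")
    proof (intro set_eqI)
      fix p :: "int \<times> int"
      obtain a b where p: "p = (a, b)" by (cases p)
      have e: "p \<in> ?f ` invs N w \<longleftrightarrow> ?f p \<in> invs N w"
        by (metis (no_types, lifting) ff image_iff)
      consider "a = 1 \<and> b = -1" | "a = - 1 \<and> b = 1"
        | "\<not> (a = 1 \<and> b = -1)" "\<not> (a = -1 \<and> b = 1)" by blast
      then show "p \<in> ?L \<longleftrightarrow> p \<in> ?R"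
      proof cases
        case 1
        then show ?thesis unfolding Un_iff e using True a i p WBC_uminus[OF w, of 1]
          by (auto simp: invs_def asc_0 sgen_0)
      next
        case 2
        then show ?thesis using True a i p WBC_uminus[OF w, of 1]
          by (auto simp: invs_def asc_0 sgen_0)
      next
        case 3
        have "a \<noteq> 0 \<and> b \<noteq> 0 \<longrightarrow> (sgen i a < sgen i b \<longleftrightarrow> a < b)"
          using sgen0_less_iff[of a b] 3 True by auto
        then show ?thesis unfolding Un_iff e using 3 p i le[of a] le[of b]
          by (auto simp: invs_def)
      qed
    qed
    have dis: "(-1, 1) \<notin> ?f ` invs N w"
      using True by (auto simp: invs_def sgen_0 split: if_splits)
    have 1: "card (invs N (w \<circ> sgen i)) = card (invs N w) + 1"
      unfolding new using dis
      by (simp add: finite_invs cf)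
    have new: "negs N (w \<circ> sgen i) = insert 1 (negs N w)"
      using a i True WBC_uminus[OF w, of 1] by (auto simp: negs_def sgen_0 asc_0)
    have "1 \<notin> negs N w" using a True by (auto simp: negs_def asc_0)
    then have 2: "card (negs N (w \<circ> sgen i)) = card (negs N w) + 1"
      unfolding new by (simp add: finite_negs)
    show ?thesis using 1 2 by (simp add: dlen_def)
  qed
qed

lemma dlen_o_sgen_desc:
  assumes w: "w \<in> WBC N" and i: "i < N" and a: "\<not> asc i w"
  shows "dlen N w = dlen N (w \<circ> sgen i) + 2"
  using dlen_o_sgen[of "w \<circ> sgen i" N i] assms asc_o_sgen[OF w, of i]
    WBC_comp[OF w WBC_sgen[OF i]] by simp

lemma dlen_id: "dlen N id = 0"
proof -
  have "invs N id = {}" "negs N id = {}" by (auto simp: invs_def negs_def)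
  then show ?thesis by (simp add: dlen_def)
qed

text \<open>The maps (a, b) -> (w b, w a) and a -> - w a carry inversions and negated entries of w
  to those of its inverse. This turns statements on right multiplication into statements on left
  multiplication.\<close>

lemma dlen_inv: assumes w: "w \<in> WBC N" shows "dlen N (inv w) = dlen N w"
proof -
  have w': "inv w \<in> WBC N" by (rule WBC_inv[OF w])
  have i1: "inv w (w a) = a" for a using WBC_bij[OF w] by (simp add: bij_is_inj)
  have i2: "w (inv w a) = a" for a using WBC_bij[OF w] by (simp add: bij_is_surj surj_f_inv_f)
  have A: "bij_betw (\<lambda>(a, b). (w b, w a)) (invs N w) (invs N (inv w))"
    by (rule bij_betwI[where g = "\<lambda>(a, b). (inv w b, inv w a)"])
      (auto simp: invs_def i1 i2 WBC_abs_le_iff[OF w] WBC_abs_le_iff[OF w'] WBC_zero_iff[OF w] WBC_zero_iff[OF w'])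
  have B: "bij_betw (\<lambda>a. - w a) (negs N w) (negs N (inv w))"
  proof (rule bij_betwI[where g = "\<lambda>a. - inv w a"])
    show "(\<lambda>a. - w a) \<in> negs N w \<rightarrow> negs N (inv w)"
      using WBC_abs_le_iff[OF w] by (auto simp: negs_def WBC_uminus[OF w'] i1)
        (smt (verit))
    show "(\<lambda>a. - inv w a) \<in> negs N (inv w) \<rightarrow> negs N w"
      using WBC_abs_le_iff[OF w'] by (auto simp: negs_def WBC_uminus[OF w] i2)
        (smt (verit))
  qed (auto simp: WBC_uminus[OF w'] WBC_uminus[OF w] i1 i2)
  show ?thesis unfolding dlen_def using bij_betw_same_card[OF A] bij_betw_same_card[OF B] by simp
qed

text \<open>Since w(1) is positive and w increases, w(j) >= j by upward induction; since w(N) <= N,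
  also w(j) <= j by downward induction.\<close>

lemma all_asc_imp_id:
  assumes w: "w \<in> WBC N" and a: "\<And>i. i < N \<Longrightarrow> asc i w"
  shows "w = id"
proof -
  have ge: "int (Suc j) \<le> w (int (Suc j))" if "Suc j \<le> N" for j
    using that
  proof (induction j)
    case 0
    then show ?case using a[of 0] by (simp add: asc_0)
  next
    case (Suc j)
    then have "w (int (Suc j)) < w (int (Suc j) + 1)" using a[of "Suc j"] asc_Suc[of "Suc j" w] by simp
    then show ?case using Suc by (simp add: add.commute)
  qed
  have le: "w (int (N - j)) \<le> int (N - j)" if "j < N" for j
    using that
  proof (induction j)
    case 0
    then show ?case using WBC_abs_le_iff[OF w, of "int N"] by simp
  next
    case (Suc j)
    have "w (int (N - Suc j)) < w (int (N - Suc j) + 1)"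
      using a[of "N - Suc j"] Suc.prems by (simp add: asc_Suc)
    moreover have "int (N - Suc j) + 1 = int (N - j)" using Suc.prems by simp
    ultimately show ?case using Suc by simp
  qed
  have pos: "w i = i" if "1 \<le> i" "i \<le> int N" for i
  proof -
    define k where "k = nat (i - 1)"
    have k: "i = int (Suc k)" "Suc k \<le> N" using that by (auto simp: k_def)
    show ?thesis using ge[of k] le[of "N - Suc k"] k by simp
  qed
  have "w i = i" for i
  proof -
    consider "1 \<le> i \<and> i \<le> int N" | "1 \<le> - i \<and> - i \<le> int N" | "i = 0" | "int N < \<bar>i\<bar>" by linarith
    then show ?thesis
    proof cases
      case 2
      then show ?thesis using pos[of "- i"] WBC_uminus[OF w, of i] by simp
    qed (use pos WBC_0[OF w] WBC_outside[OF w] in auto)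
  qed
  then show ?thesis by auto
qed

lemma inv_sgen_o: "w \<in> WBC N \<Longrightarrow> inv (sgen i \<circ> w) = inv w \<circ> sgen i"
  by (simp add: o_inv_distrib WBC_bij bij_sgen)

lemma inv_o_sgen: "w \<in> WBC N \<Longrightarrow> inv (w \<circ> sgen i) = sgen i \<circ> inv w"
  by (simp add: o_inv_distrib WBC_bij bij_sgen)

lemma dlen_sgen_o:
  assumes w: "w \<in> WBC N" and i: "i < N"
  shows "if asc i (inv w) then dlen N (sgen i \<circ> w) = dlen N w + 2 else dlen N w = dlen N (sgen i \<circ> w) + 2"
proof -
  have w': "inv w \<in> WBC N" by (rule WBC_inv[OF w])
  have "sgen i \<circ> w \<in> WBC N" using w i by (simp add: WBC_comp WBC_sgen)
  from dlen_inv[OF this] have "dlen N (inv w \<circ> sgen i) = dlen N (sgen i \<circ> w)"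
    by (simp add: inv_sgen_o[OF w])
  then show ?thesis
    using dlen_o_sgen[OF w' i] dlen_o_sgen_desc[OF w' i] dlen_inv[OF w] by auto
qed

section \<open>Reduced words and the Coxeter length\<close>

lemma wordprod_Nil: "wordprod [] = id"
  by (simp add: wordprod_def fun_eq_iff)

lemma wordprod_Cons: "wordprod (i # ws) = sgen i \<circ> wordprod ws"
  by (simp add: wordprod_def)

lemma WBC_wordprod: "set ws \<subseteq> {..<N} \<Longrightarrow> wordprod ws \<in> WBC N"
  by (induction ws) (simp_all add: wordprod_Nil wordprod_Cons WBC_comp WBC_sgen WBC_id)

lemma dlen_wordprod_le: "set ws \<subseteq> {..<N} \<Longrightarrow> dlen N (wordprod ws) \<le> 2 * length ws"
proof (induction ws)
  case Nil
  then show ?case by (simp only: wordprod_Nil dlen_id)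
next
  case (Cons i ws)
  then have *: "set ws \<subseteq> {..<N}" "i < N" "dlen N (wordprod ws) \<le> 2 * length ws" by auto
  have "dlen N (sgen i \<circ> wordprod ws) \<le> 2 * length ws + 2"
    using dlen_sgen_o[OF WBC_wordprod[OF *(1)] *(2)] *(3) by (simp split: if_splits)
  then show ?case by (simp add: wordprod_Cons comp_def)
qed

text \<open>Left descents are split off one at a time, each lowering \<open>dlen\<close> by 2; by
  \<open>all_asc_imp_id\<close> this ends only at the identity.\<close>

lemma ex_word:
  assumes "w \<in> WBC N"
  shows "\<exists>ws. 2 * length ws = dlen N w \<and> set ws \<subseteq> {..<N} \<and> wordprod ws = w"
  using assms
proof (induction "dlen N w" arbitrary: w rule: less_induct)
  case less
  show ?case
  proof (cases "\<forall>i<N. asc i (inv w)")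
    case True
    then have "inv w = id" using all_asc_imp_id[OF WBC_inv[OF less.prems]] by blast
    then have "w = id" using WBC_o_inv[OF less.prems] by simp
    then show ?thesis by (intro exI[of _ "[]"]) (simp add: wordprod_Nil dlen_id)
  next
    case False
    then obtain i where i: "i < N" "\<not> asc i (inv w)" by blast
    have *: "dlen N w = dlen N (sgen i \<circ> w) + 2" using dlen_sgen_o[OF less.prems i(1)] i(2) by simp
    have "sgen i \<circ> w \<in> WBC N" using less.prems i by (simp add: WBC_comp WBC_sgen)
    from less.hyps[OF _ this] * obtain ws where
      "2 * length ws = dlen N (sgen i \<circ> w)" "set ws \<subseteq> {..<N}" "wordprod ws = sgen i \<circ> w" by auto
    then show ?thesis using i * by (intro exI[of _ "i # ws"]) (simp add: wordprod_Cons)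
  qed
qed

lemma double_len: assumes w: "w \<in> WBC N" shows "2 * len N w = dlen N w"
proof -
  obtain ws where ws: "2 * length ws = dlen N w" "set ws \<subseteq> {..<N}" "wordprod ws = w"
    using ex_word[OF w] by blast
  have "len N w = length ws"
    unfolding len_def
  proof (rule Least_equality)
    show "\<exists>vs. length vs = length ws \<and> set vs \<subseteq> {..<N} \<and> wordprod vs = w" using ws by blast
    show "length ws \<le> k" if "\<exists>vs. length vs = k \<and> set vs \<subseteq> {..<N} \<and> wordprod vs = w" for k
    proof -
      from that obtain vs where vs: "length vs = k" "set vs \<subseteq> {..<N}" "wordprod vs = w" by blast
      show ?thesis using dlen_wordprod_le[OF vs(2)] vs ws by simp
    qed
  qed
  then show ?thesis using ws by simp
qed

section \<open>Combinatorics of the index set\<close>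

lemma sgen_fixed: "\<bar>k\<bar> \<noteq> int i \<Longrightarrow> \<bar>k\<bar> \<noteq> int i + 1 \<Longrightarrow> sgen i k = k"
  by (cases "i = 0") (auto simp: sgen_Suc sgen_0)

lemma GBC_WBC: "z \<in> GBC n \<Longrightarrow> z \<in> WBC (2 * n)"
  by (simp add: GBC_def)

lemma GBC_invol: "z \<in> GBC n \<Longrightarrow> z (z i) = i"
  by (simp add: GBC_def) (metis comp_apply id_apply)

lemma GBC_uminus: "z \<in> GBC n \<Longrightarrow> z (- i) = - z i"
  using GBC_WBC WBC_uminus by blast

lemma GBC_eq_iff: "z \<in> GBC n \<Longrightarrow> z a = z b \<longleftrightarrow> a = b"
  by (metis GBC_invol)

lemma GBC_swap: "z \<in> GBC n \<Longrightarrow> z a = b \<longleftrightarrow> z b = a"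
  by (metis GBC_invol)

lemma GBC_zero_iff: "z \<in> GBC n \<Longrightarrow> z a = 0 \<longleftrightarrow> a = 0"
  using GBC_WBC WBC_zero_iff by blast

lemma GBC_abs_le_iff: "z \<in> GBC n \<Longrightarrow> \<bar>z a\<bar> \<le> 2 * int n \<longleftrightarrow> \<bar>a\<bar> \<le> 2 * int n"
  using WBC_abs_le_iff[of z "2 * n" a] GBC_WBC[of z n] by simp

lemma GBC_outside: "z \<in> GBC n \<Longrightarrow> 2 * int n < \<bar>i\<bar> \<Longrightarrow> z i = i"
  using WBC_outside[of z "2 * n" i] GBC_WBC[of z n] by simp

lemma GBC_nofix: assumes "z \<in> GBC n" "i \<noteq> 0" "\<bar>i\<bar> \<le> 2 * int n" shows "\<bar>z i\<bar> \<noteq> \<bar>i\<bar>"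
proof -
  have *: "\<bar>z j\<bar> \<noteq> j" if "1 \<le> j" "j \<le> 2 * int n" for j using assms that by (simp add: GBC_def)
  show ?thesis
    using *[of "\<bar>i\<bar>"] assms GBC_uminus[OF assms(1), of i] by (cases "i > 0") auto
qed

lemma GBC_visdesc:
  assumes "z \<in> GBC n" "int n < i"
  shows "min i (z i) \<le> z (i + 1)" "- i \<le> z i"
proof -
  have "\<not> visdesc z i" using assms by (simp add: GBC_def)
  then show "min i (z i) \<le> z (i + 1)" "- i \<le> z i" using assms by (auto simp: visdesc_def)
qed

lemma finite_GBC: "finite (GBC n)"
proof -
  let ?R = "{- 2 * int n..2 * int n}"
  have "inj_on (\<lambda>z. restrict z ?R) (GBC n)"
  proof (rule inj_onI)
    fix y z assume yz: "y \<in> GBC n" "z \<in> GBC n" "restrict y ?R = restrict z ?R"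
    show "y = z"
    proof
      fix i show "y i = z i"
      proof (cases "i \<in> ?R")
        case True then show ?thesis using yz(3) by (metis restrict_apply')
      next
        case False then show ?thesis using GBC_outside[OF yz(1), of i] GBC_outside[OF yz(2), of i] by auto
      qed
    qed
  qed
  moreover have "(\<lambda>z. restrict z ?R) ` GBC n \<subseteq> Pi\<^sub>E ?R (\<lambda>_. ?R)"
  proof -
    have "z i \<in> ?R" if "z \<in> GBC n" "i \<in> ?R" for z i
      using GBC_abs_le_iff[OF that(1), of i] that(2) by auto
    then show ?thesis by auto
  qed
  ultimately show ?thesis
    by (metis finite_PiE finite_atLeastAtMost_int finite_imageD finite_subset)
qed

text \<open>Both functions enumerate the common image in increasing order. This recovers a tail from
  its set of values.\<close>

lemma strict_mono_image_unique:
  fixes f g :: "int \<Rightarrow> int"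
  assumes f: "\<And>i j. a \<le> i \<Longrightarrow> i < j \<Longrightarrow> j \<le> b \<Longrightarrow> f i < f j"
    and g: "\<And>i j. a \<le> i \<Longrightarrow> i < j \<Longrightarrow> j \<le> b \<Longrightarrow> g i < g j"
    and fg: "f ` {a..b} = g ` {a..b}" and i: "a \<le> i" "i \<le> b"
  shows "f i = g i"
proof -
  have *: "sorted_wrt (<) (map h [a..b])" if "\<And>i j. a \<le> i \<Longrightarrow> i < j \<Longrightarrow> j \<le> b \<Longrightarrow> h i < h j"
    for h :: "int \<Rightarrow> int"
    unfolding sorted_wrt_map
    by (rule sorted_wrt_mono_rel[OF _ sorted_wrt_upto]) (auto intro: that)
  have "map f [a..b] = map g [a..b]"
    using *[of f] *[of g] f g fg
    by (intro sorted_distinct_set_unique) (auto simp: strict_sorted_iff)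
  then show ?thesis using i by simp
qed

subsection \<open>The tail of an element\<close>

text \<open>If z(i) is not i + 1, the absence of visible descents keeps z(l) > i for all l from i +
  1 to z(i); at l = z(i) this contradicts z(z(i)) = i.\<close>

lemma tail_pair_aux:
  assumes z: "z \<in> GBC n" and i: "int n < i" "i < z i"
  shows "z i = i + 1"
proof (rule ccontr)
  assume ne: "z i \<noteq> i + 1"
  have "l \<le> z i \<longrightarrow> i < z l" if "i + 1 \<le> l" for l
    using that
  proof (induction l rule: int_ge_induct)
    case base
    have "i \<le> z (i + 1)" using GBC_visdesc(1)[OF z i(1)] i by auto
    moreover have "z (i + 1) \<noteq> i" using ne GBC_swap[OF z] by metis
    ultimately show ?case by simp
  next
    case (step l)
    then show ?case using GBC_visdesc(1)[OF z, of l] i by auto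
  qed
  from this[of "z i"] show False using i GBC_invol[OF z, of i] by auto
qed

text \<open>A negative value z(i) = -m gives z(m) = -i, and the lower bounds for visible descents at
  i and at m force m = i, which is excluded. For positive values \<open>tail_pair_aux\<close>
  applies to i or to z(i).\<close>

lemma tail_pair:
  assumes z: "z \<in> GBC n" and i: "int n < i" "i \<le> 2 * int n" "int n < \<bar>z i\<bar>"
  shows "z i = i + 1 \<or> z i = i - 1"
proof -
  have nf: "\<bar>z i\<bar> \<noteq> i" using GBC_nofix[OF z, of i] i by auto
  have "0 < z i"
  proof (rule ccontr)
    assume "\<not> 0 < z i"
    then have neg: "z i < 0" using i by auto
    have "z (- z i) = - i" using GBC_uminus[OF z] GBC_invol[OF z] by metis
    then show False using GBC_visdesc(2)[OF z, of i] GBC_visdesc(2)[OF z, of "- z i"] neg i nf by auto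
  qed
  then consider "i < z i" | "z i < i" using nf by fastforce
  then show ?thesis
  proof cases
    case 1
    then show ?thesis using tail_pair_aux[OF z i(1)] by simp
  next
    case 2
    then show ?thesis using tail_pair_aux[OF z, of "z i"] GBC_invol[OF z, of i] i \<open>0 < z i\<close> by auto
  qed
qed

lemma tail_seg:
  assumes z: "z \<in> GBC n" and i: "int n < i" "i + 1 \<le> 2 * int n" "int n < \<bar>z i\<bar>"
  shows "int n < \<bar>z (i + 1)\<bar>"
proof -
  from tail_pair[OF z i(1) _ i(3)] i have "z i = i + 1 \<or> z i = i - 1" by simp
  then show ?thesis
  proof
    assume "z i = i + 1"
    then have "z (i + 1) = i" using GBC_invol[OF z, of i] by simp
    then show ?thesis using i by simp
  next
    assume "z i = i - 1"
    then show ?thesis using GBC_visdesc(1)[OF z i(1)] i by auto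
  qed
qed

text \<open>By \<open>tail_seg\<close>, a place beyond n which z sends into \<plusminus>[n] is
  preceded, beyond n, only by such places. There min{i, z(i)} is z(i), so the absence of visible
  descents is just monotonicity.\<close>

lemma tail_strict:
  assumes z: "z \<in> GBC n" and ij: "int n < i" "i < j" "\<bar>z j\<bar> \<le> int n"
  shows "\<bar>z i\<bar> \<le> int n \<and> z i < z j"
proof -
  have "\<bar>z j\<bar> \<le> int n \<longrightarrow> \<bar>z i\<bar> \<le> int n \<and> z i < z j" if "i + 1 \<le> j" for j
    using that
  proof (induction j rule: int_ge_induct)
    case base
    show ?case
    proof
      assume a: "\<bar>z (i + 1)\<bar> \<le> int n"
      have "i + 1 \<le> 2 * int n" using a GBC_outside[OF z, of "i + 1"] ij by (cases "i + 1 \<le> 2 * int n") auto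
      then have "\<bar>z i\<bar> \<le> int n" using tail_seg[OF z ij(1)] a by force
      moreover have "z i \<noteq> z (i + 1)" using GBC_eq_iff[OF z] by simp
      ultimately show "\<bar>z i\<bar> \<le> int n \<and> z i < z (i + 1)" using GBC_visdesc(1)[OF z ij(1)] a ij by auto
    qed
  next
    case (step j)
    show ?case
    proof
      assume a: "\<bar>z (j + 1)\<bar> \<le> int n"
      have j: "int n < j" using step ij by simp
      have "j + 1 \<le> 2 * int n" using a GBC_outside[OF z, of "j + 1"] j by (cases "j + 1 \<le> 2 * int n") auto
      then have *: "\<bar>z j\<bar> \<le> int n" using tail_seg[OF z j] a by force
      moreover have "z j \<noteq> z (j + 1)" using GBC_eq_iff[OF z] by simp
      ultimately show "\<bar>z i\<bar> \<le> int n \<and> z i < z (j + 1)" using GBC_visdesc(1)[OF z j] a j step by auto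
    qed
  qed
  from this[of j] show ?thesis using ij by simp
qed

text \<open>For \<open>z = under n w\<close> this is \<open>{- a\<^sub>1, \<dots>, - a\<^sub>p, b\<^sub>1, \<dots>, b\<^sub>q}\<close>, the set of values of \<open>z\<close> on its tail
  \<open>{n + 1, \<dots>, n + p + q}\<close>.\<close>
definition tset :: "nat \<Rightarrow> sperm \<Rightarrow> int set" where
  "tset n z = {t. \<bar>t\<bar> \<le> int n \<and> int n < z t}"

definition kap :: "nat \<Rightarrow> sperm \<Rightarrow> nat" where
  "kap n z = card (tset n z)"

lemma finite_tset: "finite (tset n z)"
  by (rule finite_subset[of _ "{- int n..int n}"]) (auto simp: tset_def)

lemma tail_positions:
  assumes z: "z \<in> GBC n"
  shows "{i. int n < i \<and> \<bar>z i\<bar> \<le> int n} = {int n + 1..int n + int (kap n z)}" (is "?B = _")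
proof -
  have bij: "bij_betw z ?B (tset n z)"
    by (rule bij_betwI[where g = z]) (auto simp: tset_def GBC_invol[OF z])
  then have card: "card ?B = kap n z" by (simp add: kap_def bij_betw_same_card)
  have fin: "finite ?B" using bij finite_tset by (metis bij_betw_finite)
  show ?thesis
  proof (cases "?B = {}")
    case True
    then have "kap n z = 0" using card by (simp only: card.empty)
    then show ?thesis using True by auto
  next
    case False
    let ?M = "Max ?B"
    have M: "?M \<in> ?B" using Max_in[OF fin False] .
    have "?B = {int n + 1..?M}"
    proof
      show "?B \<subseteq> {int n + 1..?M}" using Max_ge[OF fin] by auto
      show "{int n + 1..?M} \<subseteq> ?B"
      proof
        fix i assume i: "i \<in> {int n + 1..?M}"
        show "i \<in> ?B"
        proof (cases "i = ?M")
          case False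
          then show ?thesis using tail_strict[OF z, of i ?M] i M by auto
        qed (use M in simp)
      qed
    qed
    moreover from this have "card ?B = card {int n + 1..?M}" by (rule arg_cong)
    then have "?M = int n + int (kap n z)" using M card by simp
    ultimately show ?thesis by simp
  qed
qed

lemma tail_iff: "z \<in> GBC n \<Longrightarrow> int n < i \<Longrightarrow> \<bar>z i\<bar> \<le> int n \<longleftrightarrow> i \<le> int n + int (kap n z)"
  using tail_positions[of z n] by (simp add: set_eq_iff) (smt (verit))

lemma tail_image: assumes z: "z \<in> GBC n"
  shows "z ` {int n + 1..int n + int (kap n z)} = tset n z"
  unfolding tail_positions[OF z, symmetric]
proof
  show "z ` {i. int n < i \<and> \<bar>z i\<bar> \<le> int n} \<subseteq> tset n z" by (auto simp: tset_def GBC_invol[OF z])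
  show "tset n z \<subseteq> z ` {i. int n < i \<and> \<bar>z i\<bar> \<le> int n}"
  proof
    fix t assume "t \<in> tset n z"
    then have "z t \<in> {i. int n < i \<and> \<bar>z i\<bar> \<le> int n}" by (auto simp: tset_def GBC_invol[OF z])
    then show "t \<in> z ` {i. int n < i \<and> \<bar>z i\<bar> \<le> int n}" using GBC_invol[OF z, of t] by (metis imageI)
  qed
qed

lemma kap_le: assumes z: "z \<in> GBC n" shows "kap n z \<le> n"
proof (cases "kap n z = 0")
  case False
  then have "int n < int n + int (kap n z)" by simp
  then have "\<bar>z (int n + int (kap n z))\<bar> \<le> int n" using tail_iff[OF z] by simp
  then have "int n + int (kap n z) \<le> 2 * int n"
    using GBC_outside[OF z, of "int n + int (kap n z)"] by (cases "int n + int (kap n z) \<le> 2 * int n") auto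
  then show ?thesis by simp
qed simp

text \<open>Beyond the tail every place is exchanged with a neighbour. The first one cannot be
  paired to the left, so the pairing is forced from left to right.\<close>

lemma tail_end:
  assumes z: "z \<in> GBC n" and i: "int n + int (kap n z) < i" "i \<le> 2 * int n"
  shows "z i = (if odd (i - int n - int (kap n z)) then i + 1 else i - 1)"
proof -
  have nt: "z j = j + 1 \<or> z j = j - 1" "int n < \<bar>z j\<bar>" if "int n + int (kap n z) < j" "j \<le> 2 * int n" for j
    using tail_pair[OF z, of j] tail_iff[OF z, of j] that by auto
  have "i \<le> 2 * int n \<longrightarrow> z i = (if odd (i - int n - int (kap n z)) then i + 1 else i - 1)"
    if "int n + int (kap n z) + 1 \<le> i" for i
    using that
  proof (induction i rule: int_ge_induct)
    case base
    let ?i = "int n + int (kap n z) + 1"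
    show ?case
    proof
      assume a: "?i \<le> 2 * int n"
      have "z ?i \<noteq> ?i - 1"
      proof
        assume e: "z ?i = ?i - 1"
        then have "int n < ?i - 1" using nt(2)[of ?i] a by simp
        then have "\<bar>z (?i - 1)\<bar> \<le> int n" using tail_iff[OF z, of "?i - 1"] by simp
        moreover have "z (?i - 1) = ?i" using e GBC_invol[OF z, of ?i] by simp
        ultimately show False by simp
      qed
      then show "z ?i = (if odd (?i - int n - int (kap n z)) then ?i + 1 else ?i - 1)"
        using nt(1)[of ?i] a by auto
    qed
  next
    case (step i)
    show ?case
    proof
      assume a: "i + 1 \<le> 2 * int n"
      then have IH: "z i = (if odd (i - int n - int (kap n z)) then i + 1 else i - 1)" using step by simp
      show "z (i + 1) = (if odd (i + 1 - int n - int (kap n z)) then i + 1 + 1 else i + 1 - 1)"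
      proof (cases "odd (i - int n - int (kap n z))")
        case True
        then have "z (i + 1) = i" using IH GBC_invol[OF z, of i] by simp
        then show ?thesis using True by auto
      next
        case False
        then have "z i = i - 1" using IH by simp
        then have "z (i + 1) \<noteq> i" using GBC_invol[OF z, of "i + 1"] by auto
        then show ?thesis using nt(1)[of "i + 1"] a False step by auto
      qed
    qed
  qed
  then show ?thesis using i by simp
qed

text \<open>The data determine \<open>tset\<close>, hence \<open>kap\<close>. The tail is
  increasing, so its image determines it; after the tail \<open>tail_end\<close> leaves no choice.
  The values at the points of [n] which leave it then follow from involutivity.\<close>

lemma GBC_eqI:
  assumes y: "y \<in> GBC n" and z: "z \<in> GBC n"
    and a: "\<And>j. j \<noteq> 0 \<Longrightarrow> \<bar>j\<bar> \<le> int n \<Longrightarrow> \<bar>y j\<bar> \<le> int n \<Longrightarrow> z j = y j"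
    and b: "\<And>j. j \<noteq> 0 \<Longrightarrow> \<bar>j\<bar> \<le> int n \<Longrightarrow> int n < \<bar>y j\<bar> \<Longrightarrow> int n < \<bar>z j\<bar> \<and> (0 < y j \<longleftrightarrow> 0 < z j)"
  shows "y = z"
proof -
  have y0: "y 0 = 0" and z0: "z 0 = 0" using GBC_zero_iff[OF y] GBC_zero_iff[OF z] by auto
  have T: "tset n y = tset n z"
  proof -
    have "int n < y t \<longleftrightarrow> int n < z t" if "\<bar>t\<bar> \<le> int n" for t
    proof -
      consider "t = 0" | "t \<noteq> 0" "\<bar>y t\<bar> \<le> int n" | "t \<noteq> 0" "int n < \<bar>y t\<bar>" by linarith
      then show ?thesis
      proof cases
        case 1 then show ?thesis using y0 z0 by simp
      next
        case 2 then show ?thesis using a[OF 2(1) that 2(2)] by simp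
      next
        case 3 then show ?thesis using b[OF 3(1) that 3(2)] by arith
      qed
    qed
    then show ?thesis by (auto simp: tset_def)
  qed
  then have k: "kap n y = kap n z" by (simp add: kap_def)
  have tail: "y i = z i" if "int n < i" "i \<le> int n + int (kap n z)" for i
  proof (rule strict_mono_image_unique[where a = "int n + 1" and b = "int n + int (kap n z)" and f = y and g = z])
    show "y i < y j" if "int n + 1 \<le> i" "i < j" "j \<le> int n + int (kap n z)" for i j
      using tail_strict[OF y, of i j] tail_iff[OF y, of j] k that by auto
    show "z i < z j" if "int n + 1 \<le> i" "i < j" "j \<le> int n + int (kap n z)" for i j
      using tail_strict[OF z, of i j] tail_iff[OF z, of j] that by auto
    show "y ` {int n + 1..int n + int (kap n z)} = z ` {int n + 1..int n + int (kap n z)}"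
      using tail_image[OF y] tail_image[OF z] k T by simp
  qed (use that in auto)
  have high: "y i = z i" if "int n < i" for i
  proof -
    consider "i \<le> int n + int (kap n z)" | "int n + int (kap n z) < i" "i \<le> 2 * int n" | "2 * int n < i" by linarith
    then show ?thesis
    proof cases
      case 2
      then show ?thesis using tail_end[OF y, of i] tail_end[OF z, of i] k by simp
    next
      case 3
      then show ?thesis using GBC_outside[OF y, of i] GBC_outside[OF z, of i] by auto
    qed (use tail that in auto)
  qed
  have low: "y i = z i" if "i \<noteq> 0" "\<bar>i\<bar> \<le> int n" for i
  proof -
    consider "\<bar>y i\<bar> \<le> int n" | "int n < y i" | "int n < - y i" by linarith
    then show ?thesis
    proof cases
      case 1
      then show ?thesis using a[of i] that by simp
    next
      case 2
      from high[OF this] have "z (y i) = i" using GBC_invol[OF y, of i] by simp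
      then show ?thesis using GBC_invol[OF z, of "y i"] by simp
    next
      case 3
      from high[OF this] have "z (- y i) = - i" using GBC_invol[OF y, of i] GBC_uminus[OF y, of "y i"] by simp
      then have "z (y i) = i" using GBC_uminus[OF z, of "y i"] by simp
      then show ?thesis using GBC_invol[OF z, of "y i"] by simp
    qed
  qed
  show ?thesis
  proof
    fix i
    consider "i = 0" | "i \<noteq> 0" "\<bar>i\<bar> \<le> int n" | "int n < i" | "int n < - i" by linarith
    then show "y i = z i"
    proof cases
      case 4
      then show ?thesis using high[of "- i"] GBC_uminus[OF y, of i] GBC_uminus[OF z, of i] by simp
    qed (use y0 z0 low high in auto)
  qed
qed

subsection \<open>Ascents and descents\<close>

definition mv :: "nat \<Rightarrow> sperm \<Rightarrow> sperm" where
  "mv i z = sgen i \<circ> z \<circ> sgen i"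

text \<open>This and \<open>eqa\<close> are weak descents and weak ascents, read off from the values
  at i and i + 1 (\<open>DesEq_iff\<close>, \<open>AscEq_iff\<close>). The index 0 is excluded
  because s_0 is never weak.\<close>

definition eqd :: "nat \<Rightarrow> sperm \<Rightarrow> bool" where
  "eqd i z \<longleftrightarrow> i \<noteq> 0 \<and> \<bar>z (int i)\<bar> = int i + 1"

definition eqa :: "nat \<Rightarrow> nat \<Rightarrow> sperm \<Rightarrow> bool" where
  "eqa n i z \<longleftrightarrow> i \<noteq> 0 \<and> int n < \<bar>z (int i)\<bar> \<and> int n < \<bar>z (int i + 1)\<bar> \<and> (0 < z (int i) \<longleftrightarrow> 0 < z (int i + 1))"

lemma mv_mv [simp]: "mv i (mv i z) = z"
  by (simp add: mv_def fun_eq_iff)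

lemma mv_apply: "mv i z j = sgen i (z (sgen i j))"
  by (simp add: mv_def)

lemma eqd_eqa: "i < n \<Longrightarrow> eqd i z \<Longrightarrow> \<not> eqa n i z"
  by (simp add: eqd_def eqa_def)

lemma eqd_swap:
  assumes z: "z \<in> GBC n" and e: "eqd i z"
  shows "(z (int i) = int i + 1 \<and> z (int i + 1) = int i) \<or> (z (int i) = - (int i + 1) \<and> z (int i + 1) = - int i)"
proof -
  have "z (int i) = int i + 1 \<or> z (int i) = - (int i + 1)" using e by (auto simp: eqd_def)
  then show ?thesis
    using GBC_invol[OF z, of "int i"] GBC_uminus[OF z, of "int i + 1"] by auto
qed

text \<open>The tail is strictly increasing, so the consecutive values i and i + 1 are taken at
  consecutive places. If both images are negative, the same argument applies to -i - 1 and
  -i.\<close>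

lemma eqa_adjacent:
  assumes z: "z \<in> GBC n" and i: "i < n" and e: "eqa n i z"
  shows "z (int i + 1) = z (int i) + 1"
proof -
  have key: "b = a + 1" if ab: "int n < a" "int n < b" "z b = z a + 1" "\<bar>z a\<bar> \<le> int n" "\<bar>z b\<bar> \<le> int n" for a b
  proof (rule ccontr)
    assume ne: "b \<noteq> a + 1"
    have "a < b"
    proof (rule ccontr)
      assume "\<not> a < b"
      then have "b < a" using ab by (cases "a = b") auto
      then show False using tail_strict[OF z, of b a] ab by simp
    qed
    then have "a + 1 < b" using ne by simp
    then show False using tail_strict[OF z, of "a + 1" b] tail_strict[OF z, of a "a + 1"] ab by simp
  qed
  show ?thesis
  proof (cases "0 < z (int i)")
    case True
    then show ?thesis using key[of "z (int i)" "z (int i + 1)"] e i by (auto simp: eqa_def GBC_invol[OF z])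
  next
    case False
    then have "int n < - z (int i + 1)" "int n < - z (int i)" using e by (auto simp: eqa_def)
    then show ?thesis using key[of "- z (int i + 1)" "- z (int i)"] i
      by (simp add: GBC_invol[OF z] GBC_uminus[OF z])
  qed
qed

lemma DesEq_iff:
  assumes z: "z \<in> GBC n" and i: "i < n"
  shows "sgen i \<in> DesEq n z \<longleftrightarrow> eqd i z"
proof
  assume "sgen i \<in> DesEq n z"
  then have c: "sgen i (z j) = z (sgen i j)" for j by (simp add: DesEq_def fun_eq_iff)
  show "eqd i z"
  proof (cases "i = 0")
    case True
    have "\<bar>z 1\<bar> \<noteq> 1" using GBC_nofix[OF z, of 1] i by simp
    then have "sgen 0 (z 1) = z 1" by (auto simp: sgen_0)
    then have "z 1 = - z 1" using c[of 1] True GBC_uminus[OF z, of 1] by (simp add: sgen_0)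
    then show ?thesis using GBC_zero_iff[OF z, of 1] by simp
  next
    case False
    have nf: "\<bar>z (int i)\<bar> \<noteq> int i" using GBC_nofix[OF z, of "int i"] i False by simp
    have "z (int i) \<noteq> z (int i + 1)" using GBC_eq_iff[OF z] by simp
    moreover have "sgen i (z (int i)) = z (int i + 1)" using c[of "int i"] False by (simp add: sgen_Suc)
    ultimately have "sgen i (z (int i)) \<noteq> z (int i)" by simp
    then have "\<bar>z (int i)\<bar> = int i \<or> \<bar>z (int i)\<bar> = int i + 1" using False by (auto simp: sgen_Suc split: if_splits)
    then show ?thesis using nf False by (simp add: eqd_def)
  qed
next
  assume e: "eqd i z"
  then have i0: "0 < i" by (simp add: eqd_def)
  have "sgen i (z j) = z (sgen i j)" for j
  proof (cases "\<bar>j\<bar> = int i \<or> \<bar>j\<bar> = int i + 1")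
    case True
    have 1: "sgen i (z (int i)) = z (sgen i (int i))" "sgen i (z (int i + 1)) = z (sgen i (int i + 1))"
      using eqd_swap[OF z e] i0 by (auto simp: sgen_Suc)
    have "sgen i (z (- k)) = z (sgen i (- k)) \<longleftrightarrow> sgen i (z k) = z (sgen i k)" for k
      by (simp add: GBC_uminus[OF z])
    moreover have "j = int i \<or> j = - int i \<or> j = int i + 1 \<or> j = - (int i + 1)" using True by linarith
    ultimately show ?thesis using 1 by metis
  next
    case False
    then have "\<bar>z j\<bar> \<noteq> int i" "\<bar>z j\<bar> \<noteq> int i + 1"
      using eqd_swap[OF z e] WBC_abs_eq_iff[OF GBC_WBC[OF z], of j "int i"] WBC_abs_eq_iff[OF GBC_WBC[OF z], of j "int i + 1"]
      by auto
    then show ?thesis using False sgen_fixed[of "z j" i] sgen_fixed[of j i] by simp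
  qed
  then show "sgen i \<in> DesEq n z" using i by (auto simp: DesEq_def Sgens_def fun_eq_iff)
qed

lemma GBC_conj_sgen:
  assumes z: "z \<in> GBC n" and i0: "0 < i" and j: "0 < j"
    and zj: "(z (int i) = int j \<and> z (int i + 1) = int j + 1) \<or> (z (int i) = - int j - 1 \<and> z (int i + 1) = - int j)"
  shows "z (sgen i (z l)) = sgen j l"
proof -
  from zj have jz: "(z (int i) = int j \<and> z (int i + 1) = int j + 1 \<and> z (int j) = int i \<and> z (int j + 1) = int i + 1)
      \<or> (z (int i) = - int j - 1 \<and> z (int i + 1) = - int j \<and> z (int j + 1) = - int i \<and> z (int j) = - int i - 1)"
    using GBC_invol[OF z, of "int i"] GBC_invol[OF z, of "int i + 1"] GBC_uminus[OF z, of "int j"] GBC_uminus[OF z, of "int j + 1"]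
    by auto
  show ?thesis
  proof (cases "\<bar>l\<bar> = int j \<or> \<bar>l\<bar> = int j + 1")
    case True
    have ij: "sgen i (int i) = int i + 1" "sgen i (int i + 1) = int i" "sgen i (- int i) = - int i - 1"
      "sgen i (- int i - 1) = - int i" "sgen j (int j) = int j + 1" "sgen j (int j + 1) = int j"
      using i0 j by (auto simp: sgen_Suc)
    have "z (- int i) = - z (int i)" "z (- int i - 1) = - z (int i + 1)"
      using GBC_uminus[OF z, of "int i"] GBC_uminus[OF z, of "int i + 1"] by simp_all
    then have 1: "z (sgen i (z (int j))) = sgen j (int j)" "z (sgen i (z (int j + 1))) = sgen j (int j + 1)"
      using jz ij j by auto
    have "z (sgen i (z (- k))) = sgen j (- k) \<longleftrightarrow> z (sgen i (z k)) = sgen j k" for k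
      by (simp add: GBC_uminus[OF z])
    moreover have "l = int j \<or> l = - int j \<or> l = int j + 1 \<or> l = - (int j + 1)" using True by linarith
    ultimately show ?thesis using 1 by metis
  next
    case False
    then have "\<bar>z l\<bar> \<noteq> int i" "\<bar>z l\<bar> \<noteq> int i + 1"
      using jz WBC_abs_eq_iff[OF GBC_WBC[OF z], of l "int j"] WBC_abs_eq_iff[OF GBC_WBC[OF z], of l "int j + 1"]
      by auto
    then show ?thesis using False GBC_invol[OF z, of l] sgen_fixed[of "z l" i] sgen_fixed[of l j] by simp
  qed
qed

lemma AscEq_iff:
  assumes z: "z \<in> GBC n" and i: "i < n"
  shows "sgen i \<in> AscEq n z \<longleftrightarrow> eqa n i z"
proof
  assume "sgen i \<in> AscEq n z"
  then obtain j where j: "n < j" and "z \<circ> sgen i \<circ> z = sgen j" by (auto simp: AscEq_def)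
  then have c: "z (sgen i (z l)) = sgen j l" for l by (metis comp_apply)
  show "eqa n i z"
  proof (cases "i = 0")
    case True
    have "sgen j (z 1) = - z 1" using c[of "z 1"] True GBC_invol[OF z] GBC_uminus[OF z, of 1] by (simp add: sgen_0)
    then have "z 1 = 0" using j by (smt (verit) sgen_Suc of_nat_0_less_iff zero_less_iff_neq_zero not_less_zero)
    then show ?thesis using GBC_zero_iff[OF z, of 1] by simp
  next
    case False
    have "z (int i) \<noteq> z (int i + 1)" using GBC_eq_iff[OF z] by simp
    moreover have "sgen j (z (int i)) = z (int i + 1)" using c[of "z (int i)"] False GBC_invol[OF z] by (simp add: sgen_Suc)
    ultimately show ?thesis using False j by (auto simp: eqa_def sgen_Suc split: if_splits)
  qed
next
  assume e: "eqa n i z"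
  then have i0: "0 < i" by (simp add: eqa_def)
  have adj: "z (int i + 1) = z (int i) + 1" by (rule eqa_adjacent[OF z i e])
  \<comment> \<open>The smaller of the two absolute values: z(i) if it is positive, otherwise -z(i +
    1).\<close>
  define j where "j = (if 0 < z (int i) then nat (z (int i)) else nat (- z (int i + 1)))"
  have j: "n < j" using e by (auto simp: eqa_def j_def)
  have zj: "(z (int i) = int j \<and> z (int i + 1) = int j + 1) \<or> (z (int i) = - int j - 1 \<and> z (int i + 1) = - int j)"
    using adj e by (auto simp: eqa_def j_def)
  have "z (sgen i (z l)) = sgen j l" for l using GBC_conj_sgen[OF z i0 _ zj] j by simp
  then have "z \<circ> sgen i \<circ> z = sgen j" by (simp add: fun_eq_iff)
  then show "sgen i \<in> AscEq n z" using i j by (auto simp: AscEq_def Sgens_def)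
qed

lemma inv_GBC: "z \<in> GBC n \<Longrightarrow> inv z = z"
  by (rule inv_equality) (auto simp: GBC_invol)

lemma len_sgen_o:
  assumes z: "z \<in> GBC n" and i: "i < n"
  shows "if asc i z then len (2 * n) (sgen i \<circ> z) > len (2 * n) z else len (2 * n) (sgen i \<circ> z) < len (2 * n) z"
proof -
  have i2: "i < 2 * n" using i by simp
  have "sgen i \<circ> z \<in> WBC (2 * n)" using GBC_WBC[OF z] i2 by (simp add: WBC_comp WBC_sgen)
  from double_len[OF this] double_len[OF GBC_WBC[OF z]] dlen_sgen_o[OF GBC_WBC[OF z] i2]
  show ?thesis by (auto simp: inv_GBC[OF z] split: if_splits)
qed

lemma AscLt_iff:
  assumes z: "z \<in> GBC n" and i: "i < n"
  shows "sgen i \<in> AscLt n z \<longleftrightarrow> asc i z \<and> \<not> eqd i z \<and> \<not> eqa n i z"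
  using len_sgen_o[OF z i] DesEq_iff[OF z i] AscEq_iff[OF z i] i
  by (auto simp: AscLt_def Sgens_def split: if_splits)

lemma DesLt_iff:
  assumes z: "z \<in> GBC n" and i: "i < n"
  shows "sgen i \<in> DesLt n z \<longleftrightarrow> \<not> asc i z \<and> \<not> eqd i z \<and> \<not> eqa n i z"
  using len_sgen_o[OF z i] DesEq_iff[OF z i] AscEq_iff[OF z i] i
  by (auto simp: DesLt_def Sgens_def split: if_splits)

text \<open>A visible descent beyond n can arise only if s_i reverses the order of z(j) and z(j + 1)
  for some j > n, that is, if these values are i, i + 1 or -i - 1, -i; this is what
  \<open>eqa\<close> describes. For s_0 the values would be -1, 1, which cannot occur at two
  different positive places.\<close>

lemma mv_GBC:
  assumes z: "z \<in> GBC n" and i: "i < n" and ne: "\<not> eqa n i z"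
  shows "mv i z \<in> GBC n"
proof -
  have W: "mv i z \<in> WBC (2 * n)" unfolding mv_def using i by (intro WBC_comp WBC_sgen GBC_WBC[OF z]) auto
  have I: "mv i z \<circ> mv i z = id" by (auto simp: mv_apply fun_eq_iff GBC_invol[OF z])
  have nf: "\<bar>mv i z j\<bar> \<noteq> j" if j: "1 \<le> j" "j \<le> 2 * int n" for j
  proof
    assume "\<bar>mv i z j\<bar> = j"
    then have "sgen i (z (sgen i j)) = j \<or> sgen i (z (sgen i j)) = - j" using j by (auto simp: mv_apply)
    then have "z (sgen i j) = sgen i j \<or> z (sgen i j) = - sgen i j" by (metis sgen_invol sgen_uminus)
    then have "\<bar>z (sgen i j)\<bar> = \<bar>sgen i j\<bar>" by auto
    moreover have "sgen i j \<noteq> 0" "\<bar>sgen i j\<bar> \<le> 2 * int n"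
      using j i sgen_abs_le_iff[of i "2 * int n" j] by auto
    ultimately show False using GBC_nofix[OF z] by blast
  qed
  have vd: "\<not> visdesc (mv i z) j" if j: "int n < j" for j
  proof -
    have s: "sgen i j = j" "sgen i (j + 1) = j + 1" using j i by (auto intro: sgen_outside)
    have v: "min j (z j) \<le> z (j + 1)" "- j \<le> z j" using GBC_visdesc[OF z j] by auto
    have out: "sgen i a = a \<or> (\<bar>sgen i a\<bar> \<le> int n \<and> \<bar>a\<bar> \<le> int n)" for a
      using i by (metis linorder_not_le sgen_abs_le_iff sgen_outside of_nat_less_iff add1_zle_eq order.strict_trans1)
    have 1: "- j \<le> sgen i (z j)" using out[of "z j"] v j by auto
    have 2: "min j (sgen i (z j)) \<le> sgen i (z (j + 1))"
    proof (cases "j \<le> z (j + 1)")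
      case True
      then show ?thesis using out[of "z (j + 1)"] j by auto
    next
      case False
      then have "z j \<le> z (j + 1)" using v by simp
      moreover have "z j \<noteq> z (j + 1)" using GBC_eq_iff[OF z] by simp
      ultimately have lt: "z j < z (j + 1)" by simp
      have nz: "z j \<noteq> 0" "z (j + 1) \<noteq> 0" using GBC_zero_iff[OF z] j by auto
      have "sgen i (z j) < sgen i (z (j + 1))"
      proof (cases "i = 0")
        case True
        have "z j \<noteq> - z (j + 1)" using GBC_uminus[OF z, of "j + 1"] GBC_eq_iff[OF z, of j "- (j + 1)"] j by auto
        then show ?thesis using sgen0_less_iff[of "z j" "z (j + 1)"] lt nz True by auto
      next
        case False
        have "\<not> (z j = int i \<and> z (j + 1) = int i + 1)" "\<not> (z j = - int i - 1 \<and> z (j + 1) = - int i)"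
        proof -
          show "\<not> (z j = int i \<and> z (j + 1) = int i + 1)"
          proof
            assume "z j = int i \<and> z (j + 1) = int i + 1"
            then have "z (int i) = j" "z (int i + 1) = j + 1" using GBC_swap[OF z] by metis+
            then show False using ne j False by (simp add: eqa_def)
          qed
          show "\<not> (z j = - int i - 1 \<and> z (j + 1) = - int i)"
          proof
            assume "z j = - int i - 1 \<and> z (j + 1) = - int i"
            then have "z (- int i - 1) = j" "z (- int i) = j + 1" using GBC_swap[OF z] by metis+
            then have "z (int i + 1) = - j" "z (int i) = - j - 1"
              using GBC_uminus[OF z, of "int i"] GBC_uminus[OF z, of "int i + 1"] by auto
            then show False using ne j False by (simp add: eqa_def)
          qed
        qed
        then show ?thesis using sgen_less_iff[of i "z j" "z (j + 1)"] lt False by auto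
      qed
      then show ?thesis by auto
    qed
    show ?thesis using 1 2 s by (auto simp: visdesc_def mv_apply)
  qed
  show ?thesis using W I nf vd by (simp add: GBC_def)
qed

text \<open>For i > 0, s_i fixes the values z(i) and z(i + 1) outside the weak cases, so conjugation
  simply exchanges them. For i = 0 it changes the sign of z(1).\<close>

lemma mv_types:
  assumes z: "z \<in> GBC n" and i: "i < n" and ne: "\<not> eqd i z" "\<not> eqa n i z"
  shows "\<not> eqd i (mv i z)" "\<not> eqa n i (mv i z)" "asc i (mv i z) \<longleftrightarrow> \<not> asc i z"
proof -
  have nf: "\<bar>z (int i)\<bar> \<noteq> int i" "\<bar>z (int i + 1)\<bar> \<noteq> int i + 1" if "i \<noteq> 0"
    using GBC_nofix[OF z, of "int i"] GBC_nofix[OF z, of "int i + 1"] i that by auto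
  have ne': "\<bar>z (int i + 1)\<bar> \<noteq> int i" "\<bar>z (int i)\<bar> \<noteq> int i + 1" if "i \<noteq> 0"
  proof -
    show "\<bar>z (int i)\<bar> \<noteq> int i + 1" using ne that by (simp add: eqd_def)
    show "\<bar>z (int i + 1)\<bar> \<noteq> int i"
    proof
      assume "\<bar>z (int i + 1)\<bar> = int i"
      then have "z (int i) = int i + 1 \<or> z (int i) = - (int i + 1)"
      proof (cases "z (int i + 1) = int i")
        case False
        then have "z (int i + 1) = - int i" using \<open>\<bar>z (int i + 1)\<bar> = int i\<close> by linarith
        then show ?thesis using GBC_invol[OF z, of "int i + 1"] GBC_uminus[OF z, of "int i"] by simp
      qed (use GBC_invol[OF z, of "int i + 1"] in simp)
      then show False using ne that by (auto simp: eqd_def)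
    qed
  qed
  have v: "mv i z (int i) = z (int i + 1)" "mv i z (int i + 1) = z (int i)" if "i \<noteq> 0"
    using that nf ne' by (auto simp: mv_apply sgen_Suc)
  show "\<not> eqd i (mv i z)" using v nf by (auto simp: eqd_def)
  show "\<not> eqa n i (mv i z)" using v ne by (auto simp: eqa_def)
  show "asc i (mv i z) \<longleftrightarrow> \<not> asc i z"
  proof (cases "i = 0")
    case True
    have "\<bar>z 1\<bar> \<noteq> 1" "z 1 \<noteq> 0" using GBC_nofix[OF z, of 1] GBC_zero_iff[OF z, of 1] i by auto
    then show ?thesis using True GBC_uminus[OF z, of 1] by (auto simp: asc_0 mv_apply sgen_0)
  next
    case False
    then show ?thesis using v GBC_eq_iff[OF z, of "int i" "int i + 1"] by (auto simp: asc_Suc)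
  qed
qed

text \<open>s_i is a right ascent of z and, not being a weak descent, still a left ascent of
  \<open>z \<circ> sgen i\<close>.\<close>

lemma len_mv:
  assumes z: "z \<in> GBC n" and i: "i < n" and a: "asc i z" and ne: "\<not> eqd i z"
  shows "len (2 * n) (mv i z) = len (2 * n) z + 2"
proof -
  have W: "z \<in> WBC (2 * n)" by (rule GBC_WBC[OF z])
  have i2: "i < 2 * n" using i by simp
  have W1: "z \<circ> sgen i \<in> WBC (2 * n)" and W2: "mv i z \<in> WBC (2 * n)"
    unfolding mv_def using i2 by (auto intro!: WBC_comp WBC_sgen W)
  have "asc i (inv (z \<circ> sgen i))"
  proof (cases "i = 0")
    case True
    have "\<bar>z 1\<bar> \<noteq> 1" "z 1 \<noteq> 0" using GBC_nofix[OF z, of 1] GBC_zero_iff[OF z, of 1] i by auto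
    then show ?thesis using a True by (auto simp: inv_o_sgen[OF W] inv_GBC[OF z] asc_0 sgen_0)
  next
    case False
    have "\<bar>z (int i)\<bar> \<noteq> int i" "\<bar>z (int i)\<bar> \<noteq> int i + 1"
      using GBC_nofix[OF z, of "int i"] i False ne by (auto simp: eqd_def)
    then have "z (int i) \<noteq> int i" "z (int i) \<noteq> - int i - 1" by auto
    then show ?thesis using a False sgen_less_iff[of i "z (int i)" "z (int i + 1)"]
      by (auto simp: inv_o_sgen[OF W] inv_GBC[OF z] asc_Suc)
  qed
  then have "dlen (2 * n) (mv i z) = dlen (2 * n) (z \<circ> sgen i) + 2"
    using dlen_sgen_o[OF W1 i2] by (simp add: mv_def comp_assoc)
  also have "\<dots> = dlen (2 * n) z + 4" using dlen_o_sgen[OF W i2 a] by simp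
  finally show ?thesis using double_len[OF W] double_len[OF W2] by simp
qed

text \<open>Conjugation replaces \<open>tset n z\<close> by its image under s_i. So
  \<open>kap\<close> is constant on orbits, and by \<open>no_descent_unique\<close> it separates
  them.\<close>

lemma kap_mv:
  assumes z: "z \<in> GBC n" and i: "i < n"
  shows "kap n (mv i z) = kap n z"
proof -
  have le: "\<bar>sgen i t\<bar> \<le> int n \<longleftrightarrow> \<bar>t\<bar> \<le> int n" for t
    using i sgen_abs_le_iff[of i "int n" t] by simp
  have gt: "int n < sgen i t \<longleftrightarrow> int n < t" for t
    using i sgen_outside[of i t] sgen_outside[of i "sgen i t"] by auto
  have "tset n (mv i z) = sgen i ` tset n z"
  proof (intro set_eqI)
    fix t
    have "t \<in> sgen i ` tset n z \<longleftrightarrow> sgen i t \<in> tset n z" by (metis image_iff sgen_invol)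
    then show "t \<in> tset n (mv i z) \<longleftrightarrow> t \<in> sgen i ` tset n z" by (simp add: tset_def mv_apply le gt)
  qed
  then show ?thesis by (simp add: kap_def card_image inj_on_def)
qed

subsection \<open>Minimal elements\<close>

text \<open>The hypotheses make \<open>tset\<close> a final segment of [n] with \<open>kap\<close>
  elements. The tail is increasing with this image, so it is a shift.\<close>

lemma tail_final:
  assumes z: "z \<in> GBC n" and neg: "\<And>i. 1 \<le> i \<Longrightarrow> i \<le> int n \<Longrightarrow> - int n \<le> z i"
    and up: "\<And>i. 1 \<le> i \<Longrightarrow> i < int n \<Longrightarrow> int n < z i \<Longrightarrow> int n < z (i + 1)"
  shows "\<And>i. int n - int (kap n z) < i \<Longrightarrow> i \<le> int n \<Longrightarrow> z i = i + int (kap n z)"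
    and "\<And>i. 1 \<le> i \<Longrightarrow> i \<le> int n - int (kap n z) \<Longrightarrow> z i \<le> int n"
proof -
  let ?r = "int n - int (kap n z)"
  have upto: "j \<le> int n \<longrightarrow> int n < z j" if "1 \<le> i" "int n < z i" "i \<le> j" for i j
    using that(3)
  proof (induction j rule: int_ge_induct)
    case base then show ?case using that by simp
  next
    case (step j) then show ?case using up[of j] that by auto
  qed
  have T1: "t \<in> tset n z \<longleftrightarrow> 1 \<le> t \<and> t \<le> int n \<and> int n < z t" for t
  proof (cases "1 \<le> t")
    case False
    then have "\<bar>t\<bar> \<le> int n \<Longrightarrow> z t \<le> int n"
      using neg[of "- t"] GBC_uminus[OF z, of t] GBC_zero_iff[OF z, of t] by (cases "t = 0") auto
    then show ?thesis using False by (auto simp: tset_def)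
  qed (auto simp: tset_def)
  have T: "tset n z = {?r + 1..int n}"
  proof (cases "tset n z = {}")
    case True then show ?thesis by (simp add: kap_def)
  next
    case False
    let ?m = "Min (tset n z)"
    have m: "?m \<in> tset n z" using Min_in[OF finite_tset False] .
    have "tset n z = {?m..int n}"
    proof
      show "tset n z \<subseteq> {?m..int n}" using Min_le[OF finite_tset] T1 by auto
      show "{?m..int n} \<subseteq> tset n z" using m upto T1 by fastforce
    qed
    moreover from this have "card (tset n z) = card {?m..int n}" by simp
    then have "int (kap n z) = int n + 1 - ?m" using m T1[of ?m] by (simp add: kap_def)
    ultimately show ?thesis by simp
  qed
  have e: "z i = i - int (kap n z)" if "int n < i" "i \<le> int n + int (kap n z)" for i
  proof (rule strict_mono_image_unique[where a = "int n + 1" and b = "int n + int (kap n z)" and f = z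
        and g = "\<lambda>i. i - int (kap n z)"])
    show "z i < z j" if "int n + 1 \<le> i" "i < j" "j \<le> int n + int (kap n z)" for i j
      using tail_strict[OF z, of i j] tail_iff[OF z, of j] that by auto
    show "z ` {int n + 1..int n + int (kap n z)} = (\<lambda>i. i - int (kap n z)) ` {int n + 1..int n + int (kap n z)}"
      unfolding tail_image[OF z] T
    proof -
      show "{?r + 1..int n} = (\<lambda>i. i - int (kap n z)) ` {int n + 1..int n + int (kap n z)}"
        by (auto simp: image_iff intro!: bexI[of _ "_ + int (kap n z)"])
    qed
  qed (use that in auto)
  show "z i = i + int (kap n z)" if "?r < i" "i \<le> int n" for i
    using e[of "i + int (kap n z)"] that GBC_swap[OF z] by simp
  show "z i \<le> int n" if "1 \<le> i" "i \<le> ?r" for i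
  proof -
    have "i \<notin> tset n z" using that by (simp add: T)
    then show ?thesis using T1[of i] that by auto
  qed
qed

text \<open>Without strict descents the values on [n] are positive, and once one of them exceeds n
  all later ones do, so \<open>tail_final\<close> applies. On the remaining places an odd i must go
  to i + 1: a larger value c = z(i) would keep the values at i + 1, ..., c above c, against z(c) =
  i.\<close>

lemma no_descent_form:
  assumes z: "z \<in> GBC n" and nd: "\<And>i. i < n \<Longrightarrow> asc i z \<or> eqd i z \<or> eqa n i z"
  shows "\<And>i. int n - int (kap n z) < i \<Longrightarrow> i \<le> int n \<Longrightarrow> z i = i + int (kap n z)"
    and "\<And>i. 1 \<le> i \<Longrightarrow> i \<le> int n - int (kap n z) \<Longrightarrow> z i = (if odd i then i + 1 else i - 1)"
    and "even (int n - int (kap n z))"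
proof -
  let ?r = "int n - int (kap n z)"
  have nd': "z i < z (i + 1) \<or> \<bar>z i\<bar> = i + 1 \<or> (int n < \<bar>z i\<bar> \<and> int n < \<bar>z (i + 1)\<bar> \<and> (0 < z i \<longleftrightarrow> 0 < z (i + 1)))"
    if "1 \<le> i" "i < int n" for i
    using nd[of "nat i"] that by (auto simp: asc_Suc eqd_def eqa_def)
  have pos: "i \<le> int n \<longrightarrow> 0 < z i" if "1 \<le> i" for i
    using that
  proof (induction i rule: int_ge_induct)
    case base
    show ?case using nd[of 0] by (auto simp: asc_0 eqd_def eqa_def)
  next
    case (step i)
    show ?case
    proof
      assume "i + 1 \<le> int n"
      then have p: "0 < z i" and i: "i < int n" using step by auto
      from nd'[OF step(1) i] show "0 < z (i + 1)"
      proof (elim disjE)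
        assume "\<bar>z i\<bar> = i + 1"
        then have "z i = i + 1" using p by simp
        then show ?thesis using GBC_invol[OF z, of i] step by simp
      qed (use p in auto)
    qed
  qed
  have up: "int n < z (i + 1)" if "1 \<le> i" "i < int n" "int n < z i" for i
    using nd'[OF that(1,2)] that by auto
  have neg: "- int n \<le> z i" if "1 \<le> i" "i \<le> int n" for i using pos[OF that(1)] that(2) by simp
  show A: "z i = i + int (kap n z)" if "?r < i" "i \<le> int n" for i
    using tail_final(1)[OF z neg up] that by blast
  have le: "z i \<le> int n" if "1 \<le> i" "i \<le> ?r" for i
    using tail_final(2)[OF z neg up] that by blast
  have "1 \<le> i \<longrightarrow> i \<le> ?r \<longrightarrow> z i = (if odd i then i + 1 else i - 1)" for i
  proof (induction "nat i" arbitrary: i rule: less_induct)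
    case less
    have IH: "z j = (if odd j then j + 1 else j - 1)" if "1 \<le> j" "j < i" "i \<le> ?r" for j
      using less[of j] that by auto
    show ?case
    proof (intro impI)
      assume i: "1 \<le> i" "i \<le> ?r"
      show "z i = (if odd i then i + 1 else i - 1)"
      proof (cases "odd i")
        case False
        then have "2 \<le> i" "odd (i - 1)" using i by (auto elim: evenE)
        then have "z (i - 1) = i" using IH[of "i - 1"] i by simp
        then show ?thesis using False GBC_invol[OF z, of "i - 1"] by simp
      next
        case True
        let ?c = "z i"
        have c: "1 \<le> ?c" "?c \<le> int n" using pos[of i] le[of i] i by auto
        have "?c \<noteq> i" using GBC_nofix[OF z, of i] i c by auto
        moreover have "\<not> ?c < i"
        proof
          assume l: "?c < i"
          then have "z ?c < i" using IH[of ?c] c i True by (cases "odd ?c") (auto, presburger)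
          then show False using GBC_invol[OF z, of i] by simp
        qed
        ultimately have ci: "i < ?c" by simp
        have "?c = i + 1"
        proof (rule ccontr)
          assume ne: "?c \<noteq> i + 1"
          have "l \<le> ?c \<longrightarrow> ?c < z l" if "i + 1 \<le> l" for l
            using that
          proof (induction l rule: int_ge_induct)
            case base
            show ?case using nd'[of i] i ci c ne by auto
          next
            case (step l)
            show ?case using nd'[of l] i ci c step by auto
          qed
          from this[of ?c] show False using ci GBC_invol[OF z, of i] by auto
        qed
        then show ?thesis using True by simp
      qed
    qed
  qed
  then show B: "z i = (if odd i then i + 1 else i - 1)" if "1 \<le> i" "i \<le> ?r" for i using that by blast
  show "even ?r"
  proof (rule ccontr)
    \<comment> \<open>An odd last place would be paired with its successor, which either lies
      outside [n] or belongs to the shifted segment.\<close>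
    assume o: "odd ?r"
    have "0 \<le> ?r" using kap_le[OF z] by simp
    then have r: "1 \<le> ?r" using o by (cases "?r = 0") auto
    then have zr: "z ?r = ?r + 1" using B[of ?r] o by simp
    then have "?r + 1 \<le> int n" using le[of ?r] r by simp
    then have "z (?r + 1) = ?r + 1 + int (kap n z)" using A by simp
    moreover have "z (?r + 1) = ?r" using zr GBC_invol[OF z, of ?r] by simp
    ultimately show False by simp
  qed
qed

lemma no_descent_unique:
  assumes y: "y \<in> GBC n" and yd: "\<And>i. i < n \<Longrightarrow> asc i y \<or> eqd i y \<or> eqa n i y"
    and z: "z \<in> GBC n" and zd: "\<And>i. i < n \<Longrightarrow> asc i z \<or> eqd i z \<or> eqa n i z"
    and k: "kap n y = kap n z"
  shows "y = z"
proof -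
  have p: "y j = z j" if "1 \<le> j" "j \<le> int n" for j
    using no_descent_form(1,2)[OF y yd, of j] no_descent_form(1,2)[OF z zd, of j] k that
    by (cases "int n - int (kap n z) < j") auto
  have q: "y j = z j" if "j \<noteq> 0" "\<bar>j\<bar> \<le> int n" for j
    using p[of j] p[of "- j"] GBC_uminus[OF y, of j] GBC_uminus[OF z, of j] that by (cases "0 < j") auto
  show ?thesis by (rule GBC_eqI[OF y z]) (use q in auto)
qed

subsection \<open>The bijection with involutions and the map \<open>\<iota>\<close>\<close>

lemma sorted_rank:
  fixes l :: "int list"
  assumes s: "sorted_wrt (<) l" and k: "k < length l"
  shows "card {b \<in> set l. b \<le> l ! k} = Suc k" "card {b \<in> set l. l ! k \<le> b} = length l - k"
proof -
  have m: "l ! i \<le> l ! j \<longleftrightarrow> i \<le> j" if "i < length l" "j < length l" for i j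
    using s that by (metis linorder_not_le nat_less_le order.strict_iff_order sorted_wrt_nth_less)
  have inj: "inj_on ((!) l) {..<length l}"
    using s by (simp add: inj_on_nth strict_sorted_iff)
  have "{b \<in> set l. b \<le> l ! k} = (!) l ` {..k}"
    using m k by (auto simp: in_set_conv_nth image_iff intro: le_less_trans)
  then show "card {b \<in> set l. b \<le> l ! k} = Suc k"
    using k by (simp add: card_image inj_on_subset[OF inj] subset_iff)
  have "{b \<in> set l. l ! k \<le> b} = (!) l ` {k..<length l}"
    using m k by (auto simp: in_set_conv_nth image_iff)
  then show "card {b \<in> set l. l ! k \<le> b} = length l - k"
    using k by (simp add: card_image inj_on_subset[OF inj] subset_iff)
qed

text \<open>\<open>under\<close> uses ranks, given by cardinalities, on [n] and list entries beyond
  n. These facts, and the decreasing version below, say that the two are inverse to each other and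
  monotone.\<close>

lemma increasing_list_rank:
  fixes S :: "int set"
  assumes "finite S"
  defines "b \<equiv> \<lambda>j. sorted_list_of_set S ! nat (j - 1)" and "r \<equiv> \<lambda>y. int (card {b \<in> S. b \<le> y})"
  shows "\<And>j. 1 \<le> j \<Longrightarrow> j \<le> int (card S) \<Longrightarrow> b j \<in> S \<and> r (b j) = j"
    and "\<And>y. y \<in> S \<Longrightarrow> 1 \<le> r y \<and> r y \<le> int (card S) \<and> b (r y) = y"
    and "\<And>i j. 1 \<le> i \<Longrightarrow> i < j \<Longrightarrow> j \<le> int (card S) \<Longrightarrow> b i < b j"
proof -
  let ?l = "sorted_list_of_set S"
  have s: "sorted_wrt (<) ?l" and st: "set ?l = S" and ln: "length ?l = card S"
    using assms(1) by auto
  show 1: "b j \<in> S \<and> r (b j) = j" if "1 \<le> j" "j \<le> int (card S)" for j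
    using sorted_rank(1)[OF s, of "nat (j - 1)"] nth_mem[of "nat (j - 1)" ?l] that by (simp add: st ln b_def r_def)
  show "1 \<le> r y \<and> r y \<le> int (card S) \<and> b (r y) = y" if "y \<in> S" for y
  proof -
    from that have "y \<in> set ?l" using st by simp
    then obtain k where k: "k < card S" "y = ?l ! k" unfolding in_set_conv_nth ln by blast
    then have "y = b (int k + 1)" by (simp add: b_def)
    then show ?thesis using 1[of "int k + 1"] k by simp
  qed
  show "b i < b j" if "1 \<le> i" "i < j" "j \<le> int (card S)" for i j
    using sorted_wrt_nth_less[OF s, of "nat (i - 1)" "nat (j - 1)"] that by (simp add: b_def ln)
qed

lemma decreasing_list_rank:
  fixes S :: "int set"
  assumes "finite S"
  defines "a \<equiv> \<lambda>j. rev (sorted_list_of_set S) ! nat (j - 1)" and "r \<equiv> \<lambda>y. int (card {a \<in> S. y \<le> a})"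
  shows "\<And>j. 1 \<le> j \<Longrightarrow> j \<le> int (card S) \<Longrightarrow> a j \<in> S \<and> r (a j) = j"
    and "\<And>y. y \<in> S \<Longrightarrow> 1 \<le> r y \<and> r y \<le> int (card S) \<and> a (r y) = y"
    and "\<And>i j. 1 \<le> i \<Longrightarrow> i < j \<Longrightarrow> j \<le> int (card S) \<Longrightarrow> a j < a i"
proof -
  let ?l = "sorted_list_of_set S"
  have s: "sorted_wrt (<) ?l" and st: "set ?l = S" and ln: "length ?l = card S"
    using assms(1) by auto
  have aj: "a j = ?l ! (card S - nat j)" if "1 \<le> j" "j \<le> int (card S)" for j
  proof -
    have "Suc (nat (j - 1)) = nat j" using that by simp
    moreover have "nat (j - 1) < length ?l" using that ln by simp
    ultimately show ?thesis unfolding a_def by (simp add: rev_nth ln)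
  qed
  show 1: "a j \<in> S \<and> r (a j) = j" if "1 \<le> j" "j \<le> int (card S)" for j
    unfolding aj[OF that]
    using sorted_rank(2)[OF s, of "card S - nat j"] nth_mem[of "card S - nat j" ?l] that by (simp add: st ln r_def)
  show "1 \<le> r y \<and> r y \<le> int (card S) \<and> a (r y) = y" if "y \<in> S" for y
  proof -
    from that have "y \<in> set ?l" using st by simp
    then obtain k where k: "k < card S" "y = ?l ! k" unfolding in_set_conv_nth ln by blast
    then have "y = a (int (card S - k))" using aj[of "int (card S - k)"] by (simp del: of_nat_diff)
    then show ?thesis using 1[of "int (card S - k)"] k by simp
  qed
  show "a j < a i" if "1 \<le> i" "i < j" "j \<le> int (card S)" for i j
    using sorted_wrt_nth_less[OF s, of "card S - nat j" "card S - nat i"] aj[of i] aj[of j] that by (simp add: ln)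
qed

lemma even_card_involution:
  assumes "finite S" "\<And>x. x \<in> S \<Longrightarrow> h x \<in> S \<and> h (h x) = x \<and> h x \<noteq> x"
  shows "even (card S)"
  using assms
proof (induction "card S" arbitrary: S rule: less_induct)
  case less
  show ?case
  proof (cases "S = {}")
    case False
    then obtain x where x: "x \<in> S" by blast
    let ?S = "S - {x, h x}"
    have hx: "h x \<in> S" "h x \<noteq> x" using less.prems x by auto
    have "card (insert x (insert (h x) ?S)) = card ?S + 2"
      using less.prems(1) hx by (subst card_insert_disjoint; simp)+
    moreover have "insert x (insert (h x) ?S) = S" using x hx by blast
    ultimately have c: "card S = card ?S + 2" by simp
    have "h y \<in> ?S \<and> h (h y) = y \<and> h y \<noteq> y" if "y \<in> ?S" for y
      using less.prems(2)[of y] less.prems(2)[OF x] that by (metis Diff_iff insert_iff singletonD)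
    then have "even (card ?S)" using less.hyps[of ?S] c less.prems(1) by simp
    then show ?thesis using c by simp
  qed simp
qed

section \<open>The bijection \<open>under\<close> and its inverse\<close>

lemma InvBC_props:
  assumes "w \<in> InvBC n"
  shows "w \<in> WBC n" "w (w i) = i"
  using assms by (auto simp: InvBC_def) (metis comp_apply id_apply)

lemma under_props:
  assumes w: "w \<in> InvBC n"
  shows "under n w \<in> GBC n"
    and "\<And>y. 1 \<le> y \<Longrightarrow> y \<le> int n \<Longrightarrow>
      (w y = y \<longrightarrow> int n < under n w y) \<and> (w y = - y \<longrightarrow> under n w y < - int n) \<and> (\<bar>w y\<bar> \<noteq> y \<longrightarrow> under n w y = w y)"
proof -
  note W = InvBC_props(1)[OF w] and I = InvBC_props(2)[OF w]
  define A where "A = {a::int. 1 \<le> a \<and> a \<le> int n \<and> w a = - a}"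
  define B where "B = {b::int. 1 \<le> b \<and> b \<le> int n \<and> w b = b}"
  define C where "C = {c::int. 1 \<le> c \<and> c \<le> int n \<and> \<bar>w c\<bar> \<noteq> c}"
  have fin: "finite A" "finite B" "finite C"
    by (auto simp: A_def B_def C_def intro: finite_subset[of _ "{1..int n}"])
  define p where "p = int (card A)"
  define q where "q = int (card B)"
  define al where "al j = rev (sorted_list_of_set A) ! nat (j - 1)" for j
  define be where "be j = sorted_list_of_set B ! nat (j - 1)" for j
  define ra where "ra y = int (card {a \<in> A. y \<le> a})" for y
  define rb where "rb y = int (card {b \<in> B. b \<le> y})" for y
  note dA = decreasing_list_rank[OF fin(1), folded al_def ra_def p_def]
  note dB = increasing_list_rank[OF fin(2), folded be_def rb_def q_def]
  define g where "g y = (if y \<le> int n then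
                 (if y \<in> A then - (int n + ra y) else if y \<in> B then int n + p + rb y else w y)
               else (if y - int n \<le> p then - al (y - int n)
                     else if y - int n \<le> p + q then be (y - int n - p)
                     else if odd (y - int n - p - q) then y + 1 else y - 1))" for y
  have ug: "under n w x = (if 1 \<le> \<bar>x\<bar> \<and> \<bar>x\<bar> \<le> 2 * int n then sgn x * g \<bar>x\<bar> else x)" for x
    by (simp add: under_def Let_def g_def A_def[symmetric] B_def[symmetric] al_def be_def ra_def rb_def p_def q_def)
  have disj: "A \<inter> B = {}" "A \<inter> C = {}" "B \<inter> C = {}" and un: "{1..int n} = A \<union> B \<union> C"
    by (auto simp: A_def B_def C_def)
  have "int n = int (card {1..int n})" by simp
  also have "\<dots> = p + q + int (card C)" unfolding un p_def q_def using disj fin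
    by (simp add: card_Un_disjoint Int_Un_distrib2)
  finally have npq: "int n = p + q + int (card C)" .
  \<comment> \<open>On \<open>C\<close> the map c -> |w(c)| is an involution without fixed points.
    So n - p - q is even, and the pairs at the end of [2n] do not overrun.\<close>
  have "even (card C)"
  proof (rule even_card_involution[OF fin(3), where h = "\<lambda>c. \<bar>w c\<bar>"])
    fix c assume c: "c \<in> C"
    then have cc: "1 \<le> c" "c \<le> int n" "\<bar>w c\<bar> \<noteq> c" by (auto simp: C_def)
    have ww: "\<bar>w \<bar>w c\<bar>\<bar> = c" using I[of c] WBC_uminus[OF W, of "w c"] cc by (cases "0 \<le> w c") auto
    moreover have "\<bar>w c\<bar> \<le> int n" using WBC_abs_le_iff[OF W, of c] cc by simp
    moreover have "w c \<noteq> 0" using WBC_zero_iff[OF W, of c] cc by simp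
    ultimately show "\<bar>w c\<bar> \<in> C \<and> \<bar>w \<bar>w c\<bar>\<bar> = c \<and> \<bar>w c\<bar> \<noteq> c" using cc by (auto simp: C_def)
  qed
  then have ev: "even (int n - p - q)" using npq by simp
  have pq0: "0 \<le> p" "0 \<le> q" "p + q \<le> int n" using npq by (auto simp: p_def q_def)
  \<comment> \<open>In other words, the odd extension of \<open>g\<close> is an involution of
    \<plusminus>[2n] which preserves no absolute value. The cases are the three kinds of points of
    [n] and the three segments beyond n.\<close>
  have key: "g y \<noteq> 0 \<and> \<bar>g y\<bar> \<le> 2 * int n \<and> \<bar>g y\<bar> \<noteq> y \<and> sgn (g y) * g \<bar>g y\<bar> = y"
    if y: "1 \<le> y" "y \<le> 2 * int n" for y
  proof -
    consider (a) "y \<in> A" | (b) "y \<in> B" | (c) "y \<in> C" | (d) "int n < y" "y - int n \<le> p"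
      | (e) "p < y - int n" "int n < y" "y - int n \<le> p + q" | (f) "p + q < y - int n" "int n < y"
      using un y by force
    then show ?thesis
    proof cases
      case a
      then have r: "1 \<le> ra y" "ra y \<le> p" "al (ra y) = y" and "y \<le> int n" using dA(2) by (auto simp: A_def)
      then have "g y = - (int n + ra y)" "g (int n + ra y) = - y" using a by (auto simp: g_def)
      then show ?thesis using r pq0 \<open>y \<le> int n\<close> y by (simp add: sgn_if abs_if add.commute)
    next
      case b
      then have r: "1 \<le> rb y" "rb y \<le> q" "be (rb y) = y" and "y \<le> int n" using dB(2) by (auto simp: B_def)
      then have "g y = int n + p + rb y" "g (int n + p + rb y) = y" using b disj pq0 by (auto simp: g_def)
      then show ?thesis using r pq0 \<open>y \<le> int n\<close> y by (simp add: sgn_if abs_if)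
    next
      case c
      then have yc: "y \<le> int n" "\<bar>w y\<bar> \<noteq> y" and gy: "g y = w y" using disj by (auto simp: g_def C_def)
      have le: "\<bar>w y\<bar> \<le> int n" using WBC_abs_le_iff[OF W, of y] y yc by simp
      have nz: "w y \<noteq> 0" using WBC_zero_iff[OF W, of y] y by simp
      have ww: "w \<bar>w y\<bar> = (if 0 < w y then y else - y)"
        using I[of y] WBC_uminus[OF W, of "w y"] nz by auto
      then have "\<bar>w y\<bar> \<in> C" using le nz yc y by (auto simp: C_def)
      then have "g \<bar>w y\<bar> = w \<bar>w y\<bar>" using disj le by (auto simp: g_def)
      then show ?thesis using gy le nz yc y ww by (auto simp: sgn_if)
    next
      case d
      then have a: "al (y - int n) \<in> A" "ra (al (y - int n)) = y - int n" using dA(1)[of "y - int n"] by auto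
      then have "1 \<le> al (y - int n)" "al (y - int n) \<le> int n" by (auto simp: A_def)
      moreover have "g y = - al (y - int n)" using d by (simp add: g_def)
      moreover have "g (al (y - int n)) = - y" using a calculation by (simp add: g_def)
      ultimately show ?thesis using d by (simp add: sgn_if abs_if)
    next
      case e
      then have a: "be (y - int n - p) \<in> B" "rb (be (y - int n - p)) = y - int n - p" using dB(1)[of "y - int n - p"] by auto
      then have "1 \<le> be (y - int n - p)" "be (y - int n - p) \<le> int n" by (auto simp: B_def)
      moreover have "g y = be (y - int n - p)" using e by (simp add: g_def)
      moreover have "g (be (y - int n - p)) = y" using a calculation disj by (auto simp: g_def)
      ultimately show ?thesis using e by (simp add: sgn_if abs_if)
    next
      case f
      show ?thesis
      proof (cases "odd (y - int n - p - q)")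
        case True
        have "y \<noteq> 2 * int n"
        proof
          assume "y = 2 * int n"
          then have "y - int n - p - q = int n - p - q" by simp
          then show False using ev True by simp
        qed
        moreover have "g y = y + 1" using f True pq0 by (simp add: g_def)
        moreover have "y + 1 - int n - p - q = y - int n - p - q + 1" by simp
        then have "even (y + 1 - int n - p - q)" using True by (metis odd_even_add odd_one)
        then have "g (y + 1) = y" using f pq0 by (simp add: g_def)
        ultimately show ?thesis using f y by (simp add: sgn_if)
      next
        case False
        then have "y - int n - p - q \<noteq> 1" by (metis odd_one)
        then have f': "p + q < y - 1 - int n" using f by simp
        have "g y = y - 1" using f False pq0 by (simp add: g_def)
        moreover have "y - int n - p - q = (y - 1 - int n - p - q) + 1" by simp
        then have "odd (y - 1 - int n - p - q)" using False even_plus_one_iff[of "y - 1 - int n - p - q"] by argo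
        then have "g (y - 1) = y" using f' pq0 by (simp add: g_def)
        ultimately show ?thesis using f' y pq0 by (simp add: sgn_if)
      qed
    qed
  qed
  let ?z = "under n w"
  have odd: "?z (- x) = - ?z x" for x by (simp add: ug)
  have inv: "?z (?z x) = x" for x
  proof (cases "1 \<le> \<bar>x\<bar> \<and> \<bar>x\<bar> \<le> 2 * int n")
    case True
    let ?v = "g \<bar>x\<bar>"
    have k: "?v \<noteq> 0" "\<bar>?v\<bar> \<le> 2 * int n" "sgn ?v * g \<bar>?v\<bar> = \<bar>x\<bar>" using key[of "\<bar>x\<bar>"] True by auto
    have zx: "?z x = sgn x * ?v" using True by (simp add: ug)
    have "x \<noteq> 0" using True by auto
    then have "\<bar>?z x\<bar> = \<bar>?v\<bar>" by (simp add: zx abs_mult)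
    moreover have "1 \<le> \<bar>?v\<bar>" using k(1) by simp
    ultimately have "?z (?z x) = sgn (sgn x * ?v) * g \<bar>?v\<bar>" using k by (simp add: ug[of "?z x"]) (simp add: zx)
    also have "\<dots> = sgn x * (sgn ?v * g \<bar>?v\<bar>)" by (simp add: sgn_mult)
    also have "\<dots> = x" using k(3) by (simp add: sgn_mult_abs)
    finally show ?thesis .
  next
    case False
    then have "?z x = x" unfolding ug by (rule if_not_P)
    then show ?thesis by simp
  qed
  have W2: "?z \<in> WBC (2 * n)"
  proof (rule WBC_I)
    show "bij ?z" by (rule involuntory_imp_bij) (rule inv)
    show "?z i = i" if "int (2 * n) < \<bar>i\<bar>" for i using that by (simp add: ug)
  qed (rule odd)
  have nofix: "\<bar>?z i\<bar> \<noteq> i" if "1 \<le> i" "i \<le> 2 * int n" for i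
    using key[OF that] that by (simp add: ug)
  have z: "?z i = g i" if "1 \<le> i" "i \<le> 2 * int n" for i using that by (simp add: ug)
  have vis: "\<not> visdesc ?z i" if i: "int n < i" for i
  proof -
    have 1: "- i \<le> ?z i"
    proof (cases "i \<le> 2 * int n")
      case True
      have "- int n \<le> g i"
      proof -
        consider (d) "i - int n \<le> p"
          | (e) "p < i - int n" "i - int n \<le> p + q" | (f) "p + q < i - int n" by linarith
        then show ?thesis
        proof cases
          case d then show ?thesis using i dA(1)[of "i - int n"] by (auto simp: g_def A_def)
        next
          case e then show ?thesis using i dB(1)[of "i - int n - p"] by (auto simp: g_def B_def)
        next
          case f then show ?thesis using i pq0 by (auto simp: g_def)
        qed
      qed
      then show ?thesis using z[of i] True i by simp
    next
      case False
      then show ?thesis using i by (simp add: ug)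
    qed
    have 2: "min i (?z i) \<le> ?z (i + 1)"
    proof (cases "i < 2 * int n")
      case False
      then show ?thesis using i by (simp add: ug[of "i + 1"])
    next
      case True
      then have zz: "?z i = g i" "?z (i + 1) = g (i + 1)" using z i by auto
      let ?j = "i - int n"
      consider (a) "?j + 1 \<le> p" | (b) "?j = p" "?j + 1 \<le> p + q" | (c) "p < ?j" "?j + 1 \<le> p + q"
        | (d) "p + q < ?j + 1" by linarith
      then show ?thesis
      proof cases
        case a
        have "al (?j + 1) < al ?j" using dA(3)[of ?j "?j + 1"] a i by simp
        then show ?thesis unfolding zz using a i by (simp add: g_def algebra_simps)
      next
        case b
        have "al ?j \<in> A" using dA(1)[of ?j] b i by simp
        moreover have "be 1 \<in> B" using dB(1)[of 1] b by simp
        ultimately have "0 < al ?j" "0 < be 1" by (auto simp: A_def B_def)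
        moreover have "g i = - al ?j" "g (i + 1) = be 1" using b i by (auto simp: g_def)
        ultimately show ?thesis unfolding zz by simp
      next
        case c
        have "be (?j - p) < be (?j - p + 1)" using dB(3)[of "?j - p" "?j - p + 1"] c by simp
        moreover have "g i = be (?j - p)" "g (i + 1) = be (?j - p + 1)"
          using c i by (auto simp: g_def algebra_simps)
        ultimately show ?thesis unfolding zz by simp
      next
        case d
        then have "i \<le> g (i + 1)" using i pq0 by (auto simp: g_def)
        then show ?thesis unfolding zz by simp
      qed
    qed
    show ?thesis using 1 2 by (auto simp: visdesc_def)
  qed
  show "?z \<in> GBC n" using W2 inv nofix vis by (auto simp: GBC_def fun_eq_iff)
  show "(w y = y \<longrightarrow> int n < ?z y) \<and> (w y = - y \<longrightarrow> ?z y < - int n) \<and> (\<bar>w y\<bar> \<noteq> y \<longrightarrow> ?z y = w y)"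
    if y: "1 \<le> y" "y \<le> int n" for y
  proof -
    have zy: "?z y = g y" using z y by simp
    have 1: "int n < ?z y" if "w y = y"
    proof -
      have b: "y \<in> B" using that y by (simp add: B_def)
      then show ?thesis unfolding zy using dB(2)[OF b] disj pq0 y by (auto simp: g_def)
    qed
    have 2: "?z y < - int n" if "w y = - y"
    proof -
      have b: "y \<in> A" using that y by (simp add: A_def)
      then show ?thesis unfolding zy using dA(2)[OF b] pq0 y by (auto simp: g_def)
    qed
    have 3: "?z y = w y" if "\<bar>w y\<bar> \<noteq> y"
      unfolding zy using that y by (auto simp: g_def A_def B_def)
    show ?thesis using 1 2 3 by blast
  qed
qed

text \<open>The inverse of \<open>under\<close>: a point which z sends out of \<plusminus>[n]
  becomes fixed or negated, according to the sign of its image.\<close>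

definition wof :: "nat \<Rightarrow> sperm \<Rightarrow> sperm" where
  "wof n z i = (if 1 \<le> \<bar>i\<bar> \<and> \<bar>i\<bar> \<le> int n then if \<bar>z i\<bar> \<le> int n then z i else sgn (z i) * \<bar>i\<bar> else i)"

lemma InvBC_I:
  assumes "\<And>i. w (- i) = - w i" "\<And>i. w (w i) = i" "\<And>i. \<bar>i\<bar> > int n \<Longrightarrow> w i = i"
  shows "w \<in> InvBC n"
proof -
  have "bij w" using assms(2) by (rule involuntory_imp_bij)
  then have "w \<in> WBC n" using WBC_I[of w n] assms(1,3) by blast
  then show ?thesis using assms(2) by (simp add: InvBC_def fun_eq_iff)
qed

lemma wof_InvBC: assumes z: "z \<in> GBC n" shows "wof n z \<in> InvBC n"
proof (rule InvBC_I)
  have odd: "wof n z (- i) = - wof n z i" for i by (simp add: wof_def GBC_uminus[OF z])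
  show "wof n z (- i) = - wof n z i" for i by (rule odd)
  show "wof n z i = i" if "\<bar>i\<bar> > int n" for i using that by (simp add: wof_def)
  show "wof n z (wof n z i) = i" for i
  proof (cases "1 \<le> \<bar>i\<bar> \<and> \<bar>i\<bar> \<le> int n")
    case True
    show ?thesis
    proof (cases "\<bar>z i\<bar> \<le> int n")
      case a: True
      have "z i \<noteq> 0" using GBC_zero_iff[OF z] True by auto
      then have "1 \<le> \<bar>z i\<bar>" by simp
      then show ?thesis using True a by (simp add: wof_def GBC_invol[OF z])
    next
      case False
      then have e: "wof n z i = sgn (z i) * \<bar>i\<bar>" using True by (simp add: wof_def)
      then have "wof n z i = i \<or> wof n z i = - i" using False by (auto simp: sgn_if abs_if)
      then show ?thesis using odd[of i] by auto
    qed
  qed (auto simp: wof_def)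
qed

lemma wof_under: assumes w: "w \<in> InvBC n" shows "wof n (under n w) = w"
proof -
  note W = InvBC_props(1)[OF w]
  have odd: "wof n (under n w) (- i) = - wof n (under n w) i" for i
    by (rule WBC_uminus[OF InvBC_props(1)[OF wof_InvBC[OF under_props(1)[OF w]]]])
  have p: "wof n (under n w) i = w i" if "1 \<le> i" "i \<le> int n" for i
  proof -
    have "\<bar>w i\<bar> \<le> int n" using WBC_abs_le_iff[OF W, of i] that by simp
    then show ?thesis using under_props(2)[OF w that] that by (cases "\<bar>w i\<bar> = i") (auto simp: wof_def abs_if split: if_splits)
  qed
  show ?thesis
  proof
    fix i
    consider "1 \<le> i" "i \<le> int n" | "1 \<le> - i" "- i \<le> int n" | "i = 0" | "int n < \<bar>i\<bar>" by linarith
    then show "wof n (under n w) i = w i"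
    proof cases
      case 2
      then show ?thesis using p[of "- i"] odd[of i] WBC_uminus[OF W, of i] by simp
    qed (use p WBC_0[OF W] WBC_outside[OF W] in \<open>auto simp: wof_def\<close>)
  qed
qed

text \<open>z neither fixes nor negates a point, so \<open>wof\<close> still shows which points
  leave \<plusminus>[n] and with which sign. These are the data of \<open>GBC_eqI\<close>.\<close>

lemma wof_inject:
  assumes y: "y \<in> GBC n" and z: "z \<in> GBC n" and e: "wof n y = wof n z"
  shows "y = z"
proof (rule GBC_eqI[OF y z])
  fix j assume j: "j \<noteq> 0" "\<bar>j\<bar> \<le> int n"
  have ej: "wof n y j = wof n z j" using e by simp
  have nf: "\<bar>y j\<bar> \<noteq> \<bar>j\<bar>" "\<bar>z j\<bar> \<noteq> \<bar>j\<bar>" using GBC_nofix[OF y j(1)] GBC_nofix[OF z j(1)] j by auto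
  have nz: "y j \<noteq> 0" "z j \<noteq> 0" using GBC_zero_iff[OF y] GBC_zero_iff[OF z] j by auto
  have s: "\<bar>sgn c * \<bar>j\<bar>\<bar> = \<bar>j\<bar>" if "c \<noteq> 0" for c :: int using that by (simp add: abs_mult)
  show "z j = y j" if "\<bar>y j\<bar> \<le> int n"
    using ej that j nf s[of "z j"] nz by (auto simp: wof_def split: if_splits)
  show "int n < \<bar>z j\<bar> \<and> (0 < y j \<longleftrightarrow> 0 < z j)" if "int n < \<bar>y j\<bar>"
    using ej that j nf s[of "y j"] nz by (auto simp: wof_def sgn_if split: if_splits)
qed

lemma under_wof: "z \<in> GBC n \<Longrightarrow> under n (wof n z) = z"
  by (rule wof_inject) (auto simp: wof_under wof_InvBC under_props(1))

lemma negw_InvBC: assumes w: "w \<in> InvBC n" shows "negw n w \<in> InvBC n"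
proof (rule InvBC_I)
  note W = InvBC_props(1)[OF w]
  show "negw n w (- i) = - negw n w i" for i by (simp add: negw_def WBC_uminus[OF W])
  show "negw n w i = i" if "\<bar>i\<bar> > int n" for i using that by (simp add: negw_def)
  show "negw n w (negw n w i) = i" for i
  proof (cases "1 \<le> \<bar>i\<bar> \<and> \<bar>i\<bar> \<le> int n")
    case True
    then have "w i \<noteq> 0" "\<bar>w i\<bar> \<le> int n" using WBC_zero_iff[OF W, of i] WBC_abs_le_iff[OF W, of i] by auto
    moreover from this have "1 \<le> \<bar>w i\<bar>" by simp
    ultimately have "1 \<le> \<bar>w i\<bar>" "\<bar>w i\<bar> \<le> int n" by simp_all
    then show ?thesis using True by (simp add: negw_def WBC_uminus[OF W] InvBC_props(2)[OF w])
  qed (auto simp: negw_def)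
qed

lemma iota_eq: assumes z: "z \<in> GBC n" shows "iota n z = under n (negw n (wof n z))"
proof -
  have "(THE w. w \<in> InvBC n \<and> under n w = z) = wof n z"
    by (rule the_equality) (use wof_InvBC[OF z] under_wof[OF z] wof_under in auto)
  then show ?thesis by (simp add: iota_def)
qed

text \<open>The passage from w to -w, seen on the corresponding elements of the index set and
  restricted to \<plusminus>[n]. It determines \<open>iota\<close> by \<open>opp_unique\<close>, so
  that \<open>under\<close> need not be unfolded again.\<close>

definition opp :: "nat \<Rightarrow> sperm \<Rightarrow> sperm \<Rightarrow> bool" where
  "opp n y z \<longleftrightarrow> (\<forall>j. j \<noteq> 0 \<and> \<bar>j\<bar> \<le> int n \<longrightarrow>
     (\<bar>y j\<bar> \<le> int n \<longrightarrow> z j = - y j) \<and> (int n < \<bar>y j\<bar> \<longrightarrow> int n < \<bar>z j\<bar> \<and> (0 < y j \<longleftrightarrow> z j < 0)))"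

lemma oppD:
  assumes "opp n y z" "j \<noteq> 0" "\<bar>j\<bar> \<le> int n"
  shows "\<bar>y j\<bar> \<le> int n \<Longrightarrow> z j = - y j" "int n < \<bar>y j\<bar> \<Longrightarrow> int n < \<bar>z j\<bar>"
    "int n < \<bar>y j\<bar> \<Longrightarrow> 0 < y j \<longleftrightarrow> z j < 0"
  using assms by (auto simp: opp_def)

lemma opp_unique:
  assumes a: "opp n z a" "a \<in> GBC n" and b: "opp n z b" "b \<in> GBC n" shows "a = b"
proof (rule GBC_eqI[OF a(2) b(2)])
  fix j assume j: "j \<noteq> 0" "\<bar>j\<bar> \<le> int n"
  show "b j = a j" if "\<bar>a j\<bar> \<le> int n"
  proof (cases "\<bar>z j\<bar> \<le> int n")
    case True
    then show ?thesis using oppD(1)[OF a(1) j] oppD(1)[OF b(1) j] by simp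
  next
    case False
    then show ?thesis using oppD(2)[OF a(1) j] that by simp
  qed
  show "int n < \<bar>b j\<bar> \<and> (0 < a j \<longleftrightarrow> 0 < b j)" if "int n < \<bar>a j\<bar>"
  proof (cases "\<bar>z j\<bar> \<le> int n")
    case True
    then show ?thesis using oppD(1)[OF a(1) j] oppD(1)[OF b(1) j] that by simp
  next
    case False
    then have "int n < \<bar>b j\<bar>" "0 < z j \<longleftrightarrow> a j < 0" "0 < z j \<longleftrightarrow> b j < 0"
      using oppD(2,3)[OF a(1) j] oppD(2,3)[OF b(1) j] by auto
    then show ?thesis using that by linarith
  qed
qed

lemma opp_sym: assumes o: "opp n y z" shows "opp n z y"
  unfolding opp_def
proof (intro allI impI)
  fix j assume j: "j \<noteq> 0 \<and> \<bar>j\<bar> \<le> int n"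
  show "(\<bar>z j\<bar> \<le> int n \<longrightarrow> y j = - z j) \<and> (int n < \<bar>z j\<bar> \<longrightarrow> int n < \<bar>y j\<bar> \<and> (0 < z j \<longleftrightarrow> y j < 0))"
  proof (cases "\<bar>y j\<bar> \<le> int n")
    case True
    then show ?thesis using oppD(1)[OF o, of j] j by simp
  next
    case False
    then have "int n < \<bar>z j\<bar>" "0 < y j \<longleftrightarrow> z j < 0" using oppD(2,3)[OF o, of j] j by auto
    then have "0 < z j \<longleftrightarrow> y j < 0" using False by linarith
    then show ?thesis using False \<open>int n < \<bar>z j\<bar>\<close> by simp
  qed
qed

lemma iota_opp: assumes z: "z \<in> GBC n" shows "iota n z \<in> GBC n" "opp n z (iota n z)"
proof -
  let ?w = "negw n (wof n z)"
  have w: "?w \<in> InvBC n" by (rule negw_InvBC[OF wof_InvBC[OF z]])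
  have y: "under n ?w \<in> GBC n" by (rule under_props(1)[OF w])
  have p: "(\<bar>z j\<bar> \<le> int n \<longrightarrow> under n ?w j = - z j) \<and>
     (int n < \<bar>z j\<bar> \<longrightarrow> int n < \<bar>under n ?w j\<bar> \<and> (0 < z j \<longleftrightarrow> under n ?w j < 0))" if j: "1 \<le> j" "j \<le> int n" for j
  proof -
    have nf: "\<bar>z j\<bar> \<noteq> j" using GBC_nofix[OF z, of j] j by simp
    have wj: "?w j = (if \<bar>z j\<bar> \<le> int n then - z j else - (sgn (z j) * j))" using j by (simp add: negw_def wof_def)
    show ?thesis using under_props(2)[OF w j] nf wj j by (auto simp: sgn_if split: if_splits)
  qed
  show "iota n z \<in> GBC n" using y by (simp add: iota_eq[OF z])
  show "opp n z (iota n z)" unfolding iota_eq[OF z] opp_def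
  proof (intro allI impI)
    fix j assume j: "j \<noteq> 0 \<and> \<bar>j\<bar> \<le> int n"
    show "(\<bar>z j\<bar> \<le> int n \<longrightarrow> under n ?w j = - z j) \<and>
     (int n < \<bar>z j\<bar> \<longrightarrow> int n < \<bar>under n ?w j\<bar> \<and> (0 < z j \<longleftrightarrow> under n ?w j < 0))"
    proof (cases "0 < j")
      case True
      then show ?thesis using p[of j] j by simp
    next
      case False
      have "z j \<noteq> 0" "under n ?w j \<noteq> 0" using GBC_zero_iff[OF z] GBC_zero_iff[OF y] j by auto
      then show ?thesis using p[of "- j"] j False GBC_uminus[OF z, of j] GBC_uminus[OF y, of j] by auto
    qed
  qed
qed

lemma iota_iota: assumes z: "z \<in> GBC n" shows "iota n (iota n z) = z"
  using opp_unique[of n "iota n z" "iota n (iota n z)" z] iota_opp[OF z] iota_opp[OF iota_opp(1)[OF z]]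
    opp_sym z by blast

text \<open>Negating values reverses their order, and changing the sign of a value beyond n reverses
  its comparison with values inside \<plusminus>[n] and with values beyond n of the other sign. Only
  two values beyond n of equal sign escape, since their new sizes are unknown; this is
  \<open>eqa\<close>.\<close>

lemma opp_types:
  assumes y: "y \<in> GBC n" and z: "z \<in> GBC n" and o: "opp n y z" and i: "i < n"
  shows "eqd i z \<longleftrightarrow> eqd i y" "eqa n i z \<longleftrightarrow> eqa n i y" "\<not> eqa n i y \<Longrightarrow> asc i z \<longleftrightarrow> \<not> asc i y"
proof -
  note o1 = oppD[OF o, of "int i"] and o2 = oppD[OF o, of "int i + 1"]
  have nz: "y (int i + 1) \<noteq> 0" "z (int i + 1) \<noteq> 0" "y (int i) \<noteq> y (int i + 1)"
    using GBC_zero_iff[OF y] GBC_zero_iff[OF z] GBC_eq_iff[OF y] by auto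
  have sg: "z (int i + 1) < 0 \<longleftrightarrow> \<not> 0 < z (int i + 1)" "y (int i + 1) < 0 \<longleftrightarrow> \<not> 0 < y (int i + 1)"
    using nz by auto
  have nz': "z (int i) < 0 \<longleftrightarrow> \<not> 0 < z (int i)" "y (int i) < 0 \<longleftrightarrow> \<not> 0 < y (int i)" if "0 < i"
    using that GBC_zero_iff[OF y, of "int i"] GBC_zero_iff[OF z, of "int i"] by auto
  have p1: "\<bar>int i + 1\<bar> \<le> int n" "int i + 1 \<noteq> 0" using i by auto
  show "eqd i z \<longleftrightarrow> eqd i y"
  proof (cases "i = 0")
    case False
    then have i0: "int i \<noteq> 0" "\<bar>int i\<bar> \<le> int n" using i by auto
    show ?thesis
    proof (cases "\<bar>y (int i)\<bar> \<le> int n")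
      case True
      then show ?thesis using o1(1)[OF i0] by (simp add: eqd_def)
    next
      case False
      then show ?thesis using o1(2)[OF i0] i by (simp add: eqd_def)
    qed
  qed (simp add: eqd_def)
  show "eqa n i z \<longleftrightarrow> eqa n i y"
  proof (cases "i = 0")
    case False
    then have i0: "int i \<noteq> 0" "\<bar>int i\<bar> \<le> int n" using i by auto
    consider "\<bar>y (int i)\<bar> \<le> int n" | "\<bar>y (int i + 1)\<bar> \<le> int n"
      | "int n < \<bar>y (int i)\<bar>" "int n < \<bar>y (int i + 1)\<bar>" by linarith
    then show ?thesis
    proof cases
      case 1 then show ?thesis using o1(1)[OF i0] by (simp add: eqa_def)
    next
      case 2 then show ?thesis using o2(1)[OF p1(2,1)] by (simp add: eqa_def)
    next
      case 3
      then show ?thesis using o1(2,3)[OF i0] o2(2,3)[OF p1(2,1)] sg nz' False by (auto simp: eqa_def)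
    qed
  qed (simp add: eqa_def)
  show "asc i z \<longleftrightarrow> \<not> asc i y" if ne: "\<not> eqa n i y"
  proof (cases "i = 0")
    case True
    then show ?thesis using o2 i nz by (cases "\<bar>y 1\<bar> \<le> int n") (auto simp: asc_0)
  next
    case False
    then have i0: "int i \<noteq> 0" "\<bar>int i\<bar> \<le> int n" using i by auto
    consider "\<bar>y (int i)\<bar> \<le> int n" "\<bar>y (int i + 1)\<bar> \<le> int n"
      | "\<bar>y (int i)\<bar> \<le> int n" "int n < \<bar>y (int i + 1)\<bar>"
      | "int n < \<bar>y (int i)\<bar>" "\<bar>y (int i + 1)\<bar> \<le> int n"
      | "int n < \<bar>y (int i)\<bar>" "int n < \<bar>y (int i + 1)\<bar>" by linarith
    then show ?thesis
    proof cases
      case 1 then show ?thesis using o1(1)[OF i0] o2(1)[OF p1(2,1)] nz False by (auto simp: asc_Suc)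
    next
      case 2
      then show ?thesis using o1(1)[OF i0] o2(2,3)[OF p1(2,1)] False by (auto simp: asc_Suc)
    next
      case 3
      then show ?thesis using o1(2,3)[OF i0] o2(1)[OF p1(2,1)] False by (auto simp: asc_Suc)
    next
      case 4
      then have "0 < y (int i) \<longleftrightarrow> y (int i + 1) < 0" using ne sg False by (simp add: eqa_def)
      then show ?thesis using 4 o1(2,3)[OF i0] o2(2,3)[OF p1(2,1)] sg nz' False
        by (cases "0 < y (int i)") (auto simp: asc_Suc)
    qed
  qed
qed

lemma opp_mv:
  assumes o: "opp n y z" and i: "i < n"
  shows "opp n (mv i y) (mv i z)"
  unfolding opp_def
proof (intro allI impI)
  fix j assume j: "j \<noteq> 0 \<and> \<bar>j\<bar> \<le> int n"
  have le: "\<bar>sgen i t\<bar> \<le> int n \<longleftrightarrow> \<bar>t\<bar> \<le> int n" for t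
    using i sgen_abs_le_iff[of i "int n" t] by simp
  have out: "sgen i t = t" if "int n < \<bar>t\<bar>" for t using that i sgen_outside[of i t] by simp
  let ?k = "sgen i j"
  have k: "?k \<noteq> 0" "\<bar>?k\<bar> \<le> int n" using j le by auto
  note o' = oppD[OF o k]
  show "(\<bar>mv i y j\<bar> \<le> int n \<longrightarrow> mv i z j = - mv i y j) \<and>
    (int n < \<bar>mv i y j\<bar> \<longrightarrow> int n < \<bar>mv i z j\<bar> \<and> (0 < mv i y j \<longleftrightarrow> mv i z j < 0))"
  proof (cases "\<bar>y ?k\<bar> \<le> int n")
    case True
    then show ?thesis using o'(1) le by (auto simp: mv_apply)
  next
    case False
    then show ?thesis using o'(2,3) out by (auto simp: mv_apply)
  qed
qed

lemma iota_mv: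
  assumes z: "z \<in> GBC n" and i: "i < n" and ne: "\<not> eqa n i z"
  shows "iota n (mv i z) = mv i (iota n z)"
proof -
  note o = iota_opp[OF z]
  have m: "mv i z \<in> GBC n" by (rule mv_GBC[OF z i ne])
  have "\<not> eqa n i (iota n z)" using opp_types(2)[OF z o(1,2) i] ne by simp
  then have "mv i (iota n z) \<in> GBC n" by (rule mv_GBC[OF o(1) i])
  then show ?thesis using opp_unique[OF iota_opp(2)[OF m] iota_opp(1)[OF m] opp_mv[OF o(2) i]] by blast
qed

lemma kap_iota: assumes z: "z \<in> GBC n" shows "kap n (iota n z) = kap n z"
proof -
  note o = iota_opp[OF z]
  have "tset n (iota n z) = uminus ` tset n z"
  proof (intro set_eqI)
    fix t
    have e: "t \<in> uminus ` tset n z \<longleftrightarrow> - t \<in> tset n z" by force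
    show "t \<in> tset n (iota n z) \<longleftrightarrow> t \<in> uminus ` tset n z"
    proof (cases "t \<noteq> 0 \<and> \<bar>t\<bar> \<le> int n")
      case True
      then have "z t \<noteq> 0" using GBC_zero_iff[OF z] by simp
      then show ?thesis unfolding e using oppD[OF o(2), of t] True GBC_uminus[OF z, of t]
        by (cases "\<bar>z t\<bar> \<le> int n") (auto simp: tset_def)
    next
      case False
      have "iota n z 0 = 0" "z 0 = 0" using GBC_zero_iff[OF z] GBC_zero_iff[OF o(1)] by auto
      then show ?thesis unfolding e using False by (auto simp: tset_def)
    qed
  qed
  then show ?thesis by (simp add: kap_def card_image)
qed

section \<open>The Hecke operators\<close>

type_synonym lp = "int \<Rightarrow>\<^sub>0 int"

definition vx :: lp where "vx = Poly_Mapping.single 1 1"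
definition vy :: lp where "vy = Poly_Mapping.single (-1) 1"
definition vd :: lp where "vd = vx - vy"

text \<open>The scalars by which H_s acts on weak descents (\<open>ed\<close>) and on weak ascents
  (\<open>ea\<close>). Both x and -x^-1 are roots of t^2 = 1 + \<delta> t, with \<delta> = x -
  x^-1.\<close>

fun ed :: "modkind \<Rightarrow> lp" where
  "ed ModM = vx" | "ed ModN = - vy"
fun ea :: "modkind \<Rightarrow> lp" where
  "ea ModM = - vy" | "ea ModN = vx"

lemma vx_vy: "vx * vy = 1" "vy * vx = 1"
  by (simp_all add: vx_def vy_def mult_single)

lemma ed_quad: "ed k * ed k = 1 + vd * ed k" and ea_quad: "ea k * ea k = 1 + vd * ea k"
  by (cases k; simp add: vd_def algebra_simps vx_vy)+

text \<open>Outside the index set the operator is the scalar \<open>ed k\<close>, so that the quadratic and the braid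
  relations hold on all functions.\<close>
definition xop :: "modkind \<Rightarrow> nat \<Rightarrow> nat \<Rightarrow> (sperm \<Rightarrow> lp) \<Rightarrow> (sperm \<Rightarrow> lp)" where
  "xop k n i A = (\<lambda>z. if z \<notin> GBC n \<or> eqd i z then ed k * A z else if eqa n i z then ea k * A z
     else if asc i z then A (mv i z) else A (mv i z) + vd * A z)"

lemma xop_asc: "z \<in> GBC n \<Longrightarrow> asc i z \<Longrightarrow> \<not> eqd i z \<Longrightarrow> \<not> eqa n i z \<Longrightarrow> xop k n i A z = A (mv i z)"
  and xop_desc: "z \<in> GBC n \<Longrightarrow> \<not> asc i z \<Longrightarrow> \<not> eqd i z \<Longrightarrow> \<not> eqa n i z \<Longrightarrow> xop k n i A z = A (mv i z) + vd * A z"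
  and xop_eqd: "eqd i z \<Longrightarrow> xop k n i A z = ed k * A z"
  and xop_eqa: "z \<in> GBC n \<Longrightarrow> i < n \<Longrightarrow> eqa n i z \<Longrightarrow> xop k n i A z = ea k * A z"
  and xop_out: "z \<notin> GBC n \<Longrightarrow> xop k n i A z = ed k * A z"
  using eqd_eqa[of i n z] by (auto simp: xop_def)

definition linop :: "((sperm \<Rightarrow> lp) \<Rightarrow> (sperm \<Rightarrow> lp)) \<Rightarrow> bool" where
  "linop F \<longleftrightarrow> (\<forall>c A B. F (\<lambda>z. A z + c * B z) = (\<lambda>z. F A z + c * F B z))"

lemma linopD: "linop F \<Longrightarrow> F (\<lambda>z. A z + c * B z) = (\<lambda>z. F A z + c * F B z)"
  by (simp add: linop_def)

lemma linop_xop: "linop (xop k n i)"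
  by (auto simp: linop_def xop_def fun_eq_iff algebra_simps)

lemma linop_comp: "linop F \<Longrightarrow> linop H \<Longrightarrow> linop (\<lambda>A. F (H A))"
  by (simp add: linop_def)

lemma linop_zero: assumes "linop F" shows "F (\<lambda>_. 0) = (\<lambda>_. 0)"
proof -
  have "F (\<lambda>z. 0 + (-1) * 0) = (\<lambda>z. F (\<lambda>_. 0) z + (-1) * F (\<lambda>_. 0) z)"
    by (rule linopD[OF assms, of "\<lambda>_. 0" "-1" "\<lambda>_. 0"])
  then show ?thesis by simp
qed

lemma linop_scale: assumes "linop F" shows "F (\<lambda>z. c * B z) = (\<lambda>z. c * F B z)"
  using linopD[OF assms, of "\<lambda>_. 0" c B] linop_zero[OF assms] by simp

lemma linop_sum: assumes "linop F" "finite S"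
  shows "F (\<lambda>z. \<Sum>a\<in>S. c a * B a z) = (\<lambda>z. \<Sum>a\<in>S. c a * F (B a) z)"
  using assms(2)
proof (induction S rule: finite_induct)
  case empty
  then show ?case using linop_zero[OF assms(1)] by simp
next
  case (insert a S)
  have "F (\<lambda>z. (\<Sum>a\<in>S. c a * B a z) + c a * B a z) = (\<lambda>z. (\<Sum>a\<in>S. c a * F (B a) z) + c a * F (B a) z)"
    using linopD[OF assms(1), of "\<lambda>z. \<Sum>a\<in>S. c a * B a z" "c a" "B a"] insert by simp
  then show ?case using insert by (simp add: add.commute)
qed

lemma xop_quad:
  assumes i: "i < n"
  shows "xop k n i (xop k n i A) z = A z + vd * xop k n i A z"
proof -
  consider "z \<notin> GBC n" | "z \<in> GBC n" "eqd i z" | "z \<in> GBC n" "eqa n i z"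
    | "z \<in> GBC n" "\<not> eqd i z" "\<not> eqa n i z" by blast
  then show ?thesis
  proof cases
    case 1
    have "ed k * (ed k * A z) = (ed k * ed k) * A z" by (simp only: mult.assoc)
    also have "\<dots> = A z + vd * (ed k * A z)" unfolding ed_quad by (simp add: algebra_simps)
    finally show ?thesis using 1 by (simp add: xop_out)
  next
    case 2
    have "ed k * (ed k * A z) = (ed k * ed k) * A z" by (simp only: mult.assoc)
    also have "\<dots> = A z + vd * (ed k * A z)" unfolding ed_quad by (simp add: algebra_simps)
    finally show ?thesis using 2 by (simp add: xop_eqd)
  next
    case 3
    have "ea k * (ea k * A z) = (ea k * ea k) * A z" by (simp only: mult.assoc)
    also have "\<dots> = A z + vd * (ea k * A z)" unfolding ea_quad by (simp add: algebra_simps)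
    finally show ?thesis using 3 i by (simp add: xop_eqa)
  next
    case 4
    note m = mv_GBC[OF 4(1) i 4(3)] mv_types[OF 4(1) i 4(2,3)]
    show ?thesis using 4 m by (cases "asc i z") (simp_all add: xop_asc xop_desc)
  qed
qed

text \<open>By the quadratic relation this is the inverse of H_s, which is also the image of H_s
  under bar.\<close>

definition xinv :: "modkind \<Rightarrow> nat \<Rightarrow> nat \<Rightarrow> (sperm \<Rightarrow> lp) \<Rightarrow> (sperm \<Rightarrow> lp)" where
  "xinv k n i A = (\<lambda>z. xop k n i A z - vd * A z)"

lemma xinv_xop: "i < n \<Longrightarrow> xinv k n i (xop k n i A) = A"
  by (simp add: xinv_def xop_quad fun_eq_iff)

lemma xop_xinv: assumes "i < n" shows "xop k n i (xinv k n i A) = A"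
proof -
  have "xop k n i (xinv k n i A) = (\<lambda>z. xop k n i (xop k n i A) z + (- vd) * xop k n i A z)"
    using linopD[OF linop_xop, of k n i "xop k n i A" "- vd" A] by (simp add: xinv_def)
  then show ?thesis using assms by (simp add: xop_quad fun_eq_iff)
qed

lemma linop_xinv: "linop (xinv k n i)"
  using linop_xop[of k n i] by (auto simp: linop_def xinv_def fun_eq_iff algebra_simps)

lemma GBC_induct_len [consumes 1, case_names step]:
  assumes "z \<in> GBC n" "\<And>z. z \<in> GBC n \<Longrightarrow> (\<And>y. y \<in> GBC n \<Longrightarrow> len (2 * n) y < len (2 * n) z \<Longrightarrow> P y) \<Longrightarrow> P z"
  shows "P z"
  using assms(1) by (induction "len (2 * n) z" arbitrary: z rule: less_induct) (use assms(2) in blast)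

text \<open>All that is needed to go down along a strict descent. The last clause is the form in
  which the ascent from \<open>mv i z\<close> to \<open>z\<close> enters
  \<open>braid_step\<close>.\<close>

lemma mv_desc:
  assumes "z \<in> GBC n" "i < n" "\<not> asc i z" "\<not> eqd i z" "\<not> eqa n i z"
  shows "mv i z \<in> GBC n" "len (2 * n) z = len (2 * n) (mv i z) + 2" "asc i (mv i z)"
    "\<not> eqd i (mv i z)" "\<not> eqa n i (mv i z)" "xop k n i B (mv i z) = B z"
proof -
  show m: "mv i z \<in> GBC n" "asc i (mv i z)" "\<not> eqd i (mv i z)" "\<not> eqa n i (mv i z)"
    using mv_GBC mv_types assms by blast+
  show "len (2 * n) z = len (2 * n) (mv i z) + 2" using len_mv[OF m(1) assms(2) m(2,3)] by simp
  show "xop k n i B (mv i z) = B z" using m by (simp add: xop_asc)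
qed

subsection \<open>Braid relations\<close>

text \<open>If the braid relation holds at \<open>y\<close> and \<open>s\<close> is an ascent of \<open>y\<close> to \<open>z\<close> then it holds at \<open>z\<close>:
  writing the two sides as \<open>L = s P\<close> and \<open>R = P u\<close>, one has \<open>s L = P + \<delta> L\<close> and
  \<open>s R = L u = R u = P + \<delta> R\<close> at \<open>y\<close>. So only elements without descent in the rank two parabolic
  subgroup have to be inspected.\<close>
lemma braid_step:
  assumes i: "i < n" "u < n" and P: "linop P" and s: "\<And>B. xop k n i B y = B z"
    and IH: "\<And>A. xop k n i (P A) y = P (xop k n u A) y"
  shows "xop k n i (P A) z = P (xop k n u A) z"
proof -
  have "xop k n i (P A) z = xop k n i (xop k n i (P A)) y" using s by simp
  also have "\<dots> = P A y + vd * xop k n i (P A) y" by (rule xop_quad[OF i(1)])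
  finally have 1: "xop k n i (P A) z = P A y + vd * P (xop k n u A) y" using IH by simp
  have "P (xop k n u A) z = xop k n i (P (xop k n u A)) y" using s by simp
  also have "\<dots> = P (xop k n u (xop k n u A)) y" by (rule IH)
  also have "xop k n u (xop k n u A) = (\<lambda>z. A z + vd * xop k n u A z)"
    by (rule ext) (rule xop_quad[OF i(2)])
  also have "P (\<lambda>z. A z + vd * xop k n u A z) y = P A y + vd * P (xop k n u A) y" by (simp add: linopD[OF P])
  finally show ?thesis using 1 by simp
qed

section \<open>The relation between commuting letters\<close>

lemma GBC_abs_swap: "z \<in> GBC n \<Longrightarrow> \<bar>z a\<bar> = \<bar>b\<bar> \<longleftrightarrow> \<bar>z b\<bar> = \<bar>a\<bar>"
  by (metis GBC_WBC GBC_invol WBC_abs_eq_iff)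

lemma sgen_commute:
  assumes "i + 2 \<le> j" shows "sgen i (sgen j a) = sgen j (sgen i a)"
proof (cases "\<bar>a\<bar> = int j \<or> \<bar>a\<bar> = int j + 1")
  case True
  moreover have "\<bar>sgen j a\<bar> = int j \<or> \<bar>sgen j a\<bar> = int j + 1" using True assms by (auto simp: sgen_Suc)
  ultimately show ?thesis using sgen_fixed[of a i] sgen_fixed[of "sgen j a" i] assms by auto
next
  case False
  moreover have "\<bar>sgen i a\<bar> \<noteq> int j \<and> \<bar>sgen i a\<bar> \<noteq> int j + 1"
    using False sgen_fixed[of a i] sgen_abs_le_iff[of i "int i + 1" a] assms
    by (cases "\<bar>a\<bar> \<le> int i + 1") auto
  ultimately show ?thesis using sgen_fixed[of a j] sgen_fixed[of "sgen i a" j] by auto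
qed

lemma mv_commute: assumes "i + 2 \<le> j" shows "mv i (mv j z) = mv j (mv i z)"
  by (simp add: fun_eq_iff mv_apply sgen_commute[OF assms])

lemma commuting_types:
  assumes z: "z \<in> GBC n" and ij: "i + 2 \<le> j" "j < n"
  shows "eqd j (mv i z) \<longleftrightarrow> eqd j z" "eqa n j (mv i z) \<longleftrightarrow> eqa n j z"
    "eqd i (mv j z) \<longleftrightarrow> eqd i z" "eqa n i (mv j z) \<longleftrightarrow> eqa n i z"
proof -
  have s: "sgen i (int j) = int j" "sgen i (int j + 1) = int j + 1" "sgen j (int i) = int i" "sgen j (int i + 1) = int i + 1"
    using ij by (auto intro: sgen_fixed)
  have out: "int n < \<bar>sgen a t\<bar> \<longleftrightarrow> int n < \<bar>t\<bar>" if "a < n" for a t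
    using that sgen_abs_le_iff[of a "int n" t] by auto
  have out': "sgen a t = t" if "a < n" "int n < \<bar>t\<bar>" for a t
    using that by (auto intro: sgen_outside)
  have ab: "\<bar>sgen a t\<bar> = \<bar>u\<bar> \<longleftrightarrow> \<bar>t\<bar> = \<bar>u\<bar>" if "sgen a u = u" for a t u
    using that by (metis abs_eq_iff sgen_invol sgen_uminus)
  show "eqd j (mv i z) \<longleftrightarrow> eqd j z" using s ab[of i "int j + 1" "z (int j)"] by (simp add: eqd_def mv_apply)
  show "eqd i (mv j z) \<longleftrightarrow> eqd i z" using s ab[of j "int i + 1" "z (int i)"] by (simp add: eqd_def mv_apply)
  show "eqa n j (mv i z) \<longleftrightarrow> eqa n j z"
    using s out[of i] out'[of i] ij by (auto simp: eqa_def mv_apply)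
  show "eqa n i (mv j z) \<longleftrightarrow> eqa n i z"
    using s out[of j] out'[of j] ij by (auto simp: eqa_def mv_apply)
qed

text \<open>Conjugation by s_i can destroy the ascent at j only by exchanging the values z(j) and
  z(j + 1), that is, if z s_j z = s_i. In this case s_i z s_i = s_j z s_j, so both letters lead to
  the same element.\<close>

lemma commuting_asc:
  assumes z: "z \<in> GBC n" and ij: "i + 2 \<le> j" "j < n" and a: "asc i z" "asc j z"
  shows "(asc j (mv i z) \<and> asc i (mv j z)) \<or> (i \<noteq> 0 \<and> mv i z = mv j z)"
proof (cases "i = 0")
  case True
  have "z (int j) \<noteq> - z (int j + 1)" using GBC_uminus[OF z, of "int j + 1"] GBC_eq_iff[OF z, of "int j" "- (int j + 1)"] by simp
  then have "sgen 0 (z (int j)) < sgen 0 (z (int j + 1))"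
    using sgen0_less_iff[of "z (int j)" "z (int j + 1)"] GBC_zero_iff[OF z, of "int j"] GBC_zero_iff[OF z, of "int j + 1"] a ij
    by (auto simp: asc_Suc)
  then have "asc j (mv 0 z)" using ij by (simp add: asc_Suc mv_apply sgen_0)
  moreover have "asc 0 (mv j z)" using a ij True by (auto simp: asc_0 mv_apply sgen_Suc)
  ultimately show ?thesis using True by simp
next
  case False
  have s: "sgen i (int j) = int j" "sgen i (int j + 1) = int j + 1" "sgen j (int i) = int i" "sgen j (int i + 1) = int i + 1"
    using ij by (auto intro: sgen_fixed)
  have lt: "z (int i) < z (int i + 1)" "z (int j) < z (int j + 1)" using a False ij by (auto simp: asc_Suc)
  show ?thesis
  proof (cases "(z (int i) = int j \<and> z (int i + 1) = int j + 1) \<or> (z (int i) = - int j - 1 \<and> z (int i + 1) = - int j)")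
    case True
    then have c: "z (sgen i (z l)) = sgen j l" for l using GBC_conj_sgen[OF z, of i j] False ij by simp
    have "mv i z l = mv j z l" for l
    proof -
      have 1: "z (sgen i l) = sgen j (z l)" using c[of "z l"] GBC_invol[OF z, of l] by simp
      have 2: "z (sgen j l) = sgen i (z l)" using c[of l] GBC_invol[OF z] by metis
      show ?thesis using 1 2 sgen_commute[OF ij(1)] by (simp add: mv_apply)
    qed
    then show ?thesis using False by auto
  next
    case ne: False
    then have ne': "\<not> ((z (int j) = int i \<and> z (int j + 1) = int i + 1) \<or> (z (int j) = - int i - 1 \<and> z (int j + 1) = - int i))"
      using GBC_invol[OF z, of "int j"] GBC_invol[OF z, of "int j + 1"] GBC_uminus[OF z, of "int i"] GBC_uminus[OF z, of "int i + 1"]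
      by auto
    have "sgen i (z (int j)) < sgen i (z (int j + 1))"
      using sgen_less_iff[of i "z (int j)" "z (int j + 1)"] False ne' lt by auto
    moreover have "sgen j (z (int i)) < sgen j (z (int i + 1))"
      using sgen_less_iff[of j "z (int i)" "z (int i + 1)"] ij ne lt by auto
    ultimately show ?thesis using s ij False by (simp add: asc_Suc mv_apply)
  qed
qed

text \<open>After \<open>braid_step\<close> there are no strict descents left. A weak letter acts by
  the same scalar before and after a strict move by the other one. Two strict ascents span a square
  or, in the exceptional case of \<open>commuting_asc\<close>, a pair of elements on which both
  letters act alike.\<close>

lemma xop_commute:
  assumes ij: "i + 2 \<le> j" "j < n"
  shows "xop k n i (xop k n j A) = xop k n j (xop k n i A)"
proof
  fix z
  have i: "i < n" using ij by simp
  show "xop k n i (xop k n j A) z = xop k n j (xop k n i A) z"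
  proof (cases "z \<in> GBC n")
    case False
    then show ?thesis by (simp add: xop_out mult.left_commute)
  next
    case True
    then have "\<forall>A. xop k n i (xop k n j A) z = xop k n j (xop k n i A) z"
    proof (induction z rule: GBC_induct_len)
      case (step z)
      note z = step(1)
      show ?case
      proof
        fix A
        note ct = commuting_types[OF z ij]
        consider "\<not> asc i z" "\<not> eqd i z" "\<not> eqa n i z" | "\<not> asc j z" "\<not> eqd j z" "\<not> eqa n j z"
          | "asc i z \<or> eqd i z \<or> eqa n i z" "asc j z \<or> eqd j z \<or> eqa n j z" by blast
        then show "xop k n i (xop k n j A) z = xop k n j (xop k n i A) z"
        proof cases
          case 1
          note d = mv_desc[OF z i 1]
          show ?thesis
            by (rule braid_step[OF i i linop_xop d(6)]) (use step(2)[OF d(1)] d(2) in simp)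
        next
          case 2
          note d = mv_desc[OF z ij(2) 2]
          show ?thesis
            by (rule sym, rule braid_step[OF ij(2) ij(2) linop_xop d(6)]) (use step(2)[OF d(1)] d(2) in simp)
        next
          case 3
          have scal: ?thesis if "\<And>B. xop k n i B z = c * B z" "\<And>B. xop k n j B z = c' * B z" for c c'
            using that by (simp add: mult.left_commute)
          have half: ?thesis if "\<And>B. xop k n i B z = c * B z" "\<And>B. xop k n i B (mv j z) = c * B (mv j z)"
            "\<And>B. xop k n j B z = B (mv j z)" for c using that by simp
          have half': ?thesis if "\<And>B. xop k n j B z = c * B z" "\<And>B. xop k n j B (mv i z) = c * B (mv i z)"
            "\<And>B. xop k n i B z = B (mv i z)" for c using that by simp
          have mi: "mv i z \<in> GBC n" if "\<not> eqa n i z" using mv_GBC[OF z i that] .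
          have mj: "mv j z \<in> GBC n" if "\<not> eqa n j z" using mv_GBC[OF z ij(2) that] .
          show ?thesis
          proof (cases "eqd i z \<or> eqa n i z")
            case ei: True
            show ?thesis
            proof (cases "eqd j z \<or> eqa n j z")
              case True
              then show ?thesis using ei z i ij by (elim disjE; intro scal) (auto simp: xop_eqd xop_eqa)
            next
              case False
              then show ?thesis using 3 ei z i ij mj ct
                by (elim disjE; intro half) (auto simp: xop_eqd xop_eqa xop_asc)
            qed
          next
            case ni: False
            show ?thesis
            proof (cases "eqd j z \<or> eqa n j z")
              case True
              then show ?thesis using 3 ni z i ij mi ct
                by (elim disjE; intro half') (auto simp: xop_eqd xop_eqa xop_asc)
            next
              case nj: False
              then have a: "asc i z" "asc j z" using 3 ni by auto
              note m = mi mj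
              have L: "xop k n i (xop k n j A) z = xop k n j A (mv i z)" "xop k n j (xop k n i A) z = xop k n i A (mv j z)"
                using z a ni nj by (auto simp: xop_asc)
              from commuting_asc[OF z ij a] show ?thesis
              proof
                assume "asc j (mv i z) \<and> asc i (mv j z)"
                then show ?thesis unfolding L using m ni nj ct mv_commute[OF ij(1), of z] by (simp add: xop_asc)
              next
                assume e: "i \<noteq> 0 \<and> mv i z = mv j z"
                have "xop k n j A (mv j z) = A z + vd * A (mv j z)" "xop k n i A (mv i z) = A z + vd * A (mv i z)"
                  using m ni nj mv_types[OF z i] mv_types[OF z ij(2)] a by (auto simp: xop_desc)
                then show ?thesis unfolding L using e by simp
              qed
            qed
          qed
        qed
      qed
    qed
    then show ?thesis by blast
  qed
qed

section \<open>The relations between neighbouring letters\<close>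

lemma sgen_braid3: assumes "0 < i"
  shows "sgen i (sgen (i + 1) (sgen i a)) = sgen (i + 1) (sgen i (sgen (i + 1) a))"
proof (cases "\<bar>a\<bar> < int i \<or> int i + 2 < \<bar>a\<bar>")
  case True
  then have "sgen i a = a" "sgen (i + 1) a = a" by (auto intro: sgen_fixed)
  then show ?thesis by simp
next
  case False
  then have "a = int i \<or> a = int i + 1 \<or> a = int i + 2 \<or> a = - int i \<or> a = - (int i + 1) \<or> a = - (int i + 2)" by linarith
  then show ?thesis using assms by (elim disjE) (simp_all add: sgen_Suc)
qed

lemma mv_braid3: assumes "0 < i"
  shows "mv i (mv (i + 1) (mv i z)) = mv (i + 1) (mv i (mv (i + 1) z))"
  by (rule ext) (simp only: mv_apply sgen_braid3[OF assms])

lemma sgen_braid4: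
  notes [simp del] = One_nat_def
  shows "sgen 1 (sgen 0 (sgen 1 (sgen 0 a))) = sgen 0 (sgen 1 (sgen 0 (sgen 1 a)))"
proof (cases "2 < \<bar>a\<bar>")
  case True
  then have "sgen 0 a = a" "sgen 1 a = a" by (auto intro: sgen_fixed)
  then show ?thesis by simp
next
  case False
  then have "a = 0 \<or> a = 1 \<or> a = 2 \<or> a = - 1 \<or> a = - 2" by linarith
  then show ?thesis by (elim disjE) (simp_all add: sgen_Suc sgen_0)
qed

lemma mv_braid4: "mv 1 (mv 0 (mv 1 (mv 0 z))) = mv 0 (mv 1 (mv 0 (mv 1 z)))"
  by (rule ext) (simp only: mv_apply sgen_braid4)

text \<open>Let j = i + 1. Either both letters act by one scalar (\<open>aa\<close>), or z starts a
  chain of three elements whose ends carry weak letters of the same kind (\<open>ds\<close>,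
  \<open>sd\<close>, \<open>as\<close>, \<open>sa\<close>), or z starts a hexagon of strict moves
  (\<open>ss\<close>). The conditions in \<open>dd\<close>, \<open>da\<close> and \<open>ad\<close>
  are incompatible.\<close>

lemma braid3_base:
  assumes z: "z \<in> GBC n" and i: "0 < i" "i + 1 < n"
    and ti: "asc i z \<or> eqd i z \<or> eqa n i z" and tj: "asc (i + 1) z \<or> eqd (i + 1) z \<or> eqa n (i + 1) z"
  shows "xop k n i (xop k n (i + 1) (xop k n i A)) z = xop k n (i + 1) (xop k n i (xop k n (i + 1) A)) z"
proof -
  define j where "j = i + 1"
  define a b c where "a = z (int i)" and "b = z (int i + 1)" and "c = z (int i + 2)"
  have ij: "i < n" "j < n" "int j = int i + 1" "0 < j" using i by (auto simp: j_def)
  have inI: "int i + 2 \<le> int n" using i by simp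
  have nf: "\<bar>a\<bar> \<noteq> int i" "\<bar>b\<bar> \<noteq> int i + 1" "\<bar>c\<bar> \<noteq> int i + 2"
    using GBC_nofix[OF z, of "int i"] GBC_nofix[OF z, of "int i + 1"] GBC_nofix[OF z, of "int i + 2"] i
    by (auto simp: a_def b_def c_def)
  have ne: "a \<noteq> b" "a \<noteq> c" "b \<noteq> c" and nz: "a \<noteq> 0" "b \<noteq> 0" "c \<noteq> 0"
    using GBC_eq_iff[OF z] GBC_zero_iff[OF z] i by (auto simp: a_def b_def c_def)
  have sw: "\<bar>a\<bar> = int i + 1 \<longleftrightarrow> \<bar>b\<bar> = int i" "\<bar>a\<bar> = int i + 2 \<longleftrightarrow> \<bar>c\<bar> = int i" "\<bar>b\<bar> = int i + 2 \<longleftrightarrow> \<bar>c\<bar> = int i + 1"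
    using GBC_abs_swap[OF z, of "int i" "int i + 1"] GBC_abs_swap[OF z, of "int i" "int i + 2"]
      GBC_abs_swap[OF z, of "int i + 1" "int i + 2"] by (auto simp: a_def b_def c_def)
  have sw': "a = int i + 1 \<longleftrightarrow> b = int i" "a = int i + 2 \<longleftrightarrow> c = int i" "b = int i + 2 \<longleftrightarrow> c = int i + 1"
    using GBC_swap[OF z, of "int i" "int i + 1"] GBC_swap[OF z, of "int i" "int i + 2"]
      GBC_swap[OF z, of "int i + 1" "int i + 2"] by (auto simp: a_def b_def c_def)
  have pi: "sgen i (int i) = int i + 1" "sgen i (int i + 1) = int i" "sgen i (int i + 2) = int i + 2"
    "sgen j (int i) = int i" "sgen j (int i + 1) = int i + 2" "sgen j (int i + 2) = int i + 1"
    using i by (auto simp: sgen_Suc j_def)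
  have vi: "mv i y (int i) = sgen i (y (int i + 1))" "mv i y (int i + 1) = sgen i (y (int i))" "mv i y (int i + 2) = sgen i (y (int i + 2))"
    and vj: "mv j y (int i) = sgen j (y (int i))" "mv j y (int i + 1) = sgen j (y (int i + 2))" "mv j y (int i + 2) = sgen j (y (int i + 1))"
    for y by (simp_all add: mv_apply pi)
  have T: "asc i y \<longleftrightarrow> y (int i) < y (int i + 1)" "asc j y \<longleftrightarrow> y (int i + 1) < y (int i + 2)"
    "eqd i y \<longleftrightarrow> \<bar>y (int i)\<bar> = int i + 1" "eqd j y \<longleftrightarrow> \<bar>y (int i + 1)\<bar> = int i + 2"
    "eqa n i y \<longleftrightarrow> int n < \<bar>y (int i)\<bar> \<and> int n < \<bar>y (int i + 1)\<bar> \<and> (0 < y (int i) \<longleftrightarrow> 0 < y (int i + 1))"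
    "eqa n j y \<longleftrightarrow> int n < \<bar>y (int i + 1)\<bar> \<and> int n < \<bar>y (int i + 2)\<bar> \<and> (0 < y (int i + 1) \<longleftrightarrow> 0 < y (int i + 2))"
    for y using i ij(3) by (simp_all add: asc_Suc eqd_def eqa_def j_def add.commute)
  have fix_i: "sgen i t = t" if "\<bar>t\<bar> \<noteq> int i" "\<bar>t\<bar> \<noteq> int i + 1" for t using sgen_fixed that by blast
  have fix_j: "sgen j t = t" if "\<bar>t\<bar> \<noteq> int i + 1" "\<bar>t\<bar> \<noteq> int i + 2" for t using sgen_fixed[of t j] that ij(3) by simp
  note zabc = a_def[symmetric] b_def[symmetric] c_def[symmetric]
  have adji: "b = a + 1" if "eqa n i z" using eqa_adjacent[OF z ij(1) that] by (simp add: a_def b_def)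
  have adjj: "c = b + 1" if "eqa n j z" using eqa_adjacent[OF z ij(2) that] ij(3) by (simp add: c_def b_def add.assoc)
  have big_i: "sgen i t = t" and big_j: "sgen j t = t" if "int n < \<bar>t\<bar>" for t
    using that inI by (auto intro!: fix_i fix_j)
  note X = xop_asc xop_eqd xop_eqa
  have "xop k n i (xop k n j (xop k n i A)) z = xop k n j (xop k n i (xop k n j A)) z"
  proof -
    consider (dd) "eqd i z" "eqd j z" | (da) "eqd i z" "eqa n j z" | (ad) "eqa n i z" "eqd j z" | (aa) "eqa n i z" "eqa n j z"
      | (ds) "eqd i z" "asc j z" "\<not> eqd j z" "\<not> eqa n j z" | (sd) "asc i z" "\<not> eqd i z" "\<not> eqa n i z" "eqd j z"
      | (as) "eqa n i z" "asc j z" "\<not> eqd j z" "\<not> eqa n j z" | (sa) "asc i z" "\<not> eqd i z" "\<not> eqa n i z" "eqa n j z"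
      | (ss) "asc i z" "\<not> eqd i z" "\<not> eqa n i z" "asc j z" "\<not> eqd j z" "\<not> eqa n j z"
      using ti tj unfolding j_def[symmetric] by blast
    then show ?thesis
    proof cases
      case dd then show ?thesis using sw by (simp add: T zabc)
    next
      case da then show ?thesis using sw inI by (simp add: T zabc)
    next
      case ad then show ?thesis using sw inI by (simp add: T zabc)
    next
      case aa then show ?thesis using z ij by (simp add: X)
    next
      case ds
      let ?z1 = "mv j z" and ?z2 = "mv i (mv j z)"
      have ab: "(a = int i + 1 \<and> b = int i) \<or> (a = - (int i + 1) \<and> b = - int i)"
        using eqd_swap[OF z ds(1)] by (simp add: zabc)
      have cc: "\<bar>c\<bar> \<noteq> int i" "\<bar>c\<bar> \<noteq> int i + 1" using sw ab ds(3) by (auto simp: T zabc)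
      have bc: "b < c" using ds(2) by (simp add: T zabc)
      have v1: "?z1 (int i) = (if 0 < a then int i + 2 else - (int i + 2))" "?z1 (int i + 1) = c" "?z1 (int i + 2) = b"
      proof -
        have "sgen j (- int i - 1) = - int i - 2" using sgen_uminus[of j "int i + 1"] pi by simp
        then show "?z1 (int i) = (if 0 < a then int i + 2 else - (int i + 2))" unfolding vj zabc using ab pi i by auto
        show "?z1 (int i + 1) = c" unfolding vj zabc using nf cc by (intro fix_j)
        show "?z1 (int i + 2) = b" unfolding vj zabc using ab i by (intro fix_j) auto
      qed
      \<comment> \<open>For positive a this asks for c > i + 2. It follows from c > b = i, because
        |c| differs from i, i + 1 and i + 2.\<close>
      have lt: "?z1 (int i) < ?z1 (int i + 1)" unfolding v1 using ab bc cc nf of_nat_0_le_iff[of i, where 'a = int] by (smt (verit))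
      have 1: "?z1 \<in> GBC n" "asc i ?z1" "\<not> eqd i ?z1" "\<not> eqa n i ?z1"
        using mv_GBC[OF z ij(2) ds(4)] lt inI by (auto simp: T v1)
      have 2: "eqd j ?z2" unfolding T(4) vi v1 using i by (auto simp: sgen_Suc)
      show ?thesis using z ij ds 1 2 by (simp add: X)
    next
      case sd
      let ?z1 = "mv i z" and ?z2 = "mv j (mv i z)"
      have bc: "(b = int i + 2 \<and> c = int i + 1) \<or> (b = - (int i + 2) \<and> c = - (int i + 1))"
        using eqd_swap[OF z sd(4)] ij(3) by (simp add: zabc add.assoc)
      have cc: "\<bar>a\<bar> \<noteq> int i + 2" "\<bar>a\<bar> \<noteq> int i + 1" using sw bc sd(2) by (auto simp: T zabc)
      have ab: "a < b" using sd(1) by (simp add: T zabc)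
      have v1: "?z1 (int i) = b" "?z1 (int i + 1) = a" "?z1 (int i + 2) = (if 0 < b then int i else - int i)"
      proof -
        have "sgen i (- int i - 1) = - int i" using sgen_uminus[of i "int i + 1"] pi by simp
        then show "?z1 (int i + 2) = (if 0 < b then int i else - int i)" unfolding vi zabc using bc pi i by auto
        show "?z1 (int i + 1) = a" unfolding vi zabc using nf cc by (intro fix_i)
        show "?z1 (int i) = b" unfolding vi zabc using bc i by (intro fix_i) auto
      qed
      have lt: "?z1 (int i + 1) < ?z1 (int i + 2)" unfolding v1 using ab bc cc nf of_nat_0_le_iff[of i, where 'a = int] by (smt (verit))
      have 1: "?z1 \<in> GBC n" "asc j ?z1" "\<not> eqd j ?z1" "\<not> eqa n j ?z1"
        using mv_GBC[OF z ij(1) sd(3)] lt inI cc by (auto simp: T v1)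
      have 2: "eqd i ?z2" unfolding T(3) vj v1 using i bc by (auto simp: sgen_Suc j_def)
      show ?thesis using z ij sd 1 2 by (simp add: X)
    next
      case as
      let ?z1 = "mv j z" and ?z2 = "mv i (mv j z)"
      have ab: "int n < \<bar>a\<bar>" "int n < \<bar>b\<bar>" "0 < a \<longleftrightarrow> 0 < b" using as(1) by (simp_all add: T zabc)
      have cc: "\<bar>c\<bar> \<noteq> int i" "\<bar>c\<bar> \<noteq> int i + 1" using sw(2,3) ab(1,2) inI by linarith+
      have bc: "b < c" using as(2) by (simp add: T zabc)
      have v1: "?z1 (int i) = a" "?z1 (int i + 1) = c" "?z1 (int i + 2) = b"
        unfolding vj zabc by (rule big_j[OF ab(1)] fix_j[OF cc(2) nf(3)] big_j[OF ab(2)])+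
      have v2: "?z2 (int i) = c" "?z2 (int i + 1) = a" "?z2 (int i + 2) = b"
        unfolding vi v1 by (rule big_i[OF ab(1)] fix_i[OF cc] big_i[OF ab(2)])+
      have "a < c" using bc adji[OF as(1)] by simp
      moreover have "\<bar>a\<bar> \<noteq> int i + 1" using ab(1) inI by simp
      moreover have "\<not> (int n < \<bar>c\<bar> \<and> (0 < a \<longleftrightarrow> 0 < c))" using as(4) ab by (simp add: T zabc)
      ultimately have 1: "?z1 \<in> GBC n" "asc i ?z1" "\<not> eqd i ?z1" "\<not> eqa n i ?z1"
        using mv_GBC[OF z ij(2) as(4)] by (simp_all add: T v1)
      have 2: "eqa n j ?z2" "?z2 \<in> GBC n" using mv_GBC[OF 1(1) ij(1) 1(4)] ab by (simp_all add: T v2)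
      show ?thesis using z ij as 1 2 by (simp add: X)
    next
      case sa
      let ?z1 = "mv i z" and ?z2 = "mv j (mv i z)"
      have bc: "int n < \<bar>b\<bar>" "int n < \<bar>c\<bar>" "0 < b \<longleftrightarrow> 0 < c" using sa(4) by (simp_all add: T zabc)
      have cc: "\<bar>a\<bar> \<noteq> int i + 2" "\<bar>a\<bar> \<noteq> int i + 1" using sw(1,2) bc(1,2) inI by linarith+
      have ab: "a < b" using sa(1) by (simp add: T zabc)
      have v1: "?z1 (int i) = b" "?z1 (int i + 1) = a" "?z1 (int i + 2) = c"
        unfolding vi zabc by (rule big_i[OF bc(1)] fix_i[OF nf(1) cc(2)] big_i[OF bc(2)])+
      have v2: "?z2 (int i) = b" "?z2 (int i + 1) = c" "?z2 (int i + 2) = a"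
        unfolding vj v1 by (rule big_j[OF bc(1)] fix_j[OF cc(2) cc(1)] big_j[OF bc(2)])+
      have "a < c" using ab adjj[OF sa(4)] by simp
      moreover have "\<not> (int n < \<bar>a\<bar> \<and> (0 < a \<longleftrightarrow> 0 < c))" using sa(3) bc by (simp add: T zabc)
      ultimately have 1: "?z1 \<in> GBC n" "asc j ?z1" "\<not> eqd j ?z1" "\<not> eqa n j ?z1"
        using mv_GBC[OF z ij(1) sa(3)] cc bc(2) by (simp_all add: T v1)
      have 2: "eqa n i ?z2" "?z2 \<in> GBC n" using mv_GBC[OF 1(1) ij(2) 1(4)] bc by (simp_all add: T v2)
      show ?thesis using z ij sa 1 2 by (simp add: X)
    next
      case ss
      have ord: "a < b" "b < c" using ss by (auto simp: T zabc)
      have g1: "\<bar>a\<bar> \<noteq> int i + 1" "\<bar>b\<bar> \<noteq> int i" "\<bar>b\<bar> \<noteq> int i + 2" "\<bar>c\<bar> \<noteq> int i + 1" using ss sw by (auto simp: T zabc)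
      \<comment> \<open>Otherwise z exchanges i and i + 2 up to a common sign: the positive sign
        contradicts a < c, and the negative one leaves only b = -(i + 1), which is excluded.\<close>
      have g2: "\<bar>a\<bar> \<noteq> int i + 2"
      proof
        assume h: "\<bar>a\<bar> = int i + 2"
        then have "\<bar>c\<bar> = int i" using sw by simp
        then show False using h ord sw' nf i by linarith
      qed
      then have g3: "\<bar>c\<bar> \<noteq> int i" using sw by simp
      note g = g1 g2 g3 nf
      have fi: "sgen i a = a" "sgen i b = b" "sgen i c = c" "sgen j a = a" "sgen j b = b" "sgen j c = c"
        using g by (auto intro: fix_i fix_j)
      have ea: "\<not> (int n < \<bar>a\<bar> \<and> int n < \<bar>b\<bar> \<and> (0 < a \<longleftrightarrow> 0 < b))" "\<not> (int n < \<bar>b\<bar> \<and> int n < \<bar>c\<bar> \<and> (0 < b \<longleftrightarrow> 0 < c))"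
        using ss by (auto simp: T zabc)
      then have eac: "\<not> (int n < \<bar>a\<bar> \<and> int n < \<bar>c\<bar> \<and> (0 < a \<longleftrightarrow> 0 < c))" using ord by linarith
      have G1: "mv i z \<in> GBC n" by (rule mv_GBC[OF z ij(1) ss(3)])
      have v1: "mv i z (int i) = b" "mv i z (int i + 1) = a" "mv i z (int i + 2) = c" unfolding vi zabc by (rule fi)+
      have t1: "asc j (mv i z)" "\<not> eqd j (mv i z)" "\<not> eqa n j (mv i z)" unfolding T v1 using g ord eac by auto
      have G2: "mv j (mv i z) \<in> GBC n" by (rule mv_GBC[OF G1 ij(2) t1(3)])
      have v2: "mv j (mv i z) (int i) = b" "mv j (mv i z) (int i + 1) = c" "mv j (mv i z) (int i + 2) = a" unfolding vj v1 by (rule fi)+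
      have t2: "asc i (mv j (mv i z))" "\<not> eqd i (mv j (mv i z))" "\<not> eqa n i (mv j (mv i z))" unfolding T v2 using g ord ea by auto
      have H1: "mv j z \<in> GBC n" by (rule mv_GBC[OF z ij(2) ss(6)])
      have w1: "mv j z (int i) = a" "mv j z (int i + 1) = c" "mv j z (int i + 2) = b" unfolding vj zabc by (rule fi)+
      have u1: "asc i (mv j z)" "\<not> eqd i (mv j z)" "\<not> eqa n i (mv j z)" unfolding T w1 using g ord eac by auto
      have H2: "mv i (mv j z) \<in> GBC n" by (rule mv_GBC[OF H1 ij(1) u1(3)])
      have w2: "mv i (mv j z) (int i) = c" "mv i (mv j z) (int i + 1) = a" "mv i (mv j z) (int i + 2) = b" unfolding vi w1 by (rule fi)+
      have u2: "asc j (mv i (mv j z))" "\<not> eqd j (mv i (mv j z))" "\<not> eqa n j (mv i (mv j z))" unfolding T w2 using g ord ea by auto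
      have "mv i (mv j (mv i z)) = mv j (mv i (mv j z))" unfolding j_def by (rule mv_braid3[OF i(1)])
      then show ?thesis using z ss G1 t1 G2 t2 H1 u1 H2 u2 by (simp add: xop_asc)
    qed
  qed
  then show ?thesis by (simp add: j_def)
qed

lemma xop_braid3:
  assumes i: "0 < i" "i + 1 < n"
  shows "xop k n i (xop k n (i + 1) (xop k n i A)) = xop k n (i + 1) (xop k n i (xop k n (i + 1) A))"
proof
  fix z
  have i': "i < n" using i by simp
  show "xop k n i (xop k n (i + 1) (xop k n i A)) z = xop k n (i + 1) (xop k n i (xop k n (i + 1) A)) z"
  proof (cases "z \<in> GBC n")
    case False
    then show ?thesis by (simp add: xop_out)
  next
    case True
    then have "\<forall>A. xop k n i (xop k n (i + 1) (xop k n i A)) z = xop k n (i + 1) (xop k n i (xop k n (i + 1) A)) z"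
    proof (induction z rule: GBC_induct_len)
      case (step z)
      note z = step(1)
      show ?case
      proof
        fix A
        consider "\<not> asc i z" "\<not> eqd i z" "\<not> eqa n i z" | "\<not> asc (i + 1) z" "\<not> eqd (i + 1) z" "\<not> eqa n (i + 1) z"
          | "asc i z \<or> eqd i z \<or> eqa n i z" "asc (i + 1) z \<or> eqd (i + 1) z \<or> eqa n (i + 1) z" by blast
        then show "xop k n i (xop k n (i + 1) (xop k n i A)) z = xop k n (i + 1) (xop k n i (xop k n (i + 1) A)) z"
        proof cases
          case 1
          note d = mv_desc[OF z i' 1]
          show ?thesis
            by (rule braid_step[OF i' i(2) linop_comp[OF linop_xop linop_xop] d(6)]) (use step(2)[OF d(1)] d(2) in simp)
        next
          case 2
          note d = mv_desc[OF z i(2) 2]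
          show ?thesis
            by (rule sym, rule braid_step[OF i(2) i' linop_comp[OF linop_xop linop_xop] d(6)]) (use step(2)[OF d(1)] d(2) in simp)
        next
          case 3
          then show ?thesis by (rule braid3_base[OF z i])
        qed
      qed
    qed
    then show ?thesis by blast
  qed
qed

text \<open>s_0 is never weak. If s_1 is a weak descent at z, then z(1) = 2 and s_1 acts by the same
  scalar at z and at s_0 z s_0. If it is a weak ascent, strict moves give a chain of four elements
  with s_1 weak at both ends. Otherwise they form an octagon.\<close>

lemma braid4_base:
  notes [simp del] = One_nat_def
  assumes z: "z \<in> GBC n" and n: "2 \<le> n"
    and t0: "asc 0 z" and t1: "asc 1 z \<or> eqd 1 z \<or> eqa n 1 z"
  shows "xop k n 0 (xop k n 1 (xop k n 0 (xop k n 1 A))) z = xop k n 1 (xop k n 0 (xop k n 1 (xop k n 0 A))) z"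
proof -
  define a b where "a = z 1" and "b = z 2"
  have a0: "0 < a" using t0 by (simp add: asc_0 a_def)
  have nf: "a \<noteq> 1" "\<bar>b\<bar> \<noteq> 2" using GBC_nofix[OF z, of 1] GBC_nofix[OF z, of 2] n by (auto simp: a_def b_def)
  have n0: "\<not> eqd 0 y" "\<not> eqa n 0 y" for y by (auto simp: eqd_def eqa_def)
  have v0: "mv 0 y 1 = sgen 0 (- y 1)" "mv 0 y 2 = sgen 0 (y 2)" if "y \<in> GBC n" for y
    using GBC_uminus[OF that, of 1] by (simp_all add: mv_apply sgen_0)
  have v1: "mv 1 y 1 = sgen 1 (y 2)" "mv 1 y 2 = sgen 1 (y 1)" for y by (simp_all add: mv_apply sgen_Suc)
  have f0: "sgen 0 t = t" if "\<bar>t\<bar> \<noteq> 1" for t using that by (auto simp: sgen_0)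
  have f1: "sgen 1 t = t" if "\<bar>t\<bar> \<noteq> 1" "\<bar>t\<bar> \<noteq> 2" for t using sgen_fixed[of t 1] that by simp
  have T: "asc 1 y \<longleftrightarrow> y 1 < y 2" "eqd 1 y \<longleftrightarrow> \<bar>y 1\<bar> = 2"
    "eqa n 1 y \<longleftrightarrow> int n < \<bar>y 1\<bar> \<and> int n < \<bar>y 2\<bar> \<and> (0 < y 1 \<longleftrightarrow> 0 < y 2)" "asc 0 y \<longleftrightarrow> 0 < y 1" for y
    by (simp_all add: asc_Suc asc_0 eqd_def eqa_def)
  have n01: "0 < n" "1 < n" using n by auto
  note zab = a_def[symmetric] b_def[symmetric]
  have G0: "mv 0 y \<in> GBC n" if "y \<in> GBC n" for y using mv_GBC[OF that n01(1) n0(2)] .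
  note G1 = mv_GBC[OF _ n01(2)]
  consider (d) "eqd 1 z" | (e) "eqa n 1 z" | (s) "asc 1 z" "\<not> eqd 1 z" "\<not> eqa n 1 z" using t1 by blast
  then show ?thesis
  proof cases
    case d
    then have ab: "a = 2" using a0 by (simp add: T zab)
    have y: "mv 0 z \<in> GBC n" by (rule G0[OF z])
    have "mv 0 z 1 = -2" using v0[OF z] ab by (simp add: zab f0)
    then have e: "eqd 1 (mv 0 z)" "\<not> asc 0 (mv 0 z)" by (auto simp: T)
    have x0: "xop k n 0 B z = B (mv 0 z)" "xop k n 0 B (mv 0 z) = B z + vd * B (mv 0 z)" for B
      using z y e t0 n0 by (simp_all add: xop_asc xop_desc)
    have x1: "xop k n 1 B z = ed k * B z" "xop k n 1 B (mv 0 z) = ed k * B (mv 0 z)" for B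
      using d e by (simp_all add: xop_eqd)
    show ?thesis by (simp only: x0 x1) (simp add: algebra_simps)
  next
    case e
    then have ab: "int n < a" "int n < b" using a0 by (auto simp: T zab)
    have y1: "mv 0 z \<in> GBC n" by (rule G0[OF z])
    have w1: "mv 0 z 1 = - a" "mv 0 z 2 = b" using v0[OF z] ab n by (simp_all add: zab f0)
    have t1: "asc 1 (mv 0 z)" "\<not> eqd 1 (mv 0 z)" "\<not> eqa n 1 (mv 0 z)" using ab n by (auto simp: T w1)
    have y2: "mv 1 (mv 0 z) \<in> GBC n" by (rule G1[OF y1 t1(3)])
    have w2: "mv 1 (mv 0 z) 1 = b" "mv 1 (mv 0 z) 2 = - a" using v1[of "mv 0 z"] ab n by (simp_all add: w1 f1)
    have t2: "asc 0 (mv 1 (mv 0 z))" using ab by (simp add: T w2)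
    have y3: "mv 0 (mv 1 (mv 0 z)) \<in> GBC n" by (rule G0[OF y2])
    have w3: "mv 0 (mv 1 (mv 0 z)) 1 = - b" "mv 0 (mv 1 (mv 0 z)) 2 = - a" using v0[OF y2] ab n by (simp_all add: w2 f0)
    have t3: "eqa n 1 (mv 0 (mv 1 (mv 0 z)))" using ab by (simp add: T w3)
    show ?thesis using z e t0 y1 t1 y2 t2 y3 t3 n0 n01 by (simp add: xop_asc xop_eqa)
  next
    case s
    then have ab: "a < b" "\<bar>a\<bar> \<noteq> 1" "\<bar>a\<bar> \<noteq> 2" "\<bar>b\<bar> \<noteq> 1" "\<bar>b\<bar> \<noteq> 2" "0 < b" using nf a0 by (auto simp: T zab)
    have ne: "\<not> (int n < a \<and> int n < b)" using s(3) a0 ab by (auto simp: T zab)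
    have fx: "sgen 0 a = a" "sgen 0 b = b" "sgen 1 a = a" "sgen 1 b = b" using ab by (auto intro: f0 f1)
    have y1: "mv 0 z \<in> GBC n" by (rule G0[OF z])
    have w1: "mv 0 z 1 = - a" "mv 0 z 2 = b" using v0[OF z] by (simp_all add: zab fx)
    have t1: "asc 1 (mv 0 z)" "\<not> eqd 1 (mv 0 z)" "\<not> eqa n 1 (mv 0 z)" using ab a0 by (auto simp: T w1)
    have y2: "mv 1 (mv 0 z) \<in> GBC n" by (rule G1[OF y1 t1(3)])
    have w2: "mv 1 (mv 0 z) 1 = b" "mv 1 (mv 0 z) 2 = - a" using v1[of "mv 0 z"] by (simp_all add: w1 fx)
    have t2: "asc 0 (mv 1 (mv 0 z))" using ab by (simp add: T w2)
    have y3: "mv 0 (mv 1 (mv 0 z)) \<in> GBC n" by (rule G0[OF y2])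
    have w3: "mv 0 (mv 1 (mv 0 z)) 1 = - b" "mv 0 (mv 1 (mv 0 z)) 2 = - a" using v0[OF y2] by (simp_all add: w2 fx)
    have t3: "asc 1 (mv 0 (mv 1 (mv 0 z)))" "\<not> eqd 1 (mv 0 (mv 1 (mv 0 z)))" "\<not> eqa n 1 (mv 0 (mv 1 (mv 0 z)))"
      using ab a0 ne by (auto simp: T w3)
    have x1: "mv 1 z \<in> GBC n" by (rule G1[OF z s(3)])
    have u1: "mv 1 z 1 = b" "mv 1 z 2 = a" using v1[of z] by (simp_all add: zab fx)
    have r1: "asc 0 (mv 1 z)" using ab by (simp add: T u1)
    have x2: "mv 0 (mv 1 z) \<in> GBC n" by (rule G0[OF x1])
    have u2: "mv 0 (mv 1 z) 1 = - b" "mv 0 (mv 1 z) 2 = a" using v0[OF x1] by (simp_all add: u1 fx)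
    have r2: "asc 1 (mv 0 (mv 1 z))" "\<not> eqd 1 (mv 0 (mv 1 z))" "\<not> eqa n 1 (mv 0 (mv 1 z))" using ab a0 by (auto simp: T u2)
    have x3: "mv 1 (mv 0 (mv 1 z)) \<in> GBC n" by (rule G1[OF x2 r2(3)])
    have u3: "mv 1 (mv 0 (mv 1 z)) 1 = a" using v1[of "mv 0 (mv 1 z)"] by (simp_all add: u2 fx)
    have r3: "asc 0 (mv 1 (mv 0 (mv 1 z)))" using a0 by (simp add: T u3)
    show ?thesis using z s t0 y1 t1 y2 t2 y3 t3 x1 r1 x2 r2 x3 r3 n0 mv_braid4[of z] by (simp add: xop_asc)
  qed
qed

lemma xop_braid4:
  notes [simp del] = One_nat_def
  assumes n: "2 \<le> n"
  shows "xop k n 0 (xop k n 1 (xop k n 0 (xop k n 1 A))) = xop k n 1 (xop k n 0 (xop k n 1 (xop k n 0 A)))"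
proof
  fix z
  have n01: "0 < n" "1 < n" using n by auto
  show "xop k n 0 (xop k n 1 (xop k n 0 (xop k n 1 A))) z = xop k n 1 (xop k n 0 (xop k n 1 (xop k n 0 A))) z"
  proof (cases "z \<in> GBC n")
    case False
    then show ?thesis by (simp add: xop_out)
  next
    case True
    then have "\<forall>A. xop k n 0 (xop k n 1 (xop k n 0 (xop k n 1 A))) z = xop k n 1 (xop k n 0 (xop k n 1 (xop k n 0 A))) z"
    proof (induction z rule: GBC_induct_len)
      case (step z)
      note z = step(1)
      note lin = linop_comp[OF linop_xop linop_comp[OF linop_xop linop_xop]]
      show ?case
      proof
        fix A
        consider "\<not> asc 0 z" | "\<not> asc 1 z" "\<not> eqd 1 z" "\<not> eqa n 1 z"
          | "asc 0 z" "asc 1 z \<or> eqd 1 z \<or> eqa n 1 z" by blast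
        then show "xop k n 0 (xop k n 1 (xop k n 0 (xop k n 1 A))) z = xop k n 1 (xop k n 0 (xop k n 1 (xop k n 0 A))) z"
        proof cases
          case 1
          have n0: "\<not> eqd 0 z" "\<not> eqa n 0 z" by (auto simp: eqd_def eqa_def)
          note d = mv_desc[OF z n01(1) 1 n0]
          show ?thesis
            by (rule braid_step[OF n01(1) n01(1) lin d(6)]) (use step(2)[OF d(1)] d(2) in simp)
        next
          case 2
          note d = mv_desc[OF z n01(2) 2]
          show ?thesis
            by (rule sym, rule braid_step[OF n01(2) n01(2) lin d(6)]) (use step(2)[OF d(1)] d(2) in simp)
        next
          case 3
          then show ?thesis by (rule braid4_base[OF z n])
        qed
      qed
    qed
    then show ?thesis by blast
  qed
qed

section \<open>The braid relations for the inverse operators\<close>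

lemma xinv_commute:
  assumes ij: "i + 2 \<le> j" "j < n"
  shows "xinv k n i (xinv k n j A) = xinv k n j (xinv k n i A)"
proof -
  have i: "i < n" using ij by simp
  let ?B = "xinv k n j (xinv k n i A)"
  have "xinv k n i (xinv k n j A) = xinv k n i (xinv k n j (xop k n i (xop k n j ?B)))"
    using i ij by (simp add: xop_xinv)
  also have "\<dots> = ?B" unfolding xop_commute[OF ij] using i ij by (simp add: xinv_xop)
  finally show ?thesis .
qed

lemma xinv_braid3:
  assumes i: "0 < i" "i + 1 < n"
  shows "xinv k n i (xinv k n (i + 1) (xinv k n i A)) = xinv k n (i + 1) (xinv k n i (xinv k n (i + 1) A))"
proof -
  have i': "i < n" using i by simp
  let ?B = "xinv k n (i + 1) (xinv k n i (xinv k n (i + 1) A))"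
  have "xop k n (i + 1) (xop k n i (xop k n (i + 1) ?B)) = A" using i i' by (simp only: xop_xinv)
  then have "xop k n i (xop k n (i + 1) (xop k n i ?B)) = A" using xop_braid3[OF i] by metis
  then have "xinv k n i (xinv k n (i + 1) (xinv k n i A)) = xinv k n i (xinv k n (i + 1) (xinv k n i (xop k n i (xop k n (i + 1) (xop k n i ?B)))))"
    by simp
  also have "\<dots> = ?B" using i i' by (simp only: xinv_xop)
  finally show ?thesis .
qed

lemma xinv_braid4:
  notes [simp del] = One_nat_def
  assumes n: "2 \<le> n"
  shows "xinv k n 0 (xinv k n 1 (xinv k n 0 (xinv k n 1 A))) = xinv k n 1 (xinv k n 0 (xinv k n 1 (xinv k n 0 A)))"
proof -
  have n01: "0 < n" "1 < n" using n by auto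
  let ?B = "xinv k n 1 (xinv k n 0 (xinv k n 1 (xinv k n 0 A)))"
  have "xop k n 0 (xop k n 1 (xop k n 0 (xop k n 1 ?B))) = A" using n01 by (simp only: xop_xinv)
  then have "xop k n 1 (xop k n 0 (xop k n 1 (xop k n 0 ?B))) = A" using xop_braid4[OF n] by metis
  then have "xinv k n 0 (xinv k n 1 (xinv k n 0 (xinv k n 1 A))) = xinv k n 0 (xinv k n 1 (xinv k n 0 (xinv k n 1
      (xop k n 1 (xop k n 0 (xop k n 1 (xop k n 0 ?B)))))))"
    by simp
  also have "\<dots> = ?B" using n01 by (simp only: xinv_xop)
  finally show ?thesis .
qed

subsection \<open>Operators attached to signed permutations\<close>

text \<open>\<open>\<phi>\<close> is the product of the operators \<open>T i\<close> along some
  reduced word of w, the condition \<open>asc\<close> making the word reduced. It is a relation at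
  this stage; that it is a function of w is Matsumoto's theorem, \<open>rep_unique\<close>.\<close>

inductive rep :: "nat \<Rightarrow> (nat \<Rightarrow> 'v \<Rightarrow> 'v) \<Rightarrow> sperm \<Rightarrow> ('v \<Rightarrow> 'v) \<Rightarrow> bool" for n T where
  rep_id: "rep n T id id"
| rep_step: "rep n T w \<phi> \<Longrightarrow> i < n \<Longrightarrow> asc i w \<Longrightarrow> rep n T (w \<circ> sgen i) (\<phi> \<circ> T i)"

lemma rep_WBC: "rep n T w \<phi> \<Longrightarrow> w \<in> WBC n"
  by (induction rule: rep.induct) (rule WBC_id, blast intro: WBC_comp WBC_sgen)

lemma rep_step': "rep n T (w \<circ> sgen i) \<phi> \<Longrightarrow> i < n \<Longrightarrow> asc i (w \<circ> sgen i) \<Longrightarrow> rep n T w (\<phi> \<circ> T i)"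
  using rep_step[of n T "w \<circ> sgen i" \<phi> i] by simp

lemma rep_exists: "w \<in> WBC n \<Longrightarrow> \<exists>\<phi>. rep n T w \<phi>"
proof (induction "dlen n w" arbitrary: w rule: less_induct)
  case less
  show ?case
  proof (cases "\<forall>i<n. asc i w")
    case True
    then have "w = id" using all_asc_imp_id[OF less.prems] by blast
    then show ?thesis using rep_id by blast
  next
    case False
    then obtain i where i: "i < n" "\<not> asc i w" by blast
    have "dlen n (w \<circ> sgen i) < dlen n w" using dlen_o_sgen_desc[OF less.prems i] by simp
    from less.hyps[OF this] obtain \<phi> where "rep n T (w \<circ> sgen i) \<phi>"
      using less.prems i WBC_comp WBC_sgen by blast
    then show ?thesis using rep_step' asc_o_sgen[OF less.prems, of i] i by blast
  qed
qed

definition braided :: "nat \<Rightarrow> (nat \<Rightarrow> 'v \<Rightarrow> 'v) \<Rightarrow> bool" where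
  "braided n T \<longleftrightarrow> (\<forall>i j. i + 2 \<le> j \<and> j < n \<longrightarrow> T i \<circ> T j = T j \<circ> T i)
     \<and> (\<forall>i. 0 < i \<and> i + 1 < n \<longrightarrow> T i \<circ> T (i + 1) \<circ> T i = T (i + 1) \<circ> T i \<circ> T (i + 1))
     \<and> (2 \<le> n \<longrightarrow> T 0 \<circ> T 1 \<circ> T 0 \<circ> T 1 = T 1 \<circ> T 0 \<circ> T 1 \<circ> T 0)"

text \<open>If s_i and s_j are right descents of w, the longest element of the subgroup generated by
  them splits off from w on the right, with lengths adding up. Its two reduced words extend one
  operator in two ways, which agree by the braid relation.\<close>

lemma braid_join:
  assumes T: "braided n T" and w: "w \<in> WBC n" and ij: "i < j" "j < n" "\<not> asc i w" "\<not> asc j w"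
  shows "\<exists>\<alpha> \<beta>. rep n T (w \<circ> sgen i) \<alpha> \<and> rep n T (w \<circ> sgen j) \<beta> \<and> \<alpha> \<circ> T i = \<beta> \<circ> T j"
proof -
  have i: "i < n" using ij by simp
  have W: "w \<circ> f \<in> WBC n" if "f \<in> WBC n" for f using w that by (rule WBC_comp)
  have Ws: "sgen i \<in> WBC n" "sgen j \<in> WBC n" using i ij by (auto intro: WBC_sgen)
  have dj: "w (int j + 1) < w (int j)" using not_asc_Suc[OF w, of j] ij by simp
  consider "i + 2 \<le> j" | "0 < i" "j = i + 1" | "i = 0" "j = 1" using ij by linarith
  then show ?thesis
  proof cases
    case 1
    let ?w = "w \<circ> (sgen i \<circ> sgen j)"
    obtain \<phi> where \<phi>: "rep n T ?w \<phi>" using rep_exists[OF W[OF WBC_comp[OF Ws]]] by blast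
    have s: "sgen i (int j) = int j" "sgen i (int j + 1) = int j + 1" "sgen j (int i) = int i" "sgen j (int i + 1) = int i + 1"
      "sgen j 1 = 1 \<or> i \<noteq> 0"
      using 1 by (auto intro: sgen_fixed)
    have aj: "asc j ?w" using dj s ij by (simp add: asc_Suc sgen_Suc)
    have ai: "asc i ?w"
    proof (cases "i = 0")
      case True
      then show ?thesis using not_asc_0[OF w] ij s WBC_uminus[OF w, of 1] by (simp add: asc_0 sgen_0)
    next
      case False
      then show ?thesis using not_asc_Suc[OF w, of i] ij s sgen_commute[OF 1] by (simp add: asc_Suc sgen_Suc)
    qed
    have "w \<circ> sgen i = ?w \<circ> sgen j" "w \<circ> sgen j = ?w \<circ> sgen i"
      using sgen_commute[OF 1] by (auto simp: fun_eq_iff)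
    then have "rep n T (w \<circ> sgen i) (\<phi> \<circ> T j)" "rep n T (w \<circ> sgen j) (\<phi> \<circ> T i)"
      using rep_step[OF \<phi> ij(2) aj] rep_step[OF \<phi> i ai] by simp_all
    moreover have "T i \<circ> T j = T j \<circ> T i" using T 1 ij unfolding braided_def by blast
    ultimately show ?thesis by (metis comp_assoc)
  next
    case 2
    let ?w = "w \<circ> (sgen i \<circ> (sgen j \<circ> sgen i))"
    obtain \<phi> where \<phi>: "rep n T ?w \<phi>" using rep_exists[OF W[OF WBC_comp[OF Ws(1) WBC_comp[OF Ws(2,1)]]]] by blast
    have p: "sgen i (int i) = int i + 1" "sgen i (int i + 1) = int i" "sgen i (int i + 2) = int i + 2"
      "sgen j (int i) = int i" "sgen j (int i + 1) = int i + 2" "sgen j (int i + 2) = int i + 1" "int j = int i + 1"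
      using 2 by (auto simp: sgen_Suc)
    have j0: "0 < j" using 2 by simp
    have br: "sgen i (sgen j (sgen i a)) = sgen j (sgen i (sgen j a))" for a
      using sgen_braid3[OF 2(1)] 2(2) by simp
    have ord: "w (int i + 1) < w (int i)" "w (int i + 2) < w (int i + 1)"
      using not_asc_Suc[OF w, of i] ij 2 dj p by (simp_all add: add.assoc)
    have a: "asc i ?w" "asc j (?w \<circ> sgen i)" "asc j ?w" "asc i (?w \<circ> sgen j)"
      using 2(1) j0 p ord by (simp_all add: asc_Suc add.assoc)
    have 3: "rep n T (?w \<circ> sgen i \<circ> sgen j) (\<phi> \<circ> T i \<circ> T j)" "rep n T (?w \<circ> sgen j \<circ> sgen i) (\<phi> \<circ> T j \<circ> T i)"
      using a \<phi> i ij by (auto intro!: rep_step)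
    have "?w \<circ> sgen i \<circ> sgen j = w \<circ> sgen i" "?w \<circ> sgen j \<circ> sgen i = w \<circ> sgen j"
      using br by (auto simp: fun_eq_iff)
    then have "rep n T (w \<circ> sgen i) (\<phi> \<circ> T i \<circ> T j)" "rep n T (w \<circ> sgen j) (\<phi> \<circ> T j \<circ> T i)"
      using 3 by simp_all
    moreover have "T i \<circ> T j \<circ> T i = T j \<circ> T i \<circ> T j" using T 2 ij unfolding braided_def by blast
    ultimately show ?thesis by (metis comp_assoc)
  next
    case 3
    let ?w = "w \<circ> (sgen 0 \<circ> (sgen 1 \<circ> (sgen 0 \<circ> sgen 1)))"
    have Ws': "sgen 0 \<in> WBC n" "sgen 1 \<in> WBC n" using Ws 3 by auto
    obtain \<phi> where \<phi>: "rep n T ?w \<phi>"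
      using rep_exists[OF W[OF WBC_comp[OF Ws'(1) WBC_comp[OF Ws'(2) WBC_comp[OF Ws']]]]] by blast
    have p: "sgen 0 1 = -1" "sgen 0 2 = 2" "sgen 1 1 = 2" "sgen 1 2 = 1" by (auto simp: sgen_0 sgen_Suc)
    have br: "sgen 1 (sgen 0 (sgen 1 (sgen 0 a))) = sgen 0 (sgen 1 (sgen 0 (sgen 1 a)))" for a
      by (rule sgen_braid4)
    have ord: "w 1 < 0" "w 2 < w 1" using not_asc_0[OF w] dj ij 3 by simp_all
    have wm: "w (- 1) = - w 1" "w (- 2) = - w 2" by (rule WBC_uminus[OF w])+
    have a: "asc 1 ?w" "asc 0 (?w \<circ> sgen 1)" "asc 1 (?w \<circ> sgen 1 \<circ> sgen 0)"
      "asc 0 ?w" "asc 1 (?w \<circ> sgen 0)" "asc 0 (?w \<circ> sgen 0 \<circ> sgen 1)"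
      using p ord wm sgen_uminus[of 0 1] sgen_uminus[of 0 2] sgen_uminus[of 1 1] sgen_uminus[of 1 2]
      by (simp_all add: asc_def del: One_nat_def)
    have n01: "0 < n" "1 < n" using ij 3 by auto
    have 4: "rep n T (?w \<circ> sgen 1 \<circ> sgen 0 \<circ> sgen 1) (\<phi> \<circ> T 1 \<circ> T 0 \<circ> T 1)"
      "rep n T (?w \<circ> sgen 0 \<circ> sgen 1 \<circ> sgen 0) (\<phi> \<circ> T 0 \<circ> T 1 \<circ> T 0)"
      using a \<phi> n01 by (auto intro!: rep_step simp del: One_nat_def)
    have "?w \<circ> sgen 1 \<circ> sgen 0 \<circ> sgen 1 = w \<circ> sgen 0"
      by (simp add: fun_eq_iff del: One_nat_def)
    moreover have "?w \<circ> sgen 0 \<circ> sgen 1 \<circ> sgen 0 = w \<circ> sgen 1"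
      by (simp add: fun_eq_iff br[symmetric] del: One_nat_def)
    ultimately have "rep n T (w \<circ> sgen i) (\<phi> \<circ> T 1 \<circ> T 0 \<circ> T 1)" "rep n T (w \<circ> sgen j) (\<phi> \<circ> T 0 \<circ> T 1 \<circ> T 0)"
      using 4 3 by (simp_all del: One_nat_def)
    moreover have "T 0 \<circ> T 1 \<circ> T 0 \<circ> T 1 = T 1 \<circ> T 0 \<circ> T 1 \<circ> T 0" using T n01 by (simp add: braided_def)
    ultimately show ?thesis using 3 by (metis comp_assoc)
  qed
qed

text \<open>Two reduced words of w end in descents i and j. If these differ,
  \<open>braid_join\<close> provides operators for the words shortened by i and by j which agree
  after adding these letters; by induction they are the operators of the given words.\<close>

lemma rep_unique:
  assumes T: "braided n T"
  shows "rep n T w \<phi> \<Longrightarrow> rep n T w \<psi> \<Longrightarrow> \<phi> = \<psi>"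
proof (induction "dlen n w" arbitrary: w \<phi> \<psi> rule: less_induct)
  case less
  have w: "w \<in> WBC n" using less.prems rep_WBC by blast
  have inv: "(w = id \<and> \<phi> = id) \<or> (\<exists>i \<phi>'. i < n \<and> \<not> asc i w \<and> rep n T (w \<circ> sgen i) \<phi>' \<and> \<phi> = \<phi>' \<circ> T i)"
    if "rep n T w \<phi>" for \<phi>
    using that
  proof cases
    case rep_id
    then show ?thesis by simp
  next
    case (rep_step v \<phi>' i)
    have "\<not> asc i w" using asc_o_sgen[OF rep_WBC[OF rep_step(3)], of i] rep_step by simp
    then show ?thesis using rep_step by (intro disjI2 exI[of _ i] exI[of _ \<phi>']) simp
  qed
  have aid: "asc i id" for i by (simp add: asc_def)
  from inv[OF less.prems(1)] show ?case
  proof (elim disjE exE conjE)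
    assume "w = id" "\<phi> = id"
    then show ?thesis using inv[OF less.prems(2)] aid by auto
  next
    fix i \<phi>' assume i: "i < n" "\<not> asc i w" "rep n T (w \<circ> sgen i) \<phi>'" "\<phi> = \<phi>' \<circ> T i"
    from inv[OF less.prems(2)] show ?thesis
    proof (elim disjE exE conjE)
      assume "w = id"
      then show ?thesis using i aid by auto
    next
      fix j \<psi>' assume j: "j < n" "\<not> asc j w" "rep n T (w \<circ> sgen j) \<psi>'" "\<psi> = \<psi>' \<circ> T j"
      have IHi: "\<phi>' = \<alpha>" if "rep n T (w \<circ> sgen i) \<alpha>" for \<alpha>
        using less.hyps[OF _ i(3) that] dlen_o_sgen_desc[OF w i(1,2)] by simp
      have IHj: "\<psi>' = \<beta>" if "rep n T (w \<circ> sgen j) \<beta>" for \<beta>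
        using less.hyps[OF _ j(3) that] dlen_o_sgen_desc[OF w j(1,2)] by simp
      consider "i = j" | "i < j" | "j < i" by linarith
      then show ?thesis
      proof cases
        case 1
        then show ?thesis using IHi j i by auto
      next
        case 2
        from braid_join[OF T w 2 j(1) i(2) j(2)] show ?thesis using IHi IHj i j by blast
      next
        case 3
        from braid_join[OF T w 3 i(1) j(2) i(2)] show ?thesis using IHi IHj i j by metis
      qed
    qed
  qed
qed

section \<open>The operator of a group element\<close>

definition theta :: "nat \<Rightarrow> (nat \<Rightarrow> 'v \<Rightarrow> 'v) \<Rightarrow> sperm \<Rightarrow> ('v \<Rightarrow> 'v)" where
  "theta n T w = (THE \<phi>. rep n T w \<phi>)"

lemma theta_rep: assumes "braided n T" "w \<in> WBC n" shows "rep n T w (theta n T w)"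
proof -
  obtain \<phi> where "rep n T w \<phi>" using rep_exists[OF assms(2)] by blast
  then show ?thesis unfolding theta_def using theI[of "rep n T w" \<phi>] rep_unique[OF assms(1)] by blast
qed

lemma theta_eq: "braided n T \<Longrightarrow> rep n T w \<phi> \<Longrightarrow> theta n T w = \<phi>"
  using theta_rep rep_unique rep_WBC by blast

lemma theta_id: "braided n T \<Longrightarrow> theta n T id = id"
  by (rule theta_eq) (auto intro: rep_id)

lemma theta_right:
  "braided n T \<Longrightarrow> w \<in> WBC n \<Longrightarrow> i < n \<Longrightarrow> asc i w \<Longrightarrow> theta n T (w \<circ> sgen i) = theta n T w \<circ> T i"
  by (rule theta_eq) (auto intro: rep_step theta_rep)

text \<open>The construction appends letters on the right. If s_j is a right descent of w and
  \<open>v = w \<circ> sgen j\<close>, then s_i is a left ascent of v as well: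
  \<open>sgen i \<circ> w\<close> is two letters longer than v, and removing s_j changes its length
  by only one.\<close>

lemma theta_left:
  assumes T: "braided n T" and w: "w \<in> WBC n" and i: "i < n" "asc i (inv w)"
  shows "theta n T (sgen i \<circ> w) = T i \<circ> theta n T w"
  using w i(2)
proof (induction "dlen n w" arbitrary: w rule: less_induct)
  case less
  note w = less.prems(1)
  show ?case
  proof (cases "\<forall>j<n. asc j w")
    case True
    then have "w = id" using all_asc_imp_id[OF w] by blast
    moreover have "asc i id" by (simp add: asc_def)
    ultimately show ?thesis using theta_right[OF T WBC_id i(1)] theta_id[OF T] by simp
  next
    case False
    then obtain j where j: "j < n" "\<not> asc j w" by blast
    let ?v = "w \<circ> sgen j"
    have v: "?v \<in> WBC n" using w j by (auto intro: WBC_comp WBC_sgen)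
    have av: "asc j ?v" using asc_o_sgen[OF w] j by simp
    have wv: "w = ?v \<circ> sgen j" by simp
    have d: "dlen n w = dlen n ?v + 2" by (rule dlen_o_sgen_desc[OF w j])
    have sv: "sgen i \<circ> ?v \<in> WBC n" using v i by (auto intro: WBC_comp WBC_sgen)
    have dsw: "dlen n (sgen i \<circ> w) = dlen n w + 2" using dlen_sgen_o[OF w i(1)] less.prems(2) by simp
    have e: "sgen i \<circ> w \<circ> sgen j = sgen i \<circ> ?v" "sgen i \<circ> ?v \<circ> sgen j = sgen i \<circ> w" by (simp_all add: comp_assoc)
    have step: "dlen n (sgen i \<circ> w) = dlen n (sgen i \<circ> ?v) + 2 \<or> dlen n (sgen i \<circ> ?v) = dlen n (sgen i \<circ> w) + 2"
      using dlen_o_sgen[OF sv j(1)] dlen_o_sgen_desc[OF sv j(1)] unfolding e by blast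
    have iv: "asc i (inv ?v)"
    proof (rule ccontr)
      assume "\<not> asc i (inv ?v)"
      then have "dlen n ?v = dlen n (sgen i \<circ> ?v) + 2" using dlen_sgen_o[OF v i(1)] by simp
      then show False using step d dsw by linarith
    qed
    then have dv: "dlen n (sgen i \<circ> ?v) = dlen n ?v + 2" using dlen_sgen_o[OF v i(1)] by simp
    have asv: "asc j (sgen i \<circ> ?v)"
    proof (rule ccontr)
      assume "\<not> asc j (sgen i \<circ> ?v)"
      then have "dlen n (sgen i \<circ> ?v) = dlen n (sgen i \<circ> w) + 2" using dlen_o_sgen_desc[OF sv j(1)] unfolding e by blast
      then show False using d dsw dv by linarith
    qed
    have "theta n T (sgen i \<circ> w) = theta n T (sgen i \<circ> ?v) \<circ> T j"
      using theta_right[OF T sv j(1) asv] unfolding e .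
    also have "\<dots> = T i \<circ> theta n T ?v \<circ> T j" using less.hyps[OF _ v iv] d by simp
    also have "\<dots> = T i \<circ> theta n T w" using theta_right[OF T v j(1) av] by (simp add: comp_assoc)
    finally show ?thesis .
  qed
qed

text \<open>If s_p is a right ascent of w, both sides are the operator of s_i w = w s_p. Otherwise
  \<open>w \<circ> sgen p\<close> satisfies the same relation, and multiplying the resulting
  identity by \<open>T p\<close> on the right gives the claim.\<close>

lemma theta_commute:
  assumes T: "braided n T" and w: "w \<in> WBC n" and i: "i < n" and p: "p < n" and c: "sgen i \<circ> w = w \<circ> sgen p"
  shows "T i \<circ> theta n T w = theta n T w \<circ> T p"
proof -
  have up: "T i \<circ> theta n T w = theta n T w \<circ> T p" if w: "w \<in> WBC n" and c: "sgen i \<circ> w = w \<circ> sgen p" and a: "asc p w" for w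
  proof -
    have "dlen n (w \<circ> sgen p) = dlen n w + 2" by (rule dlen_o_sgen[OF w p a])
    then have "asc i (inv w)" using dlen_sgen_o[OF w i] c by (auto split: if_splits)
    from theta_left[OF T w i this] theta_right[OF T w p a] c show ?thesis by simp
  qed
  show ?thesis
  proof (cases "asc p w")
    case True then show ?thesis using up[OF w c] by simp
  next
    case False
    let ?v = "w \<circ> sgen p"
    have v: "?v \<in> WBC n" using w p by (auto intro: WBC_comp WBC_sgen)
    have av: "asc p ?v" using asc_o_sgen[OF w] False by simp
    have wv: "theta n T w = theta n T ?v \<circ> T p" using theta_right[OF T v p av] by simp
    have "sgen i \<circ> ?v = ?v \<circ> sgen p" unfolding c[symmetric] by (simp add: comp_assoc[symmetric] c)
    from up[OF v this av] have "T i \<circ> theta n T ?v = theta n T w" using wv by simp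
    then have "T i \<circ> (theta n T ?v \<circ> T p) = theta n T w \<circ> T p" by (simp add: comp_assoc[symmetric])
    then show ?thesis using wv by simp
  qed
qed

lemma braided_xinv: "braided n (xinv k n)"
  unfolding braided_def
proof (intro conjI allI impI)
  fix i j assume ij: "i + 2 \<le> j \<and> j < n"
  show "xinv k n i \<circ> xinv k n j = xinv k n j \<circ> xinv k n i"
    by (rule ext, unfold comp_apply, rule xinv_commute) (use ij in auto)
next
  fix i assume i: "0 < i \<and> i + 1 < n"
  show "xinv k n i \<circ> xinv k n (i + 1) \<circ> xinv k n i = xinv k n (i + 1) \<circ> xinv k n i \<circ> xinv k n (i + 1)"
    by (rule ext, unfold comp_apply, rule xinv_braid3) (use i in auto)
next
  assume n: "2 \<le> n"
  show "xinv k n 0 \<circ> xinv k n 1 \<circ> xinv k n 0 \<circ> xinv k n 1 = xinv k n 1 \<circ> xinv k n 0 \<circ> xinv k n 1 \<circ> xinv k n 0"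
    by (rule ext, unfold comp_apply, rule xinv_braid4[OF n])
qed

lemma linop_theta: assumes "w \<in> WBC n" shows "linop (theta n (xinv k n) w)"
proof -
  have "linop \<phi>" if "rep n (xinv k n) w \<phi>" for w \<phi>
    using that
  proof (induction rule: rep.induct)
    case rep_id
    have "linop (\<lambda>A. A)" by (simp add: linop_def)
    then show ?case by (simp add: id_def)
  next
    case (rep_step w \<phi> i)
    then show ?case using linop_comp[OF rep_step(4) linop_xinv] by (simp add: comp_def)
  qed
  then show ?thesis using theta_rep[OF braided_xinv assms] by blast
qed

section \<open>The bar operator\<close>

subsection \<open>Reduction to elements with standard tail\<close>

definition stdu :: "nat \<Rightarrow> nat \<Rightarrow> sperm \<Rightarrow> bool" where
  "stdu n m u \<longleftrightarrow> u \<in> WBC n \<and> (\<forall>i j. 1 \<le> i \<and> i < j \<and> j \<le> int n - int m \<longrightarrow> u i < u j)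
     \<and> (\<forall>i. 1 \<le> i \<and> i \<le> int n - int m \<longrightarrow> 0 < u i)
     \<and> (\<forall>i j. int n - int m < i \<and> i < j \<and> j \<le> int n \<longrightarrow> u i < u j)"

text \<open>The tail occupies the last m places of [n], and by \<open>ybase_head\<close> the element
  preserves \<plusminus>[n - m]. Letters below n - m act on the latter part, letters above n - m on
  the tail; the letter n - m itself is the one outside the parabolic subgroup.\<close>

definition ybase :: "nat \<Rightarrow> nat \<Rightarrow> sperm \<Rightarrow> bool" where
  "ybase n m y \<longleftrightarrow> y \<in> GBC n \<and> kap n y = m \<and> (\<forall>j. int n - int m < j \<and> j \<le> int n \<longrightarrow> y j = j + int m)"

text \<open>The element \<open>z = u y u\<^sup>-\<^sup>1\<close>, where \<open>u\<close> is a minimal length representative of a coset of the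
  parabolic subgroup generated by all \<open>s\<^sub>i\<close> with \<open>i \<noteq> n - m\<close>.\<close>
definition dec :: "nat \<Rightarrow> sperm \<Rightarrow> sperm \<Rightarrow> sperm \<Rightarrow> bool" where
  "dec n z u y \<longleftrightarrow> stdu n (kap n z) u \<and> ybase n (kap n z) y \<and> (\<forall>t. z (u t) = u (y t))"

lemma ybase_tail:
  assumes y: "ybase n m y" and j: "int n - int m < \<bar>j\<bar>" "\<bar>j\<bar> \<le> int n"
  shows "int n < \<bar>y j\<bar>" "0 < y j \<longleftrightarrow> 0 < j"
proof -
  have Y: "y \<in> GBC n" "kap n y = m" "\<And>j. int n - int m < j \<Longrightarrow> j \<le> int n \<Longrightarrow> y j = j + int m" using y by (auto simp: ybase_def)
  have m: "m \<le> n" using kap_le[OF Y(1)] Y(2) by simp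
  have "y j = (if 0 < j then j + int m else j - int m)"
    using Y(3)[of j] Y(3)[of "- j"] GBC_uminus[OF Y(1), of j] j m by (cases "0 < j") auto
  then show "int n < \<bar>y j\<bar>" "0 < y j \<longleftrightarrow> 0 < j" using j m by (auto split: if_splits)
qed

text \<open>\<open>tset n y\<close> has m elements, and the shifted places exhaust it. So no other
  point leaves \<plusminus>[n], and by involutivity no other point is sent to a shifted
  place.\<close>

lemma ybase_head:
  assumes y: "ybase n m y" and a: "\<bar>a\<bar> \<le> int n - int m"
  shows "\<bar>y a\<bar> \<le> int n - int m"
proof -
  have Y: "y \<in> GBC n" "kap n y = m" using y by (auto simp: ybase_def)
  have m: "m \<le> n" using kap_le[OF Y(1)] Y(2) by simp
  have "{int n - int m<..int n} \<subseteq> tset n y"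
  proof
    fix j assume "j \<in> {int n - int m<..int n}"
    then show "j \<in> tset n y" using ybase_tail[OF y, of j] m by (auto simp: tset_def)
  qed
  moreover have "card (tset n y) = card {int n - int m<..int n}" using Y(2) m by (simp add: kap_def)
  ultimately have T: "{int n - int m<..int n} = tset n y" by (intro card_subset_eq finite_tset) auto
  have "a \<notin> tset n y" "- a \<notin> tset n y" using a by (auto simp: T[symmetric])
  then have le: "\<bar>y a\<bar> \<le> int n" using a m GBC_uminus[OF Y(1), of a] by (auto simp: tset_def)
  show ?thesis
  proof (rule ccontr)
    assume "\<not> ?thesis"
    then have "int n < \<bar>y (y a)\<bar>" using ybase_tail(1)[OF y, of "y a"] le by simp
    then show False using a m GBC_invol[OF Y(1), of a] by simp
  qed
qed

lemma decD:
  assumes "dec n z u y"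
  shows "u \<in> WBC n" "y \<in> GBC n" "kap n y = kap n z" "z (u t) = u (y t)" "ybase n (kap n z) y"
    "1 \<le> i \<Longrightarrow> i < j \<Longrightarrow> j \<le> int n - int (kap n z) \<Longrightarrow> u i < u j"
    "1 \<le> i \<Longrightarrow> i \<le> int n - int (kap n z) \<Longrightarrow> 0 < u i"
    "int n - int (kap n z) < i \<Longrightarrow> i < j \<Longrightarrow> j \<le> int n \<Longrightarrow> u i < u j"
    "kap n z \<le> n"
  using assms kap_le[of y n] by (auto simp: dec_def stdu_def ybase_def)

lemma dec_tail_value:
  assumes z: "z \<in> GBC n" and d: "dec n z u y" and c: "int n - int (kap n z) < \<bar>c\<bar>" "\<bar>c\<bar> \<le> int n"
  shows "z (u c) = y c" "int n < \<bar>z (u c)\<bar>"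
proof -
  have b: "int n < \<bar>y c\<bar>" using ybase_tail(1)[OF decD(5)[OF d] c] .
  show "z (u c) = y c" using decD(4)[OF d, of c] WBC_outside[OF decD(1)[OF d] b] by simp
  then show "int n < \<bar>z (u c)\<bar>" using b by simp
qed

lemma dec_small_iff:
  assumes z: "z \<in> GBC n" and d: "dec n z u y" and c: "\<bar>c\<bar> \<le> int n"
  shows "\<bar>z (u c)\<bar> \<le> int n \<longleftrightarrow> \<bar>c\<bar> \<le> int n - int (kap n z)"
proof (cases "\<bar>c\<bar> \<le> int n - int (kap n z)")
  case True
  then have "\<bar>y c\<bar> \<le> int n" using ybase_head[OF decD(5)[OF d], of c] by simp
  then show ?thesis using True decD(4)[OF d, of c] WBC_abs_le_iff[OF decD(1)[OF d], of "y c"] by simp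
next
  case False
  then show ?thesis using dec_tail_value(2)[OF z d, of c] c by simp
qed

lemma dec_head_mono:
  assumes d: "dec n z u y" and ab: "a < b" "\<bar>a\<bar> \<le> int n - int (kap n z)" "\<bar>b\<bar> \<le> int n - int (kap n z)"
  shows "u a < u b"
proof -
  note U = decD(1)[OF d]
  have pos: "0 < u c" if "0 < c" "c \<le> int n - int (kap n z)" for c using decD(7)[OF d, of c] that by simp
  have neg: "u c < 0" if "c < 0" "- c \<le> int n - int (kap n z)" for c
    using pos[of "- c"] WBC_uminus[OF U, of c] that by simp
  consider "1 \<le> a" | "b \<le> -1" | "a \<le> 0" "0 \<le> b" using ab by linarith
  then show ?thesis
  proof cases
    case 1
    then show ?thesis using decD(6)[OF d, of a b] ab by simp
  next
    case 2
    then show ?thesis using decD(6)[OF d, of "- b" "- a"] ab WBC_uminus[OF U, of a] WBC_uminus[OF U, of b] by simp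
  next
    case 3
    have "u a \<le> 0" using 3 neg[of a] ab WBC_0[OF U] by (cases "a = 0") auto
    moreover have "0 \<le> u b" using 3 pos[of b] ab WBC_0[OF U] by (cases "b = 0") auto
    moreover have "u a \<noteq> u b" using WBC_eq_iff[OF U] ab by simp
    ultimately show ?thesis by simp
  qed
qed

text \<open>For a letter which is not a weak ascent this decides how conjugation acts on the
  decomposition: if it holds, s_i is absorbed into \<open>u\<close> (\<open>dec_step\<close>); if
  not, s_i passes through \<open>u\<close> and becomes a letter acting on \<open>y\<close>
  (\<open>dec_head_adjacent\<close>).\<close>

definition tailpos :: "nat \<Rightarrow> nat \<Rightarrow> sperm \<Rightarrow> bool" where
  "tailpos n i z \<longleftrightarrow> (i \<noteq> 0 \<and> int n < \<bar>z (int i)\<bar>) \<or> int n < \<bar>z (int i + 1)\<bar>"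

lemma tailpos_mv: assumes i: "i < n" and z: "z \<in> GBC n" shows "tailpos n i (mv i z) \<longleftrightarrow> tailpos n i z"
proof -
  have out: "int n < \<bar>sgen i t\<bar> \<longleftrightarrow> int n < \<bar>t\<bar>" for t
    using sgen_abs_le_iff[of i "int n" t] i by auto
  show ?thesis
  proof (cases "i = 0")
    case True
    then show ?thesis using out[of "z (-1)"] GBC_uminus[OF z, of 1] by (simp add: tailpos_def mv_apply sgen_0)
  next
    case False
    then show ?thesis using out by (auto simp: tailpos_def mv_apply sgen_Suc)
  qed
qed

text \<open>s_i touches a tail place, whereas the values of u on the first n - m places are not tail
  places; so s_i neither reverses two of these values nor changes a sign. The remaining values are
  increasing for another reason: they are the entries of the tail of \<open>mv i z\<close>.\<close>

lemma dec_step: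
  assumes z: "z \<in> GBC n" and d: "dec n z u y" and i: "i < n" and ne: "\<not> eqa n i z" and tp: "tailpos n i z"
  shows "dec n (mv i z) (sgen i \<circ> u) y"
proof -
  let ?v = "sgen i \<circ> u" and ?m = "kap n z"
  have k: "kap n (mv i z) = ?m" by (rule kap_mv[OF z i])
  have G: "mv i z \<in> GBC n" by (rule mv_GBC[OF z i ne])
  have V: "?v \<in> WBC n" using decD(1)[OF d] i by (auto intro: WBC_comp WBC_sgen)
  have rel: "mv i z (?v t) = ?v (y t)" for t using decD(4)[OF d, of t] by (simp add: mv_apply)
  have tail: "?v a < ?v b" if ab: "int n - int ?m < a" "a < b" "b \<le> int n" for a b
  proof -
    have e: "?v c = mv i z (c + int ?m)" if c: "int n - int ?m < c" "c \<le> int n" for c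
    proof -
      have "y c = c + int ?m" using decD(5)[OF d] c by (simp add: ybase_def)
      then have "mv i z (?v c) = c + int ?m" using rel[of c] WBC_outside[OF V, of "c + int ?m"] c by simp
      then show ?thesis using GBC_swap[OF G] by metis
    qed
    have "mv i z (a + int ?m) < mv i z (b + int ?m)"
      using tail_strict[OF G, of "a + int ?m" "b + int ?m"] tail_iff[OF G, of "b + int ?m"] k ab by simp
    then show ?thesis using e[of a] e[of b] ab by simp
  qed
  have hd: "0 < u a" "\<bar>z (u a)\<bar> \<le> int n" if "1 \<le> a" "a \<le> int n - int ?m" for a
    using decD(7)[OF d, of a] dec_small_iff[OF z d, of a] that by auto
  have pos: "0 < ?v a" if a: "1 \<le> a" "a \<le> int n - int ?m" for a
  proof (cases "i = 0")
    case True
    then have "u a \<noteq> 1" using hd(2)[OF a] tp by (auto simp: tailpos_def)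
    then show ?thesis using True hd(1)[OF a] by (auto simp: sgen_0)
  next
    case False
    then show ?thesis using hd(1)[OF a] by (auto simp: sgen_Suc)
  qed
  have inc: "?v a < ?v b" if ab: "1 \<le> a" "a < b" "b \<le> int n - int ?m" for a b
  proof -
    have lt: "u a < u b" using decD(6)[OF d ab] .
    have ha: "0 < u a" "\<bar>z (u a)\<bar> \<le> int n" "0 < u b" "\<bar>z (u b)\<bar> \<le> int n" using hd[of a] hd[of b] ab by auto
    show ?thesis
    proof (cases "i = 0")
      case True
      then have "u a \<noteq> 1" "u b \<noteq> 1" using ha tp by (auto simp: tailpos_def)
      then show ?thesis using True lt ha by (auto simp: sgen_0)
    next
      case False
      have "\<not> (u a = int i \<and> u b = int i + 1)" using ha tp False by (auto simp: tailpos_def)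
      then show ?thesis using sgen_less_iff[of i "u a" "u b"] False lt ha by auto
    qed
  qed
  show ?thesis using decD(5)[OF d] V tail pos inc rel by (simp add: dec_def stdu_def k)
qed

text \<open>Strict descents touching the tail are undone one by one. When none is left, no value on
  [n] is below -n and the places sent beyond n form a final segment; by \<open>tail_final\<close>
  the choice u = id works.\<close>

lemma dec_exists: "z \<in> GBC n \<Longrightarrow> \<exists>u y. dec n z u y"
proof (induction z rule: GBC_induct_len)
  case (step z)
  note z = step(1)
  show ?case
  proof (cases "\<exists>i<n. \<not> asc i z \<and> \<not> eqd i z \<and> \<not> eqa n i z \<and> tailpos n i z")
    case True
    then obtain i where i: "i < n" "\<not> asc i z" "\<not> eqd i z" "\<not> eqa n i z" "tailpos n i z" by blast
    note m = mv_desc[OF z i(1-4)]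
    obtain u y where "dec n (mv i z) u y" using step(2)[OF m(1)] m(2) by auto
    from dec_step[OF m(1) this i(1) m(5)] have "dec n z (sgen i \<circ> u) y"
      using i tailpos_mv[OF i(1) z] by simp
    then show ?thesis by blast
  next
    case False
    then have nd: "asc i z \<or> eqd i z \<or> eqa n i z" if "i < n" "tailpos n i z" for i using that by blast
    have ndi: "z i < z (i + 1) \<or> (int n < \<bar>z i\<bar> \<and> int n < \<bar>z (i + 1)\<bar> \<and> (0 < z i \<longleftrightarrow> 0 < z (i + 1)))"
      if i: "1 \<le> i" "i < int n" "int n < \<bar>z i\<bar> \<or> int n < \<bar>z (i + 1)\<bar>" for i
    proof -
      define j where "j = nat i"
      have j: "i = int j" "0 < j" "j < n" using i by (auto simp: j_def)
      have "\<not> eqd j z" using eqd_swap[OF z, of j] i j by auto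
      then show ?thesis using nd[of j] i j by (auto simp: tailpos_def asc_Suc eqa_def)
    qed
    have neg: "- int n \<le> z i" if "1 \<le> i" "i \<le> int n" for i
    proof -
      have "i \<le> int n \<longrightarrow> - int n \<le> z i" if "1 \<le> i" for i
        using that
      proof (induction i rule: int_ge_induct)
        case base
        then show ?case using nd[of 0] by (cases "int n < \<bar>z 1\<bar>") (auto simp: tailpos_def asc_0 eqd_def eqa_def)
      next
        case (step i)
        show ?case
        proof (intro impI, rule ccontr)
          assume h: "i + 1 \<le> int n" "\<not> - int n \<le> z (i + 1)"
          then have "- int n \<le> z i" using step by simp
          then show False using ndi[of i] h step(1) by auto
        qed
      qed
      then show ?thesis using that by blast
    qed
    have up: "int n < z (i + 1)" if "1 \<le> i" "i < int n" "int n < z i" for i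
      using ndi[of i] that by auto
    have "ybase n (kap n z) z" using tail_final(1)[OF z neg up] z by (simp add: ybase_def)
    then have "dec n z id z" by (simp add: dec_def stdu_def WBC_id)
    then show ?thesis by blast
  qed
qed

text \<open>On the first n - m places u enumerates the points of [n] which z keeps in
  \<plusminus>[n], in increasing order; on the last m places it lists the tail of z, since u(j) =
  z(j + m). Then y is the conjugate of z by u.\<close>

lemma dec_unique:
  assumes z: "z \<in> GBC n" and d: "dec n z u y" and d': "dec n z v x"
  shows "u = v" "y = x"
proof -
  let ?r = "int n - int (kap n z)"
  note U = decD(1)[OF d] and V = decD(1)[OF d']
  have im: "u ` {1..?r} = {t. 1 \<le> t \<and> t \<le> int n \<and> \<bar>z t\<bar> \<le> int n}" if d: "dec n z u y" for u y
  proof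
    note U = decD(1)[OF d]
    show "u ` {1..?r} \<subseteq> {t. 1 \<le> t \<and> t \<le> int n \<and> \<bar>z t\<bar> \<le> int n}"
    proof
      fix t assume "t \<in> u ` {1..?r}"
      then obtain a where a: "t = u a" "1 \<le> a" "a \<le> ?r" by auto
      have "0 < u a" "\<bar>z (u a)\<bar> \<le> int n" "\<bar>u a\<bar> \<le> int n"
        using decD(7)[OF d a(2,3)] dec_small_iff[OF z d, of a] WBC_abs_le_iff[OF U, of a] a by auto
      then show "t \<in> {t. 1 \<le> t \<and> t \<le> int n \<and> \<bar>z t\<bar> \<le> int n}" using a by simp
    qed
    show "{t. 1 \<le> t \<and> t \<le> int n \<and> \<bar>z t\<bar> \<le> int n} \<subseteq> u ` {1..?r}"
    proof
      fix t assume t: "t \<in> {t. 1 \<le> t \<and> t \<le> int n \<and> \<bar>z t\<bar> \<le> int n}"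
      obtain c where c: "t = u c" using WBC_bij[OF U] by (metis bij_pointE)
      have cn: "\<bar>c\<bar> \<le> int n" using WBC_abs_le_iff[OF U, of c] t c by simp
      then have cr: "\<bar>c\<bar> \<le> ?r" using dec_small_iff[OF z d cn] t c by simp
      have "0 < c"
      proof (rule ccontr)
        assume "\<not> 0 < c"
        then have "u c \<le> u 0" using dec_head_mono[OF d, of c 0] cr by (cases "c = 0") auto
        then show False using t c WBC_0[OF U] by simp
      qed
      then show "t \<in> u ` {1..?r}" using c cr by auto
    qed
  qed
  have head: "u a = v a" if "1 \<le> a" "a \<le> ?r" for a
    by (rule strict_mono_image_unique[of 1 ?r u v]) (use decD(6)[OF d] decD(6)[OF d'] im[OF d] im[OF d'] that in auto)
  have tl: "u j = z (j + int (kap n z))" if d: "dec n z u y" and j: "?r < j" "j \<le> int n" for u y j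
  proof -
    have "y j = j + int (kap n z)" using decD(5)[OF d] j by (simp add: ybase_def)
    then have "z (u j) = j + int (kap n z)" using decD(4)[OF d, of j] WBC_outside[OF decD(1)[OF d], of "j + int (kap n z)"] j by simp
    then show ?thesis using GBC_swap[OF z] by metis
  qed
  have pos: "u a = v a" if "1 \<le> a" for a
  proof -
    consider "a \<le> ?r" | "?r < a" "a \<le> int n" | "int n < a" by linarith
    then show ?thesis
    proof cases
      case 2
      then show ?thesis using tl[OF d] tl[OF d'] by simp
    next
      case 3
      then show ?thesis using WBC_outside[OF U, of a] WBC_outside[OF V, of a] that by simp
    qed (use head that in auto)
  qed
  show uv: "u = v"
  proof
    fix a :: int
    consider "1 \<le> a" | "a = 0" | "1 \<le> - a" by linarith
    then show "u a = v a"
    proof cases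
      case 3
      then show ?thesis using pos[of "- a"] WBC_uminus[OF U, of a] WBC_uminus[OF V, of a] by simp
    qed (use pos WBC_0[OF U] WBC_0[OF V] in auto)
  qed
  show "y = x"
  proof
    fix t
    have "u (y t) = u (x t)" using decD(4)[OF d, of t] decD(4)[OF d', of t] uv by simp
    then show "y t = x t" using WBC_eq_iff[OF U] by simp
  qed
qed

lemma WBC_conj_sgen:
  assumes u: "u \<in> WBC n" and i: "i = 0 \<longleftrightarrow> p = 0"
    and up: "(u (int p) = int i \<and> u (int p + 1) = int i + 1) \<or> (i \<noteq> 0 \<and> u (int p) = - int i - 1 \<and> u (int p + 1) = - int i)"
  shows "sgen i (u t) = u (sgen p t)"
proof (cases "\<bar>t\<bar> = int p \<or> \<bar>t\<bar> = int p + 1")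
  case True
  have m: "u (- 1) = - u 1" by (rule WBC_uminus[OF u])
  have 1: "sgen i (u (int p)) = u (sgen p (int p)) \<and> sgen i (u (int p + 1)) = u (sgen p (int p + 1))"
  proof (cases "i = 0")
    case True
    then show ?thesis using i up m by (auto simp: sgen_0)
  next
    case False
    then have "sgen i (int i) = int i + 1" "sgen i (int i + 1) = int i" "sgen p (int p) = int p + 1" "sgen p (int p + 1) = int p"
      "sgen i (- int i) = - int i - 1" "sgen i (- int i - 1) = - int i"
      using i by (auto simp: sgen_Suc)
    then show ?thesis using up by auto
  qed
  have "sgen i (u (- k)) = u (sgen p (- k)) \<longleftrightarrow> sgen i (u k) = u (sgen p k)" for k
    by (simp add: WBC_uminus[OF u])
  moreover have "t = int p \<or> t = - int p \<or> t = int p + 1 \<or> t = - (int p + 1)" using True by linarith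
  ultimately show ?thesis using 1 by metis
next
  case False
  then have "\<bar>u t\<bar> \<noteq> int i" "\<bar>u t\<bar> \<noteq> int i + 1"
    using up WBC_abs_eq_iff[OF u, of t "int p"] WBC_abs_eq_iff[OF u, of t "int p + 1"] by auto
  then show ?thesis using False sgen_fixed[of "u t" i] sgen_fixed[of t p] by simp
qed

text \<open>u is increasing on the first n - m places and takes the values i and i + 1 there, so
  their preimages are neighbours. For i = 0 positivity of u gives u(1) = 1.\<close>

lemma dec_head_adjacent:
  assumes z: "z \<in> GBC n" and d: "dec n z u y" and i: "i < n" and tp: "\<not> tailpos n i z"
  obtains p where "int p + 1 \<le> int n - int (kap n z)" "i = 0 \<longleftrightarrow> p = 0" "u (int p) = int i" "u (int p + 1) = int i + 1"
    "\<And>t. sgen i (u t) = u (sgen p t)"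
proof -
  let ?r = "int n - int (kap n z)"
  note U = decD(1)[OF d]
  have pre: "\<exists>c. x = u c \<and> 1 \<le> c \<and> c \<le> ?r" if x: "1 \<le> x" "x \<le> int n" "\<bar>z x\<bar> \<le> int n" for x
  proof -
    obtain c where c: "x = u c" using WBC_bij[OF U] by (metis bij_pointE)
    have cn: "\<bar>c\<bar> \<le> int n" using WBC_abs_le_iff[OF U, of c] x c by simp
    then have cr: "\<bar>c\<bar> \<le> ?r" using dec_small_iff[OF z d cn] x c by simp
    have "0 < c"
    proof (rule ccontr)
      assume "\<not> 0 < c"
      then have "u c \<le> u 0" using dec_head_mono[OF d, of c 0] cr by (cases "c = 0") auto
      then show False using x c WBC_0[OF U] by simp
    qed
    then show ?thesis using c cr by auto
  qed
  obtain q where q: "int i + 1 = u q" "1 \<le> q" "q \<le> ?r" using pre[of "int i + 1"] tp i by (auto simp: tailpos_def)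
  have uq: "u (q - 1) = int i"
  proof (cases "i = 0")
    case True
    have "q = 1"
    proof (rule ccontr)
      assume "q \<noteq> 1"
      then have "u 1 < u q" "0 < u 1" using decD(6)[OF d, of 1 q] decD(7)[OF d, of 1] q by auto
      then show False using q True by simp
    qed
    then show ?thesis using True WBC_0[OF U] by simp
  next
    case False
    then obtain c where c: "int i = u c" "1 \<le> c" "c \<le> ?r" using pre[of "int i"] tp i by (auto simp: tailpos_def)
    have "c < q"
    proof (rule ccontr)
      assume "\<not> c < q"
      then have "u q \<le> u c" using decD(6)[OF d, of q c] q c by (cases "q = c") auto
      then show False using q c by simp
    qed
    have "c = q - 1"
    proof (rule ccontr)
      assume "c \<noteq> q - 1"
      then have "u c < u (q - 1)" "u (q - 1) < u q" using decD(6)[OF d, of c "q - 1"] decD(6)[OF d, of "q - 1" q] \<open>c < q\<close> c q by auto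
      then show False using q c by simp
    qed
    then show ?thesis using c by simp
  qed
  define p where "p = nat (q - 1)"
  have p: "int p = q - 1" using q by (simp add: p_def)
  have ip: "i = 0 \<longleftrightarrow> p = 0" using WBC_zero_iff[OF U, of "int p"] uq p by auto
  show thesis
  proof (rule that[of p])
    show "sgen i (u t) = u (sgen p t)" for t using WBC_conj_sgen[OF U ip, of t] uq q p by simp
  qed (use q p uq ip in auto)
qed

text \<open>The same argument on the last m places. The common sign of z(i) and z(i + 1) is the sign
  of the preimages; if it is negative, the letter p comes from u(p) = -i - 1 and u(p + 1) =
  -i.\<close>

lemma dec_tail_adjacent:
  assumes z: "z \<in> GBC n" and d: "dec n z u y" and i: "i < n" and e: "eqa n i z"
  obtains p where "int n - int (kap n z) < int p" "p < n" "\<And>t. sgen i (u t) = u (sgen p t)"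
proof -
  let ?r = "int n - int (kap n z)"
  note U = decD(1)[OF d]
  have i0: "0 < i" using e by (simp add: eqa_def)
  have r0: "0 \<le> ?r" using decD(9)[OF d] by simp
  have pre: "\<exists>c. x = u c \<and> ?r < \<bar>c\<bar> \<and> \<bar>c\<bar> \<le> int n \<and> (0 < c \<longleftrightarrow> 0 < z x)" if x: "1 \<le> x" "x \<le> int n" "int n < \<bar>z x\<bar>" for x
  proof -
    obtain c where c: "x = u c" using WBC_bij[OF U] by (metis bij_pointE)
    have cn: "\<bar>c\<bar> \<le> int n" using WBC_abs_le_iff[OF U, of c] x c by simp
    then have cr: "?r < \<bar>c\<bar>" using dec_small_iff[OF z d cn] x c by simp
    have "0 < c \<longleftrightarrow> 0 < z x" using dec_tail_value(1)[OF z d cr cn] ybase_tail(2)[OF decD(5)[OF d] cr cn] c by simp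
    then show ?thesis using c cr cn by auto
  qed
  obtain a where a: "int i = u a" "?r < \<bar>a\<bar>" "\<bar>a\<bar> \<le> int n" "0 < a \<longleftrightarrow> 0 < z (int i)"
    using pre[of "int i"] i i0 e by (auto simp: eqa_def)
  obtain b where b: "int i + 1 = u b" "?r < \<bar>b\<bar>" "\<bar>b\<bar> \<le> int n" "0 < b \<longleftrightarrow> 0 < z (int i + 1)"
    using pre[of "int i + 1"] i i0 e by (auto simp: eqa_def)
  have s: "0 < a \<longleftrightarrow> 0 < b" using a b e by (simp add: eqa_def)
  have adj: "y' = x' + 1" if x: "?r < x'" "x' \<le> int n" "?r < y'" "y' \<le> int n" "u y' = u x' + 1" for x' y'
  proof (rule ccontr)
    assume ne: "y' \<noteq> x' + 1"
    have "x' < y'"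
    proof (rule ccontr)
      assume "\<not> x' < y'"
      moreover have "x' \<noteq> y'" using x(5) by auto
      ultimately have "u y' < u x'" using decD(8)[OF d, of y' x'] x(2,3) by simp
      then show False using x(5) by simp
    qed
    then have "u x' < u (x' + 1)" "u (x' + 1) < u y'"
      using decD(8)[OF d, of x' "x' + 1"] decD(8)[OF d, of "x' + 1" y'] ne x(1-4) by auto
    then show False using x(5) by simp
  qed
  show thesis
  proof (cases "0 < a")
    case True
    then have ab: "b = a + 1" using adj[of a b] a b s by simp
    define p where "p = nat a"
    have p: "int p = a" using True by (simp add: p_def)
    show ?thesis
    proof (rule that[of p])
      show "sgen i (u t) = u (sgen p t)" for t
        using WBC_conj_sgen[OF U, of i p t] a b p ab i0 True by auto
    qed (use a b p ab True in auto)
  next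
    case False
    then have ab: "- a = - b + 1" using adj[of "- b" "- a"] a b s WBC_uminus[OF U, of a] WBC_uminus[OF U, of b] r0 by auto
    define p where "p = nat (- b)"
    have bn: "b < 0" using False s b r0 by auto
    have p: "int p = - b" using bn by (simp add: p_def)
    have up: "u (int p) = - int i - 1" "u (int p + 1) = - int i"
      using a b p ab WBC_uminus[OF U, of a] WBC_uminus[OF U, of b] by auto
    show ?thesis
    proof (rule that[of p])
      show "sgen i (u t) = u (sgen p t)" for t
        using WBC_conj_sgen[OF U, of i p t] up i0 p bn by auto
    qed (use a b p ab bn False in auto)
  qed
qed

subsection \<open>The images of the basis vectors\<close>

definition es :: "sperm \<Rightarrow> sperm \<Rightarrow> lp" where
  "es y = (\<lambda>z. if z = y then 1 else 0)"

lemma xop_es_asc: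
  assumes y: "y \<in> GBC n" and i: "i < n" and a: "asc i y" "\<not> eqd i y" "\<not> eqa n i y"
  shows "xop k n i (es y) = es (mv i y)"
proof
  fix z
  note m = mv_GBC[OF y i a(3)] mv_types[OF y i a(2,3)]
  have e: "mv i z = y \<longleftrightarrow> z = mv i y" by auto
  show "xop k n i (es y) z = es (mv i y) z"
    using y a m e by (auto simp: xop_def es_def)
qed

lemma xinv_es_asc:
  "y \<in> GBC n \<Longrightarrow> i < n \<Longrightarrow> asc i y \<Longrightarrow> \<not> eqd i y \<Longrightarrow> \<not> eqa n i y \<Longrightarrow> xinv k n i (es (mv i y)) = es y"
  using xop_es_asc[of y n i k] xinv_xop[of i n k "es y"] by simp

lemma xinv_es_eqd:
  assumes y: "y \<in> GBC n" and i: "i < n" and e: "eqd i y"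
  shows "xinv k n i (es y) = (\<lambda>z. (ed k - vd) * es y z)"
proof
  fix z
  have "mv i z \<noteq> y" if "z \<in> GBC n" "\<not> eqd i z" "\<not> eqa n i z" using mv_types(1)[OF that(1) i that(2,3)] e by auto
  then show "xinv k n i (es y) z = (ed k - vd) * es y z"
    using e eqd_eqa[OF i e] by (auto simp: xinv_def xop_def es_def algebra_simps)
qed

lemma xinv_es_eqa:
  assumes y: "y \<in> GBC n" and i: "i < n" and e: "eqa n i y"
  shows "xinv k n i (es y) = (\<lambda>z. (ea k - vd) * es y z)"
proof
  fix z
  have "mv i z \<noteq> y" if "z \<in> GBC n" "\<not> eqd i z" "\<not> eqa n i z" using mv_types(2)[OF that(1) i that(2,3)] e by auto
  then show "xinv k n i (es y) z = (ea k - vd) * es y z"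
    using e y eqd_eqa[OF i, of y] by (auto simp: xinv_def xop_def es_def algebra_simps)
qed

text \<open>The part of y which does lie in W_n and can therefore index an operator.\<close>

definition hdp :: "nat \<Rightarrow> nat \<Rightarrow> sperm \<Rightarrow> sperm" where
  "hdp n m y = (\<lambda>i. if \<bar>i\<bar> \<le> int n - int m then y i else i)"

lemma hdp_invol: "ybase n m y \<Longrightarrow> hdp n m y (hdp n m y t) = t"
  using ybase_head[of n m y t] GBC_invol[of y n t] by (auto simp: hdp_def ybase_def)

lemma hdp_WBC: assumes y: "ybase n m y" shows "hdp n m y \<in> WBC n"
proof (rule WBC_I)
  have Y: "y \<in> GBC n" using y by (simp add: ybase_def)
  show "hdp n m y (- i) = - hdp n m y i" for i using GBC_uminus[OF Y] by (simp add: hdp_def)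
  show "bij (hdp n m y)" using hdp_invol[OF y] by (rule involuntory_imp_bij)
  show "hdp n m y i = i" if "int n < \<bar>i\<bar>" for i using that by (simp add: hdp_def)
qed

text \<open>If y is the shortest element of its orbit, \<open>hdp n m y\<close> is a product of (n -
  m)/2 commuting letters which are weak descents of y; their inverse operators act by the inverse of
  \<open>ed k\<close>. The power in front cancels these scalars, so that the basis vector of y is
  fixed.\<close>

definition bvec :: "modkind \<Rightarrow> nat \<Rightarrow> nat \<Rightarrow> sperm \<Rightarrow> sperm \<Rightarrow> sperm \<Rightarrow> lp" where
  "bvec k n m u y = (\<lambda>x. ed k ^ ((n - m) div 2) * theta n (xinv k n) (u \<circ> hdp n m y) (es y) x)"

text \<open>The value of the bar operator at the basis vector of \<open>z = u y u\<^sup>-\<^sup>1\<close>. If \<open>y\<close> has no tail, this is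
  up to a unit the vector \<open>bar(H\<^sub>y)\<close> applied to the basis vector of \<open>y\<close>, the formula of Lusztig
  for involutions; the tail is handled by parabolic induction.\<close>
definition bv :: "modkind \<Rightarrow> nat \<Rightarrow> sperm \<Rightarrow> sperm \<Rightarrow> lp" where
  "bv k n z = (let p = (SOME p. dec n z (fst p) (snd p)) in bvec k n (kap n z) (fst p) (snd p))"

lemma bv_eq: assumes z: "z \<in> GBC n" and d: "dec n z u y" shows "bv k n z = bvec k n (kap n z) u y"
proof -
  let ?p = "SOME p. dec n z (fst p) (snd p)"
  have "dec n z (fst ?p) (snd ?p)" by (rule someI[of _ "(u, y)"]) (simp add: d)
  then have "fst ?p = u" "snd ?p = y" using dec_unique[OF z _ d] by blast+
  then show ?thesis by (simp add: bv_def Let_def)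
qed

text \<open>u is increasing on \<plusminus>[n - m] and intertwines y with z, so comparisons for y at
  p are comparisons for z at i.\<close>

lemma dec_head_values:
  assumes z: "z \<in> GBC n" and d: "dec n z u y"
    and p: "int p + 1 \<le> int n - int (kap n z)" "i = 0 \<longleftrightarrow> p = 0" "u (int p) = int i" "u (int p + 1) = int i + 1"
  shows "asc p y \<longleftrightarrow> asc i z" "eqd p y \<longleftrightarrow> eqd i z" "\<not> eqa n p y" "asc p (u \<circ> hdp n (kap n z) y) \<longleftrightarrow> asc i z"
proof -
  let ?r = "int n - int (kap n z)"
  note U = decD(1)[OF d]
  have yr: "\<bar>y (int p)\<bar> \<le> ?r" "\<bar>y (int p + 1)\<bar> \<le> ?r" using ybase_head[OF decD(5)[OF d]] p(1) by auto
  have v: "z (int i) = u (y (int p))" "z (int i + 1) = u (y (int p + 1))"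
    using decD(4)[OF d, of "int p"] decD(4)[OF d, of "int p + 1"] p by auto
  have m: "u a < u b \<longleftrightarrow> a < b" if "\<bar>a\<bar> \<le> ?r" "\<bar>b\<bar> \<le> ?r" for a b
    using dec_head_mono[OF d, of a b] dec_head_mono[OF d, of b a] that by (metis linorder_neqE order_less_asym)
  have r0: "\<bar>0::int\<bar> \<le> ?r" using p(1) by simp
  show 1: "asc p y \<longleftrightarrow> asc i z"
    using m[OF yr] m[OF r0 yr(2)] p(2) v WBC_0[OF U] by (cases "i = 0") (simp_all add: asc_def)
  have "\<bar>u (y (int p))\<bar> = \<bar>u (int p + 1)\<bar> \<longleftrightarrow> \<bar>y (int p)\<bar> = \<bar>int p + 1\<bar>" by (rule WBC_abs_eq_iff[OF U])
  then show "eqd p y \<longleftrightarrow> eqd i z" using p v by (simp add: eqd_def)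
  show "\<not> eqa n p y" using yr by (auto simp: eqa_def)
  show "asc p (u \<circ> hdp n (kap n z) y) \<longleftrightarrow> asc i z"
    using p v by (cases "i = 0") (auto simp: asc_def hdp_def)
qed

text \<open>Let v be \<open>u \<circ> hdp n m y\<close>. If s_i touches the tail, v becomes s_i v.
  Otherwise u stays, y becomes s_p y s_p and v becomes s_i v s_p; the inner operator
  \<open>xinv k n p\<close> carries the new basis vector back to that of y. In both cases the
  lengths add up, so \<open>theta\<close> factors accordingly.\<close>

lemma bv_asc:
  assumes z: "z \<in> GBC n" and i: "i < n" and a: "asc i z" "\<not> eqd i z" "\<not> eqa n i z"
  shows "bv k n (mv i z) = xinv k n i (bv k n z)"
proof -
  obtain u y where d: "dec n z u y" using dec_exists[OF z] by blast
  let ?m = "kap n z" and ?r = "int n - int (kap n z)" and ?T = "xinv k n"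
  let ?h = "hdp n ?m y" and ?v = "u \<circ> hdp n ?m y"
  note U = decD(1)[OF d] and Y = decD(2)[OF d] and yb = decD(5)[OF d]
  note B = braided_xinv[of n k]
  have H: "?h \<in> WBC n" by (rule hdp_WBC[OF yb])
  have V: "?v \<in> WBC n" using U H by (rule WBC_comp)
  \<comment> \<open>The head part is an involution, so left ascents of v are read off from it at the
    preimages under u.\<close>
  have Vinv: "inv ?v (u t) = ?h t" for t
    by (rule inv_f_eq) (use WBC_bij[OF V] hdp_invol[OF yb] in \<open>auto simp: bij_is_inj\<close>)
  have G: "mv i z \<in> GBC n" by (rule mv_GBC[OF z i a(3)])
  have k: "kap n (mv i z) = ?m" by (rule kap_mv[OF z i])
  have sc: "xinv k n i (\<lambda>x. c * A x) = (\<lambda>x. c * xinv k n i A x)" for c A by (rule linop_scale[OF linop_xinv])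
  show ?thesis
  proof (cases "tailpos n i z")
    case True
    note d' = dec_step[OF z d i a(3) True]
    obtain P where P: "int i + 1 = u P" using WBC_bij[OF U] by (metis bij_pointE)
    obtain Q where Q: "int i = u Q" using WBC_bij[OF U] by (metis bij_pointE)
    have le: "\<bar>P\<bar> \<le> int n" "\<bar>Q\<bar> \<le> int n" using WBC_abs_le_iff[OF U, of P] WBC_abs_le_iff[OF U, of Q] P Q i by auto
    have zt: "int n < \<bar>z (u c)\<bar> \<and> (0 < z (u c) \<longleftrightarrow> 0 < c) \<and> ?h c = c" if "?r < \<bar>c\<bar>" "\<bar>c\<bar> \<le> int n" for c
      using dec_tail_value[OF z d that] ybase_tail[OF yb that] that by (simp add: hdp_def)
    have zh: "\<bar>z (u c)\<bar> \<le> int n \<and> \<bar>?h c\<bar> \<le> ?r" if "\<bar>c\<bar> \<le> ?r" for c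
      using dec_small_iff[OF z d, of c] ybase_head[OF yb, of c] that by (simp add: hdp_def)
    have "asc i (inv ?v)"
    proof (cases "i = 0")
      case True
      have Pt: "?r < \<bar>P\<bar>" using zh[of P] \<open>tailpos n i z\<close> True P by (force simp: tailpos_def)
      have "0 < P" using zt[OF Pt le(1)] a True P by (simp add: asc_0)
      then show ?thesis using Vinv[of P] zt[OF Pt le(1)] P True by (simp add: asc_0)
    next
      case False
      have lt: "z (u Q) < z (u P)" using a(1) P Q False by (simp add: asc_Suc)
      have ne: "\<not> (int n < \<bar>z (u Q)\<bar> \<and> int n < \<bar>z (u P)\<bar> \<and> (0 < z (u Q) \<longleftrightarrow> 0 < z (u P)))"
        using a(3) P Q False by (simp add: eqa_def)
      have tl: "?r < \<bar>Q\<bar> \<or> ?r < \<bar>P\<bar>" using \<open>tailpos n i z\<close> P Q zh[of P] zh[of Q] by (force simp: tailpos_def)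
      \<comment> \<open>The head part fixes tail places, and z sends them beyond n with their sign
        kept. So both maps compare a tail place with any other place in the same way, except for two
        tail places of equal sign, which is the case \<open>eqa\<close>.\<close>
      have "?h Q < ?h P"
      proof (cases "?r < \<bar>Q\<bar>")
        case q: True
        show ?thesis
        proof (cases "?r < \<bar>P\<bar>")
          case True
          then show ?thesis using zt[OF q le(2)] zt[OF True le(1)] lt ne by auto
        next
          case False
          then have "\<bar>z (u P)\<bar> \<le> int n" "\<bar>?h P\<bar> \<le> ?r" using zh[of P] by auto
          then show ?thesis using zt[OF q le(2)] q lt by auto
        qed
      next
        case q: False
        then have "?r < \<bar>P\<bar>" using tl by simp
        moreover have "\<bar>z (u Q)\<bar> \<le> int n" "\<bar>?h Q\<bar> \<le> ?r" using zh[of Q] q by auto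
        ultimately show ?thesis using zt[of P] le lt by auto
      qed
      then show ?thesis using Vinv[of P] Vinv[of Q] P Q False by (simp add: asc_Suc)
    qed
    from theta_left[OF B V i this] have "theta n ?T (sgen i \<circ> u \<circ> ?h) = xinv k n i \<circ> theta n ?T ?v" by (simp add: comp_assoc)
    then show ?thesis unfolding bv_eq[OF z d] bv_eq[OF G d'] bvec_def k sc by simp
  next
    case False
    obtain p where p: "int p + 1 \<le> ?r" "i = 0 \<longleftrightarrow> p = 0" "u (int p) = int i" "u (int p + 1) = int i + 1"
      "\<And>t. sgen i (u t) = u (sgen p t)" using dec_head_adjacent[OF z d i False] by blast
    have pn: "p < n" using p(1) by simp
    note hv = dec_head_values[OF z d p(1-4)]
    have ay: "asc p y" "\<not> eqd p y" "\<not> eqa n p y" "asc p ?v" using hv a by auto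
    let ?y = "mv p y"
    have Yn: "?y \<in> GBC n" by (rule mv_GBC[OF Y pn ay(3)])
    have yb': "ybase n ?m ?y" unfolding ybase_def
    proof (intro conjI allI impI)
      show "kap n ?y = ?m" using kap_mv[OF Y pn] decD(3)[OF d] by simp
      fix j assume j: "?r < j \<and> j \<le> int n"
      then have "y j = j + int ?m" using yb by (simp add: ybase_def)
      then show "?y j = j + int ?m" using j p(1) sgen_outside[of p j] sgen_outside[of p "j + int ?m"] by (simp add: mv_apply)
    qed (rule Yn)
    have d': "dec n (mv i z) u ?y" unfolding dec_def k
    proof (intro conjI allI)
      show "stdu n ?m u" using d by (simp add: dec_def)
      fix t
      have "mv i z (u t) = sgen i (z (u (sgen p t)))" by (simp add: mv_apply p(5))
      also have "\<dots> = u (sgen p (y (sgen p t)))" by (simp add: decD(4)[OF d] p(5))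
      finally show "mv i z (u t) = u (?y t)" by (simp add: mv_apply)
    qed (rule yb')
    have hy: "hdp n ?m ?y = sgen p \<circ> ?h \<circ> sgen p"
    proof
      fix t
      show "hdp n ?m ?y t = (sgen p \<circ> ?h \<circ> sgen p) t"
        using sgen_abs_le_iff[of p ?r t] p(1) by (simp add: hdp_def mv_apply)
    qed
    have nv: "u \<circ> hdp n ?m ?y = sgen i \<circ> (?v \<circ> sgen p)"
      unfolding hy by (rule ext) (simp add: p(5))
    have Vp: "?v \<circ> sgen p \<in> WBC n" using V pn by (auto intro: WBC_comp WBC_sgen)
    have hp: "?h (int p) = y (int p)" "?h (int p + 1) = y (int p + 1)" using p(1) by (auto simp: hdp_def)
    have iv: "asc i (inv (?v \<circ> sgen p))"
    proof (cases "i = 0")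
      case True
      then have p0: "p = 0" using p by simp
      have "y 1 \<noteq> 1" using GBC_nofix[OF Y, of 1] i by auto
      moreover have "0 < y 1" using ay p0 by (simp add: asc_0)
      ultimately show ?thesis using Vinv[of 1] hp p(4) True p0 by (auto simp: inv_o_sgen[OF V] asc_0 sgen_0)
    next
      case False
      then have p0: "0 < p" using p by simp
      have "y (int p) \<noteq> int p" using GBC_nofix[OF Y, of "int p"] p0 pn by auto
      moreover have "y (int p) \<noteq> - int p - 1" using ay(2) p0 by (auto simp: eqd_def)
      moreover have "y (int p) < y (int p + 1)" using ay(1) p0 by (simp add: asc_Suc)
      ultimately have "sgen p (y (int p)) < sgen p (y (int p + 1))" using sgen_less_iff[of p "y (int p)" "y (int p + 1)"] p0 by auto
      then show ?thesis using Vinv[of "int p"] Vinv[of "int p + 1"] hp p(3,4) False by (simp add: inv_o_sgen[OF V] asc_Suc)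
    qed
    have "theta n ?T (u \<circ> hdp n ?m ?y) = xinv k n i \<circ> (theta n ?T ?v \<circ> xinv k n p)"
      unfolding nv theta_left[OF B Vp i iv] theta_right[OF B V pn ay(4)] ..
    then have "theta n ?T (u \<circ> hdp n ?m ?y) (es ?y) = xinv k n i (theta n ?T ?v (es y))"
      using xinv_es_asc[OF Y pn ay(1-3), of k] by simp
    then show ?thesis unfolding bv_eq[OF z d] bv_eq[OF G d'] bvec_def k sc by simp
  qed
qed

text \<open>For weak letters: s_i passes through the group element to s_p, whose operator acts on
  the basis vector of y by a scalar, and \<open>theta_commute\<close> carries this scalar
  over.\<close>

lemma bv_commuting:
  assumes z: "z \<in> GBC n" and d: "dec n z u y" and i: "i < n" and p: "p < n"
    and c: "sgen i \<circ> (u \<circ> hdp n (kap n z) y) = u \<circ> hdp n (kap n z) y \<circ> sgen p"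
    and e: "xinv k n p (es y) = (\<lambda>x. c * es y x)"
  shows "xinv k n i (bv k n z) = (\<lambda>x. c * bv k n z x)"
proof -
  let ?v = "u \<circ> hdp n (kap n z) y" and ?T = "xinv k n"
  have V: "?v \<in> WBC n" using decD(1)[OF d] hdp_WBC[OF decD(5)[OF d]] by (rule WBC_comp)
  have "xinv k n i (theta n ?T ?v (es y)) = theta n ?T ?v (xinv k n p (es y))"
    using theta_commute[OF braided_xinv V i p c, of k] by (metis comp_apply)
  also have "\<dots> = (\<lambda>x. c * theta n ?T ?v (es y) x)" unfolding e by (rule linop_scale[OF linop_theta[OF V]])
  finally show ?thesis unfolding bv_eq[OF z d] bvec_def linop_scale[OF linop_xinv] by (simp add: mult.left_commute)
qed

lemma bv_eqd:
  assumes z: "z \<in> GBC n" and i: "i < n" and e: "eqd i z"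
  shows "xinv k n i (bv k n z) = (\<lambda>x. (ed k - vd) * bv k n z x)"
proof -
  obtain u y where d: "dec n z u y" using dec_exists[OF z] by blast
  let ?r = "int n - int (kap n z)" and ?h = "hdp n (kap n z) y"
  note Y = decD(2)[OF d]
  have "\<not> tailpos n i z" using eqd_swap[OF z e] i by (auto simp: tailpos_def)
  then obtain p where p: "int p + 1 \<le> ?r" "i = 0 \<longleftrightarrow> p = 0" "u (int p) = int i" "u (int p + 1) = int i + 1"
    "\<And>t. sgen i (u t) = u (sgen p t)" using dec_head_adjacent[OF z d i] by blast
  have pn: "p < n" using p(1) by simp
  have ey: "eqd p y" using dec_head_values(2)[OF z d p(1-4)] e by simp
  then have cy: "sgen p (y t) = y (sgen p t)" for t using DesEq_iff[OF Y pn] by (simp add: DesEq_def fun_eq_iff)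
  have "?h (sgen p t) = sgen p (?h t)" for t
    using sgen_abs_le_iff[of p ?r t] p(1) cy by (simp add: hdp_def)
  then have "sgen i \<circ> (u \<circ> ?h) = u \<circ> ?h \<circ> sgen p" by (simp add: fun_eq_iff p(5))
  then show ?thesis by (rule bv_commuting[OF z d i pn _ xinv_es_eqd[OF Y pn ey]])
qed

lemma bv_eqa:
  assumes z: "z \<in> GBC n" and i: "i < n" and e: "eqa n i z"
  shows "xinv k n i (bv k n z) = (\<lambda>x. (ea k - vd) * bv k n z x)"
proof -
  obtain u y where d: "dec n z u y" using dec_exists[OF z] by blast
  let ?r = "int n - int (kap n z)" and ?h = "hdp n (kap n z) y"
  note Y = decD(2)[OF d] and yb = decD(5)[OF d]
  obtain p where p: "?r < int p" "p < n" "\<And>t. sgen i (u t) = u (sgen p t)" using dec_tail_adjacent[OF z d i e] by blast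
  have r0: "0 \<le> ?r" using decD(9)[OF d] by simp
  have ey: "eqa n p y" using ybase_tail[OF yb, of "int p"] ybase_tail[OF yb, of "int p + 1"] p r0 by (auto simp: eqa_def)
  have "?h (sgen p t) = sgen p (?h t)" for t
  proof (cases "\<bar>t\<bar> \<le> ?r")
    case True
    then have "sgen p t = t" "sgen p (y t) = y t" using ybase_head[OF yb True] p(1) by (auto intro!: sgen_fixed)
    then show ?thesis using True by (simp add: hdp_def)
  next
    case False
    have "\<not> \<bar>sgen p t\<bar> \<le> ?r"
    proof
      assume "\<bar>sgen p t\<bar> \<le> ?r"
      then have "sgen p (sgen p t) = sgen p t" using p(1) by (intro sgen_fixed) auto
      then show False using False \<open>\<bar>sgen p t\<bar> \<le> ?r\<close> by simp
    qed
    then show ?thesis using False by (simp add: hdp_def)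
  qed
  then have "sgen i \<circ> (u \<circ> ?h) = u \<circ> ?h \<circ> sgen p" by (simp add: fun_eq_iff p(3))
  then show ?thesis by (rule bv_commuting[OF z d i p(2) _ xinv_es_eqa[OF Y p(2) ey]])
qed

lemma ed_inverse: "ed k * (ed k - vd) = 1"
  using ed_quad[of k] by (simp add: algebra_simps)

lemma bv_minimal:
  assumes z: "z \<in> GBC n" and nd: "\<And>i. i < n \<Longrightarrow> asc i z \<or> eqd i z \<or> eqa n i z"
  shows "bv k n z = es z"
proof -
  let ?m = "kap n z" and ?r = "int n - int (kap n z)" and ?T = "xinv k n"
  note F = no_descent_form[OF z nd]
  have yb: "ybase n ?m z" using F(1) z by (simp add: ybase_def)
  have d: "dec n z id z" using yb by (simp add: dec_def stdu_def WBC_id)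
  have m: "?m \<le> n" by (rule kap_le[OF z])
  \<comment> \<open>\<open>c j\<close> is the product of the letters s_1, s_3, ..., s_{2j-1}, all
    weak descents of z; each contributes the scalar \<open>ed k - vd\<close>, the inverse of
    \<open>ed k\<close>.\<close>
  define c where "c j = (\<lambda>i. if \<bar>i\<bar> \<le> 2 * int j then z i else i)" for j
  have step: "c (Suc j) = c j \<circ> sgen (2 * j + 1)" if j: "2 * int j + 2 \<le> ?r" for j
  proof
    fix t
    have z1: "z (2 * int j + 1) = 2 * int j + 2" "z (2 * int j + 2) = 2 * int j + 1"
      using F(2)[of "2 * int j + 1"] F(2)[of "2 * int j + 2"] j by auto
    have zm: "z (- (2 * int j + 1)) = - z (2 * int j + 1)" "z (- (2 * int j + 2)) = - z (2 * int j + 2)"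
      by (rule GBC_uminus[OF z])+
    consider "\<bar>t\<bar> \<le> 2 * int j" | "t = 2 * int j + 1" | "t = 2 * int j + 2" | "t = - (2 * int j + 1)" | "t = - (2 * int j + 2)"
      | "2 * int j + 2 < \<bar>t\<bar>" by linarith
    then show "c (Suc j) t = (c j \<circ> sgen (2 * j + 1)) t"
    proof cases
      case 1
      then have "sgen (2 * j + 1) t = t" by (intro sgen_fixed) auto
      then show ?thesis using 1 by (simp add: c_def)
    next
      case 6
      then have "sgen (2 * j + 1) t = t" by (intro sgen_fixed) auto
      then show ?thesis using 6 by (simp add: c_def)
    qed (use z1 zm in \<open>simp_all add: c_def sgen_Suc\<close>)
  qed
  have th: "c j \<in> WBC n \<and> theta n ?T (c j) (es z) = (\<lambda>x. (ed k - vd) ^ j * es z x)" if "2 * int j \<le> ?r" for j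
    using that
  proof (induction j)
    case 0
    have c0: "c 0 = id" using WBC_0[OF GBC_WBC[OF z]] by (auto simp: c_def)
    show ?case
    proof
      show "c 0 \<in> WBC n" by (rule ssubst[OF c0]) (rule WBC_id)
      have "theta n ?T (c 0) = id" by (rule ssubst[OF c0]) (rule theta_id[OF braided_xinv])
      then show "theta n ?T (c 0) (es z) = (\<lambda>x. (ed k - vd) ^ 0 * es z x)" by simp
    qed
  next
    case (Suc j)
    then have IH: "c j \<in> WBC n" "theta n ?T (c j) (es z) = (\<lambda>x. (ed k - vd) ^ j * es z x)" and j: "2 * int j + 2 \<le> ?r" by auto
    have pn: "2 * j + 1 < n" using j m by linarith
    have a: "asc (2 * j + 1) (c j)" by (simp add: asc_def c_def)
    have e: "eqd (2 * j + 1) z" using F(2)[of "2 * int j + 1"] j by (simp add: eqd_def add.commute)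
    have 1: "c (Suc j) \<in> WBC n" unfolding step[OF j] using IH(1) pn by (intro WBC_comp WBC_sgen)
    have "theta n ?T (c (Suc j)) (es z) = theta n ?T (c j) (xinv k n (2 * j + 1) (es z))"
      unfolding step[OF j] theta_right[OF braided_xinv IH(1) pn a] by simp
    also have "\<dots> = (\<lambda>x. (ed k - vd) * theta n ?T (c j) (es z) x)"
      unfolding xinv_es_eqd[OF z pn e] by (rule linop_scale[OF linop_theta[OF IH(1)]])
    finally show ?case using 1 IH(2) by (simp add: mult.assoc)
  qed
  let ?j = "(n - ?m) div 2"
  have "even (n - ?m)" using F(3) m by (simp add: of_nat_diff[symmetric] del: of_nat_diff)
  then have "2 * ?j = n - ?m" by (rule dvd_mult_div_cancel)
  then have "int (2 * ?j) = int (n - ?m)" by (rule arg_cong)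
  then have rj: "2 * int ?j = ?r" unfolding of_nat_diff[OF m] by simp
  have h: "hdp n ?m z = c ?j" by (simp add: hdp_def c_def rj)
  have one: "ed k ^ ?j * (ed k - vd) ^ ?j = 1"
    by (simp add: power_mult_distrib[symmetric] ed_inverse)
  have "theta n ?T (id \<circ> hdp n ?m z) (es z) = (\<lambda>x. (ed k - vd) ^ ?j * es z x)"
    using th[of ?j] rj h by simp
  then show ?thesis unfolding bv_eq[OF z d] bvec_def by (simp only: mult.assoc[symmetric] one mult_1)
qed

subsection \<open>Laurent polynomials\<close>

lemma lookup_times_lp:
  fixes p q :: lp
  assumes "finite S" "Poly_Mapping.keys p \<subseteq> S"
  shows "Poly_Mapping.lookup (p * q) k = (\<Sum>j\<in>S. Poly_Mapping.lookup p j * Poly_Mapping.lookup q (k - j))"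
proof -
  have "(\<Sum>r. Poly_Mapping.lookup q r when k = l + r) = Poly_Mapping.lookup q (k - l)" for l
  proof -
    have e: "(\<lambda>r. Poly_Mapping.lookup q r when k = l + r) = (\<lambda>r. Poly_Mapping.lookup q r when r = k - l)"
      by (auto simp: when_def fun_eq_iff)
    show ?thesis unfolding e by (rule Sum_any_when_equal)
  qed
  then have "Poly_Mapping.lookup (p * q) k = (\<Sum>l. Poly_Mapping.lookup p l * Poly_Mapping.lookup q (k - l))"
    by (simp add: times_poly_mapping.rep_eq prod_fun_def)
  also have "\<dots> = (\<Sum>j\<in>S. Poly_Mapping.lookup p j * Poly_Mapping.lookup q (k - j))"
    by (rule Sum_any.expand_superset[OF assms(1)]) (use assms(2) in \<open>auto simp: in_keys_iff\<close>)
  finally show ?thesis .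
qed

lemma lookup_single_times: "Poly_Mapping.lookup (Poly_Mapping.single i a * p) k = a * Poly_Mapping.lookup (p :: lp) (k - i)"
  using lookup_times_lp[of "{i}" "Poly_Mapping.single i a" p k] by (simp add: keys_single split: if_splits)

lemma lookup_vx_times: "Poly_Mapping.lookup (vx * p) k = Poly_Mapping.lookup p (k - 1)"
  and lookup_vy_times: "Poly_Mapping.lookup (vy * p) k = Poly_Mapping.lookup p (k + 1)"
  by (simp_all add: vx_def vy_def lookup_single_times)

definition barp :: "lp \<Rightarrow> lp" where
  "barp p = Abs_poly_mapping (\<lambda>k. Poly_Mapping.lookup p (- k))"

lemma lookup_barp: "Poly_Mapping.lookup (barp p) k = Poly_Mapping.lookup p (- k)"
proof -
  have "{k. Poly_Mapping.lookup p (- k) \<noteq> 0} = uminus ` Poly_Mapping.keys p"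
  proof (rule set_eqI)
    fix k :: int
    have "k \<in> uminus ` Poly_Mapping.keys p \<longleftrightarrow> - k \<in> Poly_Mapping.keys p" by force
    then show "k \<in> {k. Poly_Mapping.lookup p (- k) \<noteq> 0} \<longleftrightarrow> k \<in> uminus ` Poly_Mapping.keys p" by (simp add: in_keys_iff)
  qed
  then show ?thesis unfolding barp_def by (subst Abs_poly_mapping_inverse) auto
qed

lemma keys_barp: "Poly_Mapping.keys (barp p) = uminus ` Poly_Mapping.keys p"
proof (rule set_eqI)
  fix k :: int
  have "k \<in> uminus ` Poly_Mapping.keys p \<longleftrightarrow> - k \<in> Poly_Mapping.keys p" by force
  then show "k \<in> Poly_Mapping.keys (barp p) \<longleftrightarrow> k \<in> uminus ` Poly_Mapping.keys p" by (simp add: in_keys_iff lookup_barp)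
qed

definition tw :: "lp \<Rightarrow> lp" where
  "tw p = Abs_poly_mapping (\<lambda>k. if even k then Poly_Mapping.lookup p k else - Poly_Mapping.lookup p k)"

lemma lookup_tw: "Poly_Mapping.lookup (tw p) k = (if even k then Poly_Mapping.lookup p k else - Poly_Mapping.lookup p k)"
proof -
  have "{k. (if even k then Poly_Mapping.lookup p k else - Poly_Mapping.lookup p k) \<noteq> 0} = Poly_Mapping.keys p"
    by (auto simp: in_keys_iff)
  then show ?thesis unfolding tw_def by (subst Abs_poly_mapping_inverse) auto
qed

lemma keys_tw: "Poly_Mapping.keys (tw p) = Poly_Mapping.keys p"
  by (auto simp: in_keys_iff lookup_tw split: if_splits)

lemma barp_mult: "barp (p * q) = barp p * barp q"
proof (rule poly_mapping_eqI)
  fix k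
  have "Poly_Mapping.lookup (barp p * barp q) k = (\<Sum>j\<in>uminus ` Poly_Mapping.keys p. Poly_Mapping.lookup p (- j) * Poly_Mapping.lookup q (- (k - j)))"
    using lookup_times_lp[of "uminus ` Poly_Mapping.keys p" "barp p" "barp q" k] by (simp add: keys_barp lookup_barp)
  also have "\<dots> = (\<Sum>j\<in>Poly_Mapping.keys p. Poly_Mapping.lookup p j * Poly_Mapping.lookup q (- k - j))"
    by (subst sum.reindex) (auto intro!: sum.cong simp: minus_diff_commute)
  also have "\<dots> = Poly_Mapping.lookup (barp (p * q)) k"
    using lookup_times_lp[of "Poly_Mapping.keys p" p q "- k"] by (simp add: lookup_barp)
  finally show "Poly_Mapping.lookup (barp (p * q)) k = Poly_Mapping.lookup (barp p * barp q) k" by simp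
qed

lemma tw_mult: "tw (p * q) = tw p * tw q"
proof (rule poly_mapping_eqI)
  fix k
  have "Poly_Mapping.lookup (tw p * tw q) k = (\<Sum>j\<in>Poly_Mapping.keys p. Poly_Mapping.lookup (tw p) j * Poly_Mapping.lookup (tw q) (k - j))"
    using lookup_times_lp[of "Poly_Mapping.keys p" "tw p" "tw q" k] by (simp add: keys_tw)
  also have "\<dots> = (\<Sum>j\<in>Poly_Mapping.keys p. if even k then Poly_Mapping.lookup p j * Poly_Mapping.lookup q (k - j) else - (Poly_Mapping.lookup p j * Poly_Mapping.lookup q (k - j)))"
    by (rule sum.cong) (auto simp: lookup_tw)
  also have "\<dots> = Poly_Mapping.lookup (tw (p * q)) k"
    using lookup_times_lp[of "Poly_Mapping.keys p" p q k] by (simp add: lookup_tw sum_negf)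
  finally show "Poly_Mapping.lookup (tw (p * q)) k = Poly_Mapping.lookup (tw p * tw q) k" by simp
qed

lemma barp_simps [simp]: "barp 0 = 0" "barp 1 = 1" "barp (p + q) = barp p + barp q" "barp (- p) = - barp p"
  "barp (p - q) = barp p - barp q" "barp (barp p) = p" "barp vx = vy" "barp vy = vx" "barp vd = - vd"
  "barp (Poly_Mapping.single 0 a) = Poly_Mapping.single 0 a"
  by (auto intro!: poly_mapping_eqI simp: lookup_barp lookup_add lookup_minus lookup_one lookup_single vx_def vy_def vd_def when_def)

lemma tw_simps [simp]: "tw 0 = 0" "tw 1 = 1" "tw (p + q) = tw p + tw q" "tw (- p) = - tw p" "tw (p - q) = tw p - tw q"
  "tw vx = - vx" "tw vy = - vy" "tw vd = - vd"
  by (auto intro!: poly_mapping_eqI simp: lookup_tw lookup_add lookup_minus lookup_one lookup_single vx_def vy_def vd_def when_def)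

lemma tw_barp: "tw (barp p) = barp (tw p)"
  by (rule poly_mapping_eqI) (simp add: lookup_tw lookup_barp)

lemma barp_sum: "barp (sum f S) = (\<Sum>a\<in>S. barp (f a))"
  by (induction S rule: infinite_finite_induct) auto

lemma barp_ed: "barp (ed k) = ed k - vd" and barp_ea: "barp (ea k) = ea k - vd"
  by (cases k; simp add: vd_def)+

definition ngd :: "lp \<Rightarrow> bool" where
  "ngd p \<longleftrightarrow> (\<forall>j\<ge>0. Poly_Mapping.lookup p j = 0)"

lemma ngd_bar_invariant: assumes "ngd p" "barp p = p" shows "p = 0"
proof (rule poly_mapping_eqI)
  fix j
  have "Poly_Mapping.lookup p j = Poly_Mapping.lookup p (- j)" using assms(2) lookup_barp[of p j] by simp
  then show "Poly_Mapping.lookup p j = Poly_Mapping.lookup 0 j" using assms(1) by (cases "0 \<le> j") (auto simp: ngd_def)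
qed

subsection \<open>Antilinear extension\<close>

definition fb :: "modkind \<Rightarrow> nat \<Rightarrow> (sperm \<Rightarrow> lp) \<Rightarrow> (sperm \<Rightarrow> lp)" where
  "fb k n A = (\<lambda>z. \<Sum>y\<in>GBC n. barp (A y) * bv k n y z)"

lemma fb_add: "fb k n (\<lambda>z. A z + B z) = (\<lambda>z. fb k n A z + fb k n B z)"
  by (simp add: fb_def sum.distrib algebra_simps)

lemma fb_scale: "fb k n (\<lambda>z. c * A z) = (\<lambda>z. barp c * fb k n A z)"
  by (simp add: fb_def barp_mult sum_distrib_left mult.assoc)

lemma fb_diff: "fb k n (\<lambda>z. A z - B z) = (\<lambda>z. fb k n A z - fb k n B z)"
  by (simp add: fb_def sum_subtractf algebra_simps)

lemma fb_sum: "fb k n (\<lambda>z. \<Sum>a\<in>S. B a z) = (\<lambda>z. \<Sum>a\<in>S. fb k n (B a) z)"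
  by (simp add: fb_def barp_sum sum_distrib_right sum.swap[of _ S])

lemma fb_es: "z \<in> GBC n \<Longrightarrow> fb k n (es z) = bv k n z"
  by (rule ext) (simp add: fb_def es_def if_distrib[of barp] if_distrib[of "\<lambda>c. c * _"] finite_GBC sum.delta cong: if_cong)

lemma bv_desc:
  assumes z: "z \<in> GBC n" and i: "i < n" and a: "\<not> asc i z" "\<not> eqd i z" "\<not> eqa n i z"
  shows "bv k n z = xinv k n i (bv k n (mv i z))"
  using bv_asc[OF mv_desc(1)[OF z i a] i mv_desc(3-5)[OF z i a], of k] by simp

lemma sum_mv_swap:
  assumes i: "i < n"
  shows "(\<Sum>y\<in>GBC n. if eqd i y \<or> eqa n i y then 0 else h y (mv i y))
    = (\<Sum>y\<in>GBC n. if eqd i y \<or> eqa n i y then 0 else h (mv i y) y :: lp)"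
proof -
  let ?N = "{y \<in> GBC n. \<not> (eqd i y \<or> eqa n i y)}"
  have N: "mv i y \<in> ?N" if "y \<in> ?N" for y using that mv_GBC[of y n i] mv_types[of y n i] i by auto
  have "(\<Sum>y\<in>?N. h y (mv i y)) = (\<Sum>y\<in>?N. h (mv i y) y)"
    by (rule sum.reindex_bij_witness[where i = "mv i" and j = "mv i"]) (use N in auto)
  then show ?thesis by (simp add: finite_GBC sum.inter_filter[symmetric] if_not_P sum.If_cases Int_def)
qed

text \<open>The diagonal part of H_s. What remains is the interchange of z and s z s at strict
  letters (\<open>xop_dcoef\<close>), so that sums over the index set are handled by
  \<open>sum_mv_swap\<close>.\<close>

definition dcoef :: "modkind \<Rightarrow> nat \<Rightarrow> nat \<Rightarrow> sperm \<Rightarrow> lp" where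
  "dcoef k n i z = (if eqd i z then ed k else if eqa n i z then ea k else if asc i z then 0 else vd)"

lemma xop_dcoef: "z \<in> GBC n \<Longrightarrow> xop k n i A z = (if eqd i z \<or> eqa n i z then 0 else A (mv i z)) + dcoef k n i z * A z"
  by (auto simp: xop_def dcoef_def)

text \<open>The shape of the action of H_s on basis vectors, with the diagonal entry barred; this is
  exactly what \<open>fb_xop\<close> needs. At a strict descent the entry \<open>- vd\<close> is the
  difference between \<open>xinv\<close> and \<open>xop\<close>.\<close>

lemma xinv_bv:
  assumes y: "y \<in> GBC n" and i: "i < n"
  shows "xinv k n i (bv k n y) x = (if eqd i y \<or> eqa n i y then 0 else bv k n (mv i y) x) + barp (dcoef k n i y) * bv k n y x"
proof -
  consider "eqd i y" | "\<not> eqd i y" "eqa n i y" | "\<not> eqd i y" "\<not> eqa n i y" "asc i y" | "\<not> asc i y" "\<not> eqd i y" "\<not> eqa n i y" by blast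
  then show ?thesis
  proof cases
    case 1
    then show ?thesis using bv_eqd[OF y i, of k] by (simp add: dcoef_def barp_ed)
  next
    case 2
    then show ?thesis using bv_eqa[OF y i, of k] by (simp add: dcoef_def barp_ea)
  next
    case 3
    then show ?thesis using bv_asc[OF y i, of k] by (simp add: dcoef_def)
  next
    case 4
    have "xop k n i (bv k n y) = bv k n (mv i y)" using bv_desc[OF y i 4, of k] xop_xinv[OF i] by simp
    then show ?thesis using 4 by (simp add: xinv_def dcoef_def)
  qed
qed

lemma fb_xop:
  assumes i: "i < n"
  shows "fb k n (xop k n i A) = xinv k n i (fb k n A)"
proof
  fix z
  have "fb k n (xop k n i A) z = (\<Sum>y\<in>GBC n. if eqd i y \<or> eqa n i y then 0 else barp (A (mv i y)) * bv k n y z)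
     + (\<Sum>y\<in>GBC n. barp (dcoef k n i y) * barp (A y) * bv k n y z)"
    unfolding fb_def sum.distrib[symmetric]
    by (rule sum.cong) (auto simp: xop_dcoef barp_mult algebra_simps)
  also have "(\<Sum>y\<in>GBC n. if eqd i y \<or> eqa n i y then 0 else barp (A (mv i y)) * bv k n y z)
    = (\<Sum>y\<in>GBC n. if eqd i y \<or> eqa n i y then 0 else barp (A y) * bv k n (mv i y) z)"
    using sum_mv_swap[OF i, of "\<lambda>y x. barp (A x) * bv k n y z"] by simp
  also have "\<dots> + (\<Sum>y\<in>GBC n. barp (dcoef k n i y) * barp (A y) * bv k n y z)
    = (\<Sum>y\<in>GBC n. barp (A y) * xinv k n i (bv k n y) z)"
    unfolding sum.distrib[symmetric]
    by (rule sum.cong) (auto simp: xinv_bv[OF _ i] algebra_simps)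
  also have "\<dots> = xinv k n i (fb k n A) z"
    unfolding fb_def linop_sum[OF linop_xinv finite_GBC] ..
  finally show "fb k n (xop k n i A) z = xinv k n i (fb k n A) z" .
qed

lemma fb_xinv: "i < n \<Longrightarrow> fb k n (xinv k n i B) = xop k n i (fb k n B)"
  using fb_xop[of i n k "xinv k n i B"] xop_xinv[of i n k B] xop_xinv[of i n k "fb k n (xinv k n i B)"] by simp

lemma xinv_asc: "z \<in> GBC n \<Longrightarrow> asc i z \<Longrightarrow> \<not> eqd i z \<Longrightarrow> \<not> eqa n i z \<Longrightarrow> xinv k n i A z = A (mv i z) - vd * A z"
  and xinv_desc: "z \<in> GBC n \<Longrightarrow> \<not> asc i z \<Longrightarrow> \<not> eqd i z \<Longrightarrow> \<not> eqa n i z \<Longrightarrow> xinv k n i A z = A (mv i z)"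
  and xinv_other: "z \<notin> GBC n \<or> eqd i z \<or> eqa n i z \<Longrightarrow> \<exists>c. xinv k n i A z = c * A z"
  by (auto simp: xinv_def xop_def left_diff_distrib[symmetric])

text \<open>Induction along strict descents: \<open>xinv\<close> mixes only the coefficients at z
  and s_i z s_i, whose lengths differ by at most 2, and y is longer by 2 than its predecessor. The
  clause on \<open>kap\<close> confines the support to one orbit, so that in \<open>fb_top\<close>
  only longer elements of the same orbit matter.\<close>

lemma bv_triangular:
  assumes "y \<in> GBC n"
  shows "bv k n y y = 1 \<and> (\<forall>z. z \<noteq> y \<longrightarrow> bv k n y z \<noteq> 0 \<longrightarrow> z \<in> GBC n \<and> len (2 * n) z < len (2 * n) y \<and> kap n z = kap n y)"
  using assms
proof (induction y rule: GBC_induct_len)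
  case (step y)
  note y = step(1)
  show ?case
  proof (cases "\<forall>i<n. asc i y \<or> eqd i y \<or> eqa n i y")
    case True
    then show ?thesis using bv_minimal[OF y, of k] by (auto simp: es_def)
  next
    case False
    then obtain i where i: "i < n" "\<not> asc i y" "\<not> eqd i y" "\<not> eqa n i y" by blast
    let ?y = "mv i y" and ?B = "bv k n (mv i y)"
    note m = mv_desc[OF y i]
    have IH: "?B ?y = 1" "\<And>z. z \<noteq> ?y \<Longrightarrow> ?B z \<noteq> 0 \<Longrightarrow> z \<in> GBC n \<and> len (2 * n) z < len (2 * n) ?y \<and> kap n z = kap n ?y"
      using step(2)[OF m(1)] m(2) by auto
    have k: "kap n ?y = kap n y" by (rule kap_mv[OF y i(1)])
    have B: "bv k n y = xinv k n i ?B" by (rule bv_desc[OF y i])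
    have near: "z \<in> GBC n \<and> len (2 * n) z < len (2 * n) y \<and> kap n z = kap n y" if "?B z \<noteq> 0" for z
      using IH(2)[of z] that m(1,2) k by (cases "z = ?y") auto
    show ?thesis
    proof (intro conjI allI impI)
      show "bv k n y y = 1" unfolding B using xinv_desc[OF y i(2-4), of k ?B] IH(1) by simp
    next
      fix z assume zy: "z \<noteq> y" and nz: "bv k n y z \<noteq> 0"
      consider "z \<notin> GBC n \<or> eqd i z \<or> eqa n i z" | "z \<in> GBC n" "\<not> eqd i z" "\<not> eqa n i z" by blast
      then have "z \<in> GBC n \<and> len (2 * n) z < len (2 * n) y \<and> kap n z = kap n y"
      proof cases
        case 1
        then obtain c where "bv k n y z = c * ?B z" using xinv_other B by metis
        then show ?thesis using near nz by auto
      next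
        case 2
        have far: "len (2 * n) z < len (2 * n) y \<and> kap n z = kap n y" if "?B (mv i z) \<noteq> 0"
        proof -
          have "mv i z \<noteq> ?y" using zy by (metis mv_mv)
          then have h: "len (2 * n) (mv i z) < len (2 * n) ?y" "kap n (mv i z) = kap n ?y" using IH(2) that by auto
          have "len (2 * n) z \<le> len (2 * n) (mv i z) + 2"
            using len_mv[OF 2(1) i(1)] mv_desc(2)[OF 2(1) i(1)] 2 by (cases "asc i z") auto
          then show ?thesis using h m(2) k kap_mv[OF 2(1) i(1)] by simp
        qed
        show ?thesis
        proof (cases "asc i z")
          case True
          then have "bv k n y z = ?B (mv i z) - vd * ?B z" unfolding B using xinv_asc 2 by blast
          then have "?B (mv i z) \<noteq> 0 \<or> ?B z \<noteq> 0" using nz by auto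
          then show ?thesis using far near 2 by blast
        next
          case False
          then have "bv k n y z = ?B (mv i z)" unfolding B using xinv_desc 2 by blast
          then show ?thesis using far nz 2 by simp
        qed
      qed
      then show "z \<in> GBC n" "len (2 * n) z < len (2 * n) y" "kap n z = kap n y" by auto
    qed
  qed
qed

lemma fb_support: "z \<notin> GBC n \<Longrightarrow> fb k n A z = 0"
  unfolding fb_def
proof (intro sum.neutral ballI)
  fix x assume z: "z \<notin> GBC n" and x: "x \<in> GBC n"
  then have "bv k n x z = 0" using bv_triangular[OF x, of k] by metis
  then show "barp (A x) * bv k n x z = 0" by simp
qed

lemma fb_top:
  assumes y: "y \<in> GBC n" and A: "\<And>x. x \<in> GBC n \<Longrightarrow> len (2 * n) y < len (2 * n) x \<Longrightarrow> kap n x = kap n y \<Longrightarrow> A x = 0"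
  shows "fb k n A y = barp (A y)"
proof -
  have "fb k n A y = (\<Sum>x\<in>GBC n. if x = y then barp (A y) else 0)"
    unfolding fb_def
  proof (rule sum.cong)
    fix x assume x: "x \<in> GBC n"
    show "barp (A x) * bv k n x y = (if x = y then barp (A y) else 0)"
    proof (cases "x = y \<or> bv k n x y = 0")
      case True
      then show ?thesis using bv_triangular[OF y, of k] by auto
    next
      case False
      then have "A x = 0" using bv_triangular[OF x, of k] A[OF x] by auto
      then show ?thesis using False by simp
    qed
  qed simp
  then show ?thesis using y by (simp add: finite_GBC)
qed

text \<open>At a longest element of the support, triangularity makes the coefficient itself bar
  invariant, although it has only negative powers of x.\<close>

lemma bar_invariant_unique:
  assumes inv: "fb k n A = A" and neg: "\<And>y. y \<in> GBC n \<Longrightarrow> ngd (A y)"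
  shows "A = (\<lambda>_. 0)"
proof (rule ccontr)
  assume ne: "A \<noteq> (\<lambda>_. 0)"
  let ?S = "{y \<in> GBC n. A y \<noteq> 0}"
  have "A z = 0" if "z \<notin> GBC n" for z using fb_support[OF that, of k A] inv by simp
  then have "?S \<noteq> {}" using ne by blast
  moreover have "finite ?S" using finite_GBC by simp
  ultimately obtain y where y: "y \<in> ?S" "\<And>x. x \<in> ?S \<Longrightarrow> len (2 * n) x \<le> len (2 * n) y"
    using obtains_MAX[of ?S "len (2 * n)"] by (metis (no_types, lifting) Max_ge finite_imageI imageI)
  have "A y = barp (A y)" using fb_top[of y n A k] y inv by force
  then show False using ngd_bar_invariant[of "A y"] neg y by auto
qed

section \<open>Canonical bases\<close>

definition iscan :: "modkind \<Rightarrow> nat \<Rightarrow> sperm \<Rightarrow> (sperm \<Rightarrow> lp) \<Rightarrow> bool" where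
  "iscan k n z c \<longleftrightarrow> fb k n c = c \<and> c z = 1 \<and> (\<forall>y. y \<noteq> z \<longrightarrow> ngd (c y) \<and> (c y \<noteq> 0 \<longrightarrow> y \<in> GBC n \<and> len (2 * n) y < len (2 * n) z))"

lemma iscan_unique:
  assumes "iscan k n z c" "iscan k n z d" shows "c = d"
proof -
  have "fb k n (\<lambda>y. c y - d y) = (\<lambda>y. c y - d y)" using assms by (simp add: fb_diff iscan_def)
  moreover have "ngd (c y - d y)" for y using assms by (cases "y = z") (auto simp: iscan_def ngd_def lookup_minus)
  ultimately have "(\<lambda>y. c y - d y) = (\<lambda>_. 0)" by (rule bar_invariant_unique)
  then show ?thesis by (simp add: fun_eq_iff)
qed

definition npd :: "lp \<Rightarrow> bool" where
  "npd p \<longleftrightarrow> (\<forall>j>0. Poly_Mapping.lookup p j = 0)"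

lemma ngd_npd: "ngd p \<Longrightarrow> npd p" "ngd p \<Longrightarrow> npd (vx * p)" "ngd p \<Longrightarrow> npd (vy * p)" "ngd p \<Longrightarrow> ngd (vy * p)"
  by (auto simp: ngd_def npd_def lookup_vx_times lookup_vy_times)

lemma npd_add: "npd p \<Longrightarrow> npd q \<Longrightarrow> npd (p + q)"
  by (simp add: npd_def lookup_add)

text \<open>The factor is 0 for the scalar -x^-1 and x + x^-1 for the scalar x, so it raises degrees
  by at most one.\<close>

lemma npd_eigen: assumes "ngd p" shows "npd ((ed k + vy) * p)" "npd ((ea k + vy) * p)"
proof -
  have 1: "npd (vx * p + vy * p)" using ngd_npd(2,3)[OF assms] by (rule npd_add)
  have 2: "npd 0" by (simp add: npd_def)
  show "npd ((ed k + vy) * p)" using 1 2 by (cases k) (simp_all add: distrib_right)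
  show "npd ((ea k + vy) * p)" using 1 2 by (cases k) (simp_all add: distrib_right)
qed

text \<open>As for Kazhdan-Lusztig bases: if \<open>s\<close> is an ascent from \<open>y\<close> to \<open>z\<close> then \<open>(H\<^sub>s + x\<^sup>-\<^sup>1) C\<^sub>y\<close> is
  bar invariant with leading term \<open>z\<close> and coefficients without positive powers of \<open>x\<close>; subtracting
  integer multiples of smaller canonical basis elements removes the constant terms.\<close>
lemma iscan_exists: "z \<in> GBC n \<Longrightarrow> \<exists>c. iscan k n z c"
proof (induction z rule: GBC_induct_len)
  case (step z)
  note z = step(1)
  show ?case
  proof (cases "\<forall>i<n. asc i z \<or> eqd i z \<or> eqa n i z")
    case True
    then have "fb k n (es z) = es z" using bv_minimal[OF z, of k] fb_es[OF z, of k] by simp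
    then have "iscan k n z (es z)" by (simp add: iscan_def es_def ngd_def)
    then show ?thesis by blast
  next
    case False
    then obtain i where i: "i < n" "\<not> asc i z" "\<not> eqd i z" "\<not> eqa n i z" by blast
    let ?y = "mv i z"
    note m = mv_desc[OF z i]
    let ?S = "{w \<in> GBC n. len (2 * n) w < len (2 * n) z}"
    have "\<forall>w\<in>?S. \<exists>c. iscan k n w c" using step(2) by blast
    then obtain C where C: "\<And>w. w \<in> ?S \<Longrightarrow> iscan k n w (C w)" by metis
    have yS: "?y \<in> ?S" using m by simp
    let ?c = "C ?y"
    have c: "fb k n ?c = ?c" "?c ?y = 1" "\<And>x. x \<noteq> ?y \<Longrightarrow> ngd (?c x)"
      "\<And>x. x \<noteq> ?y \<Longrightarrow> ?c x \<noteq> 0 \<Longrightarrow> x \<in> GBC n \<and> len (2 * n) x < len (2 * n) ?y"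
      using C[OF yS] by (auto simp: iscan_def)
    define D where "D = (\<lambda>x. xop k n i ?c x + vy * ?c x)"
    have fD: "fb k n D = D"
    proof -
      have "fb k n D = (\<lambda>x. xinv k n i ?c x + vx * ?c x)" unfolding D_def fb_add fb_scale fb_xop[OF i(1)] c(1) by simp
      then show ?thesis by (simp add: D_def xinv_def vd_def algebra_simps)
    qed
    have Dasc: "D x = ?c (mv i x) + vy * ?c x" if "x \<in> GBC n" "asc i x" "\<not> eqd i x" "\<not> eqa n i x" for x
      using that by (simp add: D_def xop_asc)
    have Ddesc: "D x = ?c (mv i x) + vx * ?c x" if "x \<in> GBC n" "\<not> asc i x" "\<not> eqd i x" "\<not> eqa n i x" for x
      using that by (simp add: D_def xop_desc vd_def algebra_simps)
    have yz: "?y \<noteq> z" using m(2) by auto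
    have cz: "?c z = 0" using c(4)[of z] yz m(2) by auto
    have Dz: "D z = 1" using Ddesc[OF z i(2-4)] c(2) cz by simp
    have Dn: "npd (D x)" "D x \<noteq> 0 \<Longrightarrow> x \<in> GBC n \<and> len (2 * n) x < len (2 * n) z" if xz: "x \<noteq> z" for x
    proof -
      have mx: "mv i x \<noteq> ?y" using xz by (metis mv_mv)
      consider "x \<notin> GBC n \<or> eqd i x" | "x \<in> GBC n" "\<not> eqd i x" "eqa n i x"
        | "x \<in> GBC n" "\<not> eqd i x" "\<not> eqa n i x" "asc i x" | "x \<in> GBC n" "\<not> eqd i x" "\<not> eqa n i x" "\<not> asc i x" by blast
      then have "npd (D x) \<and> (D x \<noteq> 0 \<longrightarrow> x \<in> GBC n \<and> len (2 * n) x < len (2 * n) z)"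
      proof cases
        case 1
        then have xy: "x \<noteq> ?y" using m by auto
        have "D x = (ed k + vy) * ?c x" using 1 by (auto simp: D_def xop_def algebra_simps)
        then show ?thesis using npd_eigen(1)[OF c(3)[OF xy], of k] c(4)[OF xy] m(2) by auto
      next
        case 2
        then have xy: "x \<noteq> ?y" using m by auto
        have "D x = (ea k + vy) * ?c x" using 2 by (auto simp: D_def xop_def algebra_simps)
        then show ?thesis using npd_eigen(2)[OF c(3)[OF xy], of k] c(4)[OF xy] m(2) by auto
      next
        case 3
        have D: "D x = ?c (mv i x) + vy * ?c x" using Dasc 3 by blast
        have "npd (vy * ?c x)" using ngd_npd(3)[OF c(3)[of x]] c(2) by (cases "x = ?y") (auto simp: npd_def vy_def lookup_single when_def)
        then have "npd (D x)" unfolding D using ngd_npd(1)[OF c(3)[OF mx]] by (rule npd_add[rotated])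
        moreover have "len (2 * n) x < len (2 * n) z" if "D x \<noteq> 0"
        proof -
          have "?c (mv i x) \<noteq> 0 \<or> ?c x \<noteq> 0" using that D by auto
          then show ?thesis
          proof
            assume "?c (mv i x) \<noteq> 0"
            then show ?thesis using c(4)[OF mx] len_mv[OF 3(1) i(1) 3(4,2)] m(2) by auto
          next
            assume "?c x \<noteq> 0"
            then show ?thesis using c(4)[of x] m(2) by (cases "x = ?y") auto
          qed
        qed
        ultimately show ?thesis using 3 by blast
      next
        case 4
        then have xy: "x \<noteq> ?y" using m by auto
        have D: "D x = ?c (mv i x) + vx * ?c x" using Ddesc 4 by blast
        have "npd (D x)" unfolding D using ngd_npd(1)[OF c(3)[OF mx]] ngd_npd(2)[OF c(3)[OF xy]] by (rule npd_add)
        moreover have "len (2 * n) x < len (2 * n) z" if "D x \<noteq> 0"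
        proof -
          have "?c (mv i x) \<noteq> 0 \<or> ?c x \<noteq> 0" using that D by auto
          then show ?thesis
          proof
            assume "?c (mv i x) \<noteq> 0"
            then show ?thesis using c(4)[OF mx] mv_desc(2)[OF 4(1) i(1) 4(4,2,3)] m(2) by auto
          next
            assume "?c x \<noteq> 0"
            then show ?thesis using c(4)[OF xy] m(2) by auto
          qed
        qed
        ultimately show ?thesis using 4 by blast
      qed
      then show "npd (D x)" "D x \<noteq> 0 \<Longrightarrow> x \<in> GBC n \<and> len (2 * n) x < len (2 * n) z" by auto
    qed
    define a where "a w = Poly_Mapping.lookup (D w) 0" for w
    define E where "E = (\<lambda>x. D x - (\<Sum>w\<in>?S. Poly_Mapping.single 0 (a w) * C w x))"
    have fC: "fb k n (C w) = C w" if "w \<in> ?S" for w using C[OF that] by (simp add: iscan_def)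
    have "fb k n E = (\<lambda>x. D x - (\<Sum>w\<in>?S. Poly_Mapping.single 0 (a w) * fb k n (C w) x))"
      unfolding E_def fb_diff fb_sum fb_scale fD by simp
    also have "\<dots> = E"
    proof
      fix x
      have "(\<Sum>w\<in>?S. Poly_Mapping.single 0 (a w) * fb k n (C w) x) = (\<Sum>w\<in>?S. Poly_Mapping.single 0 (a w) * C w x)"
        by (rule sum.cong[OF refl]) (simp only: fC)
      then show "D x - (\<Sum>w\<in>?S. Poly_Mapping.single 0 (a w) * fb k n (C w) x) = E x" by (simp add: E_def)
    qed
    finally have fE: "fb k n E = E" .
    have Cn: "ngd (C w x)" "C w x \<noteq> 0 \<Longrightarrow> x \<in> GBC n \<and> len (2 * n) x < len (2 * n) w" if "w \<in> ?S" "x \<noteq> w" for w x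
      using C[OF that(1)] that(2) by (auto simp: iscan_def)
    have C1: "C w w = 1" if "w \<in> ?S" for w using C[OF that] by (simp add: iscan_def)
    have out: "C w x = 0" if "w \<in> ?S" "x \<notin> ?S" for w x
      using Cn(2)[OF that(1), of x] that by (cases "x = w") auto
    have Eout: "E x = D x" if "x \<notin> ?S" for x
      unfolding E_def using out[OF _ that] by (simp add: sum.neutral)
    have Ez: "E z = 1" using Eout[of z] Dz by simp
    have En: "ngd (E x)" "E x \<noteq> 0 \<Longrightarrow> x \<in> GBC n \<and> len (2 * n) x < len (2 * n) z" if xz: "x \<noteq> z" for x
    proof -
      show "E x \<noteq> 0 \<Longrightarrow> x \<in> GBC n \<and> len (2 * n) x < len (2 * n) z"
        using Eout[of x] Dn(2)[OF xz] by (cases "x \<in> ?S") auto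
      show "ngd (E x)"
      proof (cases "x \<in> ?S")
        case False
        then have "E x = 0" using Eout[OF False] Dn(2)[OF xz] by auto
        then show ?thesis by (simp add: ngd_def)
      next
        case True
        have fin: "finite ?S" using finite_GBC by simp
        have "Poly_Mapping.lookup (E x) j = 0" if j: "0 \<le> j" for j
        proof -
          have "Poly_Mapping.lookup (\<Sum>w\<in>?S. Poly_Mapping.single 0 (a w) * C w x) j = (\<Sum>w\<in>?S. a w * Poly_Mapping.lookup (C w x) j)"
            by (simp add: lookup_sum lookup_single_times)
          also have "\<dots> = (\<Sum>w\<in>?S. if w = x then a x * Poly_Mapping.lookup 1 j else 0)"
            by (rule sum.cong) (use Cn(1)[of _ x] C1 j in \<open>auto simp: ngd_def\<close>)
          also have "\<dots> = a x * Poly_Mapping.lookup 1 j" using fin True by (simp add: sum.delta)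
          finally have "Poly_Mapping.lookup (E x) j = Poly_Mapping.lookup (D x) j - a x * Poly_Mapping.lookup 1 j"
            by (simp add: E_def lookup_minus)
          then show ?thesis using Dn(1)[OF xz] j by (cases "j = 0") (auto simp: a_def npd_def lookup_one)
        qed
        then show ?thesis by (simp add: ngd_def)
      qed
    qed
    have "iscan k n z E" using fE Ez En by (auto simp: iscan_def)
    then show ?thesis by blast
  qed
qed

section \<open>The duality pairing\<close>

lemma iota_types:
  assumes w: "w \<in> GBC n" and i: "i < n"
  shows "eqd i (iota n w) \<longleftrightarrow> eqd i w" "eqa n i (iota n w) \<longleftrightarrow> eqa n i w" "\<not> eqa n i w \<Longrightarrow> asc i (iota n w) \<longleftrightarrow> \<not> asc i w"
  using opp_types[OF w iota_opp[OF w] i] by auto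

text \<open>Every element climbs by strict ascents inside its orbit; the induction is on the
  distance to the greatest length. The climb ends at an element without strict ascents, which
  \<open>iota\<close> turns into one without strict descents, and these are unique for given
  \<open>kap\<close>.\<close>

lemma orbit_max:
  assumes Z: "Z \<in> GBC n" and na: "\<And>i. i < n \<Longrightarrow> \<not> asc i Z \<or> eqd i Z \<or> eqa n i Z"
    and y: "y \<in> GBC n" "kap n y = kap n Z"
  shows "y = Z \<or> len (2 * n) y < len (2 * n) Z"
  using y
proof (induction "Max (len (2 * n) ` GBC n) - len (2 * n) y" arbitrary: y rule: less_induct)
  case less
  note y = less.prems
  show ?case
  proof (cases "\<exists>i<n. asc i y \<and> \<not> eqd i y \<and> \<not> eqa n i y")
    case True
    then obtain i where i: "i < n" "asc i y" "\<not> eqd i y" "\<not> eqa n i y" by blast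
    have G: "mv i y \<in> GBC n" by (rule mv_GBC[OF y(1) i(1,4)])
    have l: "len (2 * n) (mv i y) = len (2 * n) y + 2" by (rule len_mv[OF y(1) i(1-3)])
    have "len (2 * n) (mv i y) \<le> Max (len (2 * n) ` GBC n)" using G finite_GBC by (intro Max_ge) auto
    then have "mv i y = Z \<or> len (2 * n) (mv i y) < len (2 * n) Z"
      using less.hyps[OF _ G] l kap_mv[OF y(1) i(1)] y(2) by simp
    then show ?thesis using l by auto
  next
    case False
    have nd: "asc i (iota n y) \<or> eqd i (iota n y) \<or> eqa n i (iota n y)" if "i < n" for i
      using False that iota_types[OF y(1) that] by blast
    have nd': "asc i (iota n Z) \<or> eqd i (iota n Z) \<or> eqa n i (iota n Z)" if "i < n" for i
      using na that iota_types[OF Z that] by blast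
    have "kap n (iota n y) = kap n (iota n Z)" using y(2) kap_iota[OF y(1)] kap_iota[OF Z] by simp
    then have "iota n y = iota n Z"
      using no_descent_unique[OF iota_opp(1)[OF y(1)] nd iota_opp(1)[OF Z] nd'] by blast
    then show ?thesis using iota_iota[OF y(1)] iota_iota[OF Z] by metis
  qed
qed

text \<open>The substitution \<open>x \<mapsto> - x\<close> absorbs the signs which usually occur in the duality between
  Kazhdan-Lusztig bases.\<close>
definition pr :: "nat \<Rightarrow> (sperm \<Rightarrow> lp) \<Rightarrow> (sperm \<Rightarrow> lp) \<Rightarrow> lp" where
  "pr n B A = (\<Sum>w\<in>GBC n. tw (B (iota n w)) * A w)"

lemma pr_xop:
  assumes i: "i < n"
  shows "pr n (xop ModN n i B) A = pr n B (xinv ModM n i A)"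
proof -
  \<comment> \<open>The identity behind x -> -x. Weak letters are kept by \<open>iota\<close>: -x^-1
    becomes x^-1 = x - \<delta>, and x becomes -x = -x^-1 - \<delta>. At strict letters
    \<open>iota\<close> exchanges the entries 0 and \<delta>, and \<delta> becomes
    -\<delta>.\<close>
  have c: "tw (dcoef ModN n i (iota n w)) = dcoef ModM n i w - vd" if "w \<in> GBC n" for w
    using iota_types[OF that i] by (auto simp: dcoef_def vd_def)
  have L: "tw (xop ModN n i B (iota n w)) * A w = (if eqd i w \<or> eqa n i w then 0 else tw (B (iota n (mv i w))) * A w)
      + (dcoef ModM n i w - vd) * tw (B (iota n w)) * A w" if w: "w \<in> GBC n" for w
  proof -
    have "xop ModN n i B (iota n w) = (if eqd i w \<or> eqa n i w then 0 else B (iota n (mv i w))) + dcoef ModN n i (iota n w) * B (iota n w)"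
      using iota_types[OF w i] iota_mv[OF w i] by (auto simp: xop_dcoef[OF iota_opp(1)[OF w]])
    then show ?thesis by (cases "eqd i w \<or> eqa n i w") (simp_all add: tw_mult c[OF w] distrib_right)
  qed
  have R: "tw (B (iota n w)) * xinv ModM n i A w = (if eqd i w \<or> eqa n i w then 0 else tw (B (iota n w)) * A (mv i w))
      + (dcoef ModM n i w - vd) * tw (B (iota n w)) * A w" if w: "w \<in> GBC n" for w
    by (simp add: xinv_def xop_dcoef[OF w] algebra_simps)
  have "pr n (xop ModN n i B) A = (\<Sum>w\<in>GBC n. if eqd i w \<or> eqa n i w then 0 else tw (B (iota n (mv i w))) * A w)
      + (\<Sum>w\<in>GBC n. (dcoef ModM n i w - vd) * tw (B (iota n w)) * A w)"
    unfolding pr_def sum.distrib[symmetric] by (rule sum.cong) (auto simp: L)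
  also have "(\<Sum>w\<in>GBC n. if eqd i w \<or> eqa n i w then 0 else tw (B (iota n (mv i w))) * A w)
    = (\<Sum>w\<in>GBC n. if eqd i w \<or> eqa n i w then 0 else tw (B (iota n w)) * A (mv i w))"
    using sum_mv_swap[OF i, of "\<lambda>w v. tw (B (iota n v)) * A w"] by simp
  also have "\<dots> + (\<Sum>w\<in>GBC n. (dcoef ModM n i w - vd) * tw (B (iota n w)) * A w) = pr n B (xinv ModM n i A)"
    unfolding pr_def sum.distrib[symmetric] by (rule sum.cong) (auto simp: R)
  finally show ?thesis .
qed

lemma pr_es: assumes "z \<in> GBC n" shows "pr n B (es z) = tw (B (iota n z))"
proof -
  have "pr n B (es z) = (\<Sum>w\<in>GBC n. if w = z then tw (B (iota n z)) else 0)"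
    unfolding pr_def by (rule sum.cong) (auto simp: es_def)
  then show ?thesis using assms by (simp add: finite_GBC)
qed

lemma pr_bv:
  assumes "z \<in> GBC n"
  shows "pr n (fb ModN n B) (bv ModM n z) = barp (tw (B (iota n z)))"
  using assms
proof (induction z arbitrary: B rule: GBC_induct_len)
  case (step z)
  note z = step(1)
  have Z: "iota n z \<in> GBC n" by (rule iota_opp(1)[OF z])
  show ?case
  proof (cases "\<forall>i<n. asc i z \<or> eqd i z \<or> eqa n i z")
    case True
    then have b: "bv ModM n z = es z" using bv_minimal[OF z] by blast
    have na: "\<not> asc i (iota n z) \<or> eqd i (iota n z) \<or> eqa n i (iota n z)" if "i < n" for i
      using True that iota_types[OF z that] by blast
    \<comment> \<open>\<open>iota n z\<close> is the longest element of its orbit, so by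
      triangularity no other basis vector contributes to this coefficient.\<close>
    have "fb ModN n B (iota n z) = barp (B (iota n z))"
    proof (rule fb_top[OF Z])
      fix x assume "x \<in> GBC n" "len (2 * n) (iota n z) < len (2 * n) x" "kap n x = kap n (iota n z)"
      then show "B x = 0" using orbit_max[OF Z na, of x] by auto
    qed
    then show ?thesis unfolding b pr_es[OF z] by (simp add: tw_barp)
  next
    case False
    then obtain i where i: "i < n" "\<not> asc i z" "\<not> eqd i z" "\<not> eqa n i z" by blast
    let ?y = "mv i z"
    note m = mv_desc[OF z i]
    have Y: "iota n ?y \<in> GBC n" by (rule iota_opp(1)[OF m(1)])
    have "pr n (fb ModN n B) (bv ModM n z) = pr n (xop ModN n i (fb ModN n B)) (bv ModM n ?y)"
      unfolding bv_desc[OF z i] pr_xop[OF i(1)] ..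
    also have "\<dots> = pr n (fb ModN n (xinv ModN n i B)) (bv ModM n ?y)" unfolding fb_xinv[OF i(1)] ..
    also have "\<dots> = barp (tw (xinv ModN n i B (iota n ?y)))" using step(2)[OF m(1)] m(2) by simp
    also have "xinv ModN n i B (iota n ?y) = B (mv i (iota n ?y))"
      using iota_types[OF m(1) i(1)] m by (intro xinv_desc[OF Y]) auto
    also have "mv i (iota n ?y) = iota n z" using iota_mv[OF m(1) i(1) m(5)] by simp
    finally show ?thesis .
  qed
qed

lemma pr_fb: "pr n (fb ModN n B) (fb ModM n A) = barp (pr n B A)"
proof -
  have "pr n (fb ModN n B) (fb ModM n A) = (\<Sum>w\<in>GBC n. \<Sum>z\<in>GBC n. barp (A z) * (tw (fb ModN n B (iota n w)) * bv ModM n z w))"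
    unfolding pr_def fb_def[of ModM] by (simp add: sum_distrib_left mult.left_commute)
  also have "\<dots> = (\<Sum>z\<in>GBC n. barp (A z) * pr n (fb ModN n B) (bv ModM n z))"
    by (subst sum.swap) (simp add: pr_def sum_distrib_left)
  also have "\<dots> = (\<Sum>z\<in>GBC n. barp (A z) * barp (tw (B (iota n z))))"
    by (rule sum.cong) (auto simp: pr_bv)
  also have "\<dots> = barp (pr n B A)" by (simp add: pr_def barp_sum barp_mult mult.commute)
  finally show ?thesis .
qed

text \<open>The product of two elements of x^-1 Z[x^-1] starts only at x^-2; the pairing can
  therefore be read off even in degree -1.\<close>

lemma ngd_mult:
  assumes "ngd p" "ngd q" "-1 \<le> j" shows "Poly_Mapping.lookup (p * q) j = 0"
proof -
  have "Poly_Mapping.lookup (p * q) j = (\<Sum>i\<in>Poly_Mapping.keys p. Poly_Mapping.lookup p i * Poly_Mapping.lookup q (j - i))"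
    by (rule lookup_times_lp) auto
  also have "\<dots> = 0"
  proof (intro sum.neutral ballI)
    fix i
    show "Poly_Mapping.lookup p i * Poly_Mapping.lookup q (j - i) = 0"
      using assms by (cases "0 \<le> i") (auto simp: ngd_def)
  qed
  finally show ?thesis .
qed

lemma canonical_duality:
  assumes y: "y \<in> GBC n" and z: "z \<in> GBC n" and yz: "y \<noteq> z"
    and c: "iscan ModM n y c" and d: "iscan ModN n (iota n z) d"
  shows "Poly_Mapping.lookup (d (iota n y)) (-1) = Poly_Mapping.lookup (c z) (-1)"
proof -
  have iy: "iota n y \<noteq> iota n z" using iota_iota[OF y] iota_iota[OF z] yz by metis
  let ?g = "\<lambda>w. tw (d (iota n w)) * c w"
  have tn: "ngd (tw p)" if "ngd p" for p using that by (simp add: ngd_def lookup_tw)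
  have cz: "ngd (c z)" "c y = 1" and dy: "ngd (d (iota n y))" "d (iota n z) = 1" using c d yz iy by (auto simp: iscan_def)
  \<comment> \<open>Away from y and z both factors have only negative powers of x.\<close>
  have rest: "Poly_Mapping.lookup (?g w) j = 0" if w: "w \<in> GBC n - {y, z}" and j: "-1 \<le> j" for w j
  proof -
    have "iota n w \<noteq> iota n z" using iota_iota[of w n] iota_iota[OF z] w by (metis Diff_iff insertCI)
    then have "ngd (tw (d (iota n w)))" "ngd (c w)" using c d w tn by (auto simp: iscan_def)
    then show ?thesis using j by (rule ngd_mult)
  qed
  have split: "Poly_Mapping.lookup (pr n d c) j = Poly_Mapping.lookup (tw (d (iota n y))) j + Poly_Mapping.lookup (c z) j" if j: "-1 \<le> j" for j
  proof -
    have "pr n d c = sum ?g {y, z} + sum ?g (GBC n - {y, z})"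
      unfolding pr_def using y z by (subst sum.subset_diff[of "{y, z}"]) (auto simp: finite_GBC add.commute)
    then have "Poly_Mapping.lookup (pr n d c) j = Poly_Mapping.lookup (sum ?g {y, z}) j"
      using rest[OF _ j] by (simp add: lookup_add lookup_sum)
    then show ?thesis using yz cz dy by (simp add: lookup_add)
  qed
  have "barp (pr n d c) = pr n d c" using pr_fb[of n d c] c d by (simp add: iscan_def)
  moreover have "ngd (pr n d c)" using split cz(1) tn[OF dy(1)] by (simp add: ngd_def)
  ultimately have "pr n d c = 0" using ngd_bar_invariant by blast
  \<comment> \<open>The substitution x -> -x changes the sign of the coefficient of x^-1, so the
    vanishing sum becomes an equality.\<close>
  then show ?thesis using split[of "-1"] by (simp add: lookup_tw)
qed

section \<open>Coefficient functions and Laurent polynomials\<close>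

text \<open>The statement works with bare coefficient functions, the computations with finitely
  supported ones, which form a commutative ring. \<open>lft\<close> and \<open>low\<close> translate
  between the two.\<close>

definition lft :: "(sperm \<Rightarrow> lp) \<Rightarrow> melt" where
  "lft A = (\<lambda>y. Poly_Mapping.lookup (A y))"

definition low :: "melt \<Rightarrow> sperm \<Rightarrow> lp" where
  "low A = (\<lambda>y. Abs_poly_mapping (A y))"

lemma low_lft [simp]: "low (lft A) = A"
  by (simp add: low_def lft_def lookup_inverse)

lemma lft_eq_iff [simp]: "lft A = lft B \<longleftrightarrow> A = B"
  by (metis low_lft)

lemma lfin_lookup [simp]: "lfin (Poly_Mapping.lookup p)"
  by (simp add: lfin_def)

lemma lfinE: assumes "lfin c" obtains p where "c = Poly_Mapping.lookup p"
  using assms by (metis Abs_poly_mapping_inverse lfin_def mem_Collect_eq)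

lemma lft_zero: "lft A y = (\<lambda>_. 0) \<longleftrightarrow> A y = 0"
proof
  assume "lft A y = (\<lambda>_. 0)"
  then show "A y = 0" by (intro poly_mapping_eqI) (simp add: lft_def)
qed (auto simp: lft_def fun_eq_iff)

lemma valid_lft: "valid n (lft A) \<longleftrightarrow> (\<forall>y. y \<notin> GBC n \<longrightarrow> A y = 0)"
  unfolding valid_def lft_zero by (simp add: lft_def)

lemma validE:
  assumes "valid n A" obtains B where "A = lft B" "\<And>y. y \<notin> GBC n \<Longrightarrow> B y = 0"
proof -
  have "A = lft (low A)"
    using assms by (auto simp: fun_eq_iff lft_def low_def valid_def lfin_def Abs_poly_mapping_inverse)
  then show thesis using that[of "low A"] assms valid_lft by metis
qed

lemma lmul_lookup: "lmul (Poly_Mapping.lookup p) (Poly_Mapping.lookup q) = Poly_Mapping.lookup (p * q)"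
proof
  fix k
  have "{j. Poly_Mapping.lookup p j \<noteq> 0} = Poly_Mapping.keys p" by (auto simp: in_keys_iff)
  then show "lmul (Poly_Mapping.lookup p) (Poly_Mapping.lookup q) k = Poly_Mapping.lookup (p * q) k"
    using lookup_times_lp[of "Poly_Mapping.keys p" p q k] by (simp add: lmul_def)
qed

lemma smul_lft: "smul (Poly_Mapping.lookup c) (lft A) = lft (\<lambda>y. c * A y)"
  by (simp add: smul_def lft_def lmul_lookup)

lemma lft_add: "lft A + lft B = lft (\<lambda>y. A y + B y)"
  by (simp add: fun_eq_iff lft_def lookup_add)

lemma lft_diff: "lft A - lft B = lft (\<lambda>y. A y - B y)"
  by (simp add: fun_eq_iff lft_def lookup_minus)

lemma lft_sum: "(\<Sum>a\<in>S. lft (B a)) = lft (\<lambda>y. \<Sum>a\<in>S. B a y)"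
proof (induction S rule: infinite_finite_induct)
  case (insert a S)
  then show ?case by (simp add: lft_add)
qed (auto simp: fun_eq_iff lft_def)

lemma bas_lft: "bas z = lft (es z)"
  by (auto simp: fun_eq_iff bas_def lft_def es_def lone_def lookup_one when_def)

lemma scalars_lft: "lx = Poly_Mapping.lookup vx" "- lxinv = Poly_Mapping.lookup (- vy)"
  "lx - lxinv = Poly_Mapping.lookup vd"
  by (auto simp: fun_eq_iff lx_def lxinv_def vx_def vy_def vd_def lookup_minus lookup_single when_def)

lemma lbar_lookup: "lbar (Poly_Mapping.lookup p) = Poly_Mapping.lookup (barp p)"
  by (simp add: fun_eq_iff lbar_def lookup_barp)

text \<open>The basis vector of z is H_s applied to that of s_i z s_i, so this is the quadratic
  relation.\<close>

lemma xop_es_desc: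
  assumes z: "z \<in> GBC n" and i: "i < n" and a: "\<not> asc i z" "\<not> eqd i z" "\<not> eqa n i z"
  shows "xop k n i (es z) = (\<lambda>x. es (mv i z) x + vd * es z x)"
proof -
  note m = mv_desc[OF z i a]
  have e: "xop k n i (es (mv i z)) = es z" using xop_es_asc[OF m(1) i m(3-5), of k] by simp
  show ?thesis by (rule ext) (use xop_quad[OF i, of k "es (mv i z)"] in \<open>simp add: e\<close>)
qed

lemma hbas_lft:
  assumes z: "z \<in> GBC n" and i: "i < n"
  shows "hbas k n (sgen i) z = lft (xop k n i (es z))"
proof -
  have eq: "xop k n i (es z) = (\<lambda>x. c * es z x)" if "xinv k n i (es z) = (\<lambda>x. (c - vd) * es z x)" for c
    using that by (auto simp: xinv_def fun_eq_iff algebra_simps)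
  consider "eqd i z" | "\<not> eqd i z" "eqa n i z" | "asc i z" "\<not> eqd i z" "\<not> eqa n i z" | "\<not> asc i z" "\<not> eqd i z" "\<not> eqa n i z" by blast
  then show ?thesis
  proof cases
    case 1
    then have "xop k n i (es z) = (\<lambda>x. ed k * es z x)" using eq xinv_es_eqd[OF z i] by blast
    then show ?thesis using 1 eqd_eqa[OF i 1] AscLt_iff[OF z i] DesLt_iff[OF z i] AscEq_iff[OF z i]
      by (cases k) (simp_all add: hbas_def bas_lft scalars_lft(1,2) smul_lft)
  next
    case 2
    then have "xop k n i (es z) = (\<lambda>x. ea k * es z x)" using eq xinv_es_eqa[OF z i] by blast
    then show ?thesis using 2 AscLt_iff[OF z i] DesLt_iff[OF z i] AscEq_iff[OF z i]
      by (cases k) (simp_all add: hbas_def bas_lft scalars_lft(1,2) smul_lft)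
  next
    case 3
    then show ?thesis using AscLt_iff[OF z i] xop_es_asc[OF z i, of k]
      by (simp add: hbas_def bas_lft mv_def)
  next
    case 4
    then show ?thesis using AscLt_iff[OF z i] DesLt_iff[OF z i] xop_es_desc[OF z i 4, of k]
      by (simp add: hbas_def bas_lft scalars_lft(3) smul_lft lft_add mv_def)
  qed
qed

lemma es_expand:
  assumes "\<And>y. y \<notin> GBC n \<Longrightarrow> A y = 0"
  shows "A = (\<lambda>y. \<Sum>z\<in>GBC n. A z * es z y)"
proof
  fix y
  have "(\<Sum>z\<in>GBC n. A z * es z y) = (\<Sum>z\<in>GBC n. if z = y then A y else 0)"
    by (rule sum.cong) (auto simp: es_def)
  then show "A y = (\<Sum>z\<in>GBC n. A z * es z y)" using assms[of y] by (simp add: finite_GBC)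
qed

lemma hact_lft:
  assumes A: "\<And>y. y \<notin> GBC n \<Longrightarrow> A y = 0" and i: "i < n"
  shows "hact k n (sgen i) (lft A) = lft (xop k n i A)"
proof -
  have "hact k n (sgen i) (lft A) = (\<Sum>z\<in>GBC n. lft (\<lambda>y. A z * xop k n i (es z) y))"
    unfolding hact_def by (rule sum.cong) (auto simp: hbas_lft[OF _ i] smul_lft[symmetric], simp add: lft_def)
  also have "\<dots> = lft (xop k n i (\<lambda>y. \<Sum>z\<in>GBC n. A z * es z y))"
    unfolding lft_sum linop_sum[OF linop_xop finite_GBC] ..
  finally show ?thesis using es_expand[of n A] A by simp
qed

section \<open>Bar operators and canonical bases of the statement\<close>

lemma DesLt_empty_iff:
  assumes z: "z \<in> GBC n"
  shows "DesLt n z = {} \<longleftrightarrow> (\<forall>i<n. asc i z \<or> eqd i z \<or> eqa n i z)"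
proof -
  have "DesLt n z \<subseteq> Sgens n" by (auto simp: DesLt_def)
  then have "DesLt n z = {} \<longleftrightarrow> (\<forall>i<n. sgen i \<notin> DesLt n z)" by (auto simp: Sgens_def)
  then show ?thesis using DesLt_iff[OF z] by blast
qed

lemma is_bar_fb: "is_bar k n (\<lambda>A. lft (fb k n (low A)))"
  unfolding is_bar_def
proof (intro conjI allI impI ballI)
  fix A assume "valid n A"
  show "valid n (lft (fb k n (low A)))" using fb_support by (simp add: valid_lft)
next
  fix A B assume "valid n A" "valid n B"
  then obtain A' B' where "A = lft A'" "B = lft B'" by (metis validE)
  then show "lft (fb k n (low (A + B))) = lft (fb k n (low A)) + lft (fb k n (low B))"
    by (simp add: lft_add fb_add)
next
  fix c A assume "lfin c" "valid n A"
  then obtain c' A' where "c = Poly_Mapping.lookup c'" "A = lft A'" by (metis validE lfinE)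
  then show "lft (fb k n (low (smul c A))) = smul (lbar c) (lft (fb k n (low A)))"
    by (simp add: smul_lft fb_scale lbar_lookup)
next
  fix s A assume "s \<in> Sgens n" "valid n A"
  then obtain i A' where i: "s = sgen i" "i < n" and A: "A = lft A'" "\<And>y. y \<notin> GBC n \<Longrightarrow> A' y = 0"
    by (auto simp: Sgens_def elim: validE)
  have "hact k n s (lft (fb k n A')) = lft (xop k n i (fb k n A'))"
    unfolding i(1) by (rule hact_lft[OF fb_support i(2)])
  then show "lft (fb k n (low (hact k n s A))) = hact k n s (lft (fb k n (low A))) - smul (lx - lxinv) (lft (fb k n (low A)))"
    using hact_lft[where k = k, OF A(2) i(2)] i A by (simp add: fb_xop scalars_lft(3) smul_lft lft_diff xinv_def)
next
  fix z assume "z \<in> GBC n" "DesLt n z = {}"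
  then show "lft (fb k n (low (bas z))) = bas z"
    using bv_minimal[of z n k] DesLt_empty_iff[of z n] by (simp add: bas_lft fb_es)
qed

text \<open>The axioms determine f on basis vectors by induction on the length: a vector with a
  strict descent is H_s applied to a shorter one, and the others are fixed. Antilinearity and the
  finiteness of the index set then give all valid elements.\<close>

lemma is_bar_unique:
  assumes f: "is_bar k n f" and A: "valid n A"
  shows "f A = lft (fb k n (low A))"
proof -
  have add: "f (lft A + lft B) = f (lft A) + f (lft B)" if "valid n (lft A)" "valid n (lft B)" for A B
    using f that by (simp add: is_bar_def)
  have sc: "f (smul (Poly_Mapping.lookup c) (lft A)) = smul (Poly_Mapping.lookup (barp c)) (f (lft A))" if "valid n (lft A)" for c A
    using f that lfin_lookup[of c] unfolding is_bar_def lbar_lookup[symmetric] by blast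
  have hs: "f (hact k n (sgen i) (lft A)) = hact k n (sgen i) (f (lft A)) - smul (lx - lxinv) (f (lft A))"
    if "i < n" "valid n (lft A)" for i A
  proof -
    have "sgen i \<in> Sgens n" using that by (simp add: Sgens_def)
    then show ?thesis using f that unfolding is_bar_def by blast
  qed
  have mn: "f (bas z) = bas z" if "z \<in> GBC n" "DesLt n z = {}" for z
    using f that by (simp add: is_bar_def)
  have es0: "es z y = 0" if "z \<in> GBC n" "y \<notin> GBC n" for z y using that by (auto simp: es_def)
  have basis: "f (lft (es z)) = lft (bv k n z)" if "z \<in> GBC n" for z
    using that
  proof (induction z rule: GBC_induct_len)
    case (step z)
    note z = step(1)
    show ?case
    proof (cases "\<forall>i<n. asc i z \<or> eqd i z \<or> eqa n i z")
      case True
      then show ?thesis using mn[OF z] DesLt_empty_iff[OF z] bv_minimal[OF z, of k] by (simp add: bas_lft)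
    next
      case False
      then obtain i where i: "i < n" "\<not> asc i z" "\<not> eqd i z" "\<not> eqa n i z" by blast
      let ?y = "mv i z"
      note m = mv_desc[OF z i]
      have "xop k n i (es ?y) = es z" using xop_es_asc[OF m(1) i(1) m(3-5), of k] by simp
      then have "lft (es z) = hact k n (sgen i) (lft (es ?y))" using hact_lft[where k = k, OF es0[OF m(1)] i(1)] by simp
      then have "f (lft (es z)) = hact k n (sgen i) (f (lft (es ?y))) - smul (lx - lxinv) (f (lft (es ?y)))"
        using hs[OF i(1), of "es ?y"] es0[OF m(1)] by (simp add: valid_lft)
      also have "f (lft (es ?y)) = lft (bv k n ?y)" using step(2)[OF m(1)] m(2) by simp
      also have "hact k n (sgen i) (lft (bv k n ?y)) = lft (xop k n i (bv k n ?y))"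
        by (rule hact_lft[OF _ i(1)]) (use fb_support[of _ n k "es ?y"] fb_es[OF m(1), of k] in simp)
      finally show ?thesis using bv_desc[OF z i, of k] by (simp add: scalars_lft(3) smul_lft lft_diff xinv_def)
    qed
  qed
  have sum: "f (lft (\<lambda>y. \<Sum>z\<in>S. c z * es z y)) = lft (\<lambda>y. \<Sum>z\<in>S. barp (c z) * bv k n z y)"
    if "finite S" "S \<subseteq> GBC n" for S c
    using that
  proof (induction S rule: finite_induct)
    case empty
    have "f (lft (\<lambda>_. 0)) = f (lft (\<lambda>_. 0)) + f (lft (\<lambda>_. 0))"
      using add[of "\<lambda>_. 0" "\<lambda>_. 0"] by (simp add: valid_lft lft_add)
    then have "f (lft (\<lambda>_. 0)) = 0" by simp
    moreover have "lft (\<lambda>_. 0) = 0" by (simp add: fun_eq_iff lft_def)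
    ultimately show ?case by (simp add: zero_fun_def)
  next
    case (insert x S)
    have x: "x \<in> GBC n" and S: "S \<subseteq> GBC n" using insert by auto
    have v1: "valid n (lft (es x))" using es0[OF x] by (simp add: valid_lft)
    have v2: "valid n (lft (\<lambda>y. c x * es x y))" using es0[OF x] by (simp add: valid_lft)
    have v3: "valid n (lft (\<lambda>y. \<Sum>z\<in>S. c z * es z y))" using es0 S by (auto simp: valid_lft intro!: sum.neutral)
    have "f (lft (\<lambda>y. c x * es x y)) = lft (\<lambda>y. barp (c x) * bv k n x y)"
      using sc[OF v1, of "c x"] basis[OF x] by (simp add: smul_lft)
    then show ?case using add[OF v2 v3] insert S by (simp add: lft_add)
  qed
  obtain B where B: "A = lft B" "\<And>y. y \<notin> GBC n \<Longrightarrow> B y = 0" using A by (metis validE)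
  have "f A = f (lft (\<lambda>y. \<Sum>z\<in>GBC n. B z * es z y))" using es_expand[of n B] B by simp
  also have "\<dots> = lft (fb k n B)" unfolding sum[OF finite_GBC subset_refl] fb_def ..
  finally show ?thesis using B by simp
qed

definition cbas :: "modkind \<Rightarrow> nat \<Rightarrow> sperm \<Rightarrow> sperm \<Rightarrow> lp" where
  "cbas k n z = (SOME c. iscan k n z c)"

lemma iscan_cbas: "z \<in> GBC n \<Longrightarrow> iscan k n z (cbas k n z)"
  unfolding cbas_def by (rule someI_ex[OF iscan_exists])

text \<open>This resolves the definite description: \<open>is_bar_fb\<close> supplies an operator,
  \<open>is_bar_unique\<close> identifies every other one with it on valid elements, and
  \<open>iscan_unique\<close> then fixes the vectors.\<close>

lemma canon_eq: "canon k n = (\<lambda>z. if z \<in> GBC n then lft (cbas k n z) else (\<lambda>_ _. 0))"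
  unfolding canon_def
proof (rule the_equality)
  let ?C = "\<lambda>z. if z \<in> GBC n then lft (cbas k n z) else (\<lambda>_ _. 0)"
  have "valid n (lft (cbas k n z)) \<and> lft (fb k n (low (lft (cbas k n z)))) = lft (cbas k n z) \<and> lft (cbas k n z) z = lone
      \<and> (\<forall>y\<in>GBC n. y \<noteq> z \<longrightarrow> (if len (2 * n) y < len (2 * n) z then (\<forall>j\<ge>0. lft (cbas k n z) y j = 0)
           else lft (cbas k n z) y = (\<lambda>_. 0)))" if z: "z \<in> GBC n" for z
  proof -
    note c = iscan_cbas[OF z, of k]
    have "valid n (lft (cbas k n z))" using c z by (auto simp: valid_lft iscan_def)
    moreover have "lft (cbas k n z) z = lone" using c by (auto simp: iscan_def lft_def lone_def lookup_one when_def)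
    moreover have "if len (2 * n) y < len (2 * n) z then (\<forall>j\<ge>0. lft (cbas k n z) y j = 0) else lft (cbas k n z) y = (\<lambda>_. 0)"
      if "y \<noteq> z" for y
      unfolding lft_zero using c that by (auto simp: iscan_def ngd_def lft_def)
    ultimately show ?thesis using c by (simp add: iscan_def)
  qed
  then show "(\<forall>z. z \<notin> GBC n \<longrightarrow> ?C z = (\<lambda>_ _. 0)) \<and> (\<exists>f. is_bar k n f \<and>
      (\<forall>z\<in>GBC n. valid n (?C z) \<and> f (?C z) = ?C z \<and> ?C z z = lone \<and>
        (\<forall>y\<in>GBC n. y \<noteq> z \<longrightarrow> (if len (2 * n) y < len (2 * n) z then \<forall>j\<ge>0. ?C z y j = 0 else ?C z y = (\<lambda>_. 0)))))"
    using is_bar_fb[of k n] by (intro conjI allI impI exI[of _ "\<lambda>A. lft (fb k n (low A))"]) auto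
next
  fix C
  assume "(\<forall>z. z \<notin> GBC n \<longrightarrow> C z = (\<lambda>_ _. 0)) \<and> (\<exists>f. is_bar k n f \<and>
      (\<forall>z\<in>GBC n. valid n (C z) \<and> f (C z) = C z \<and> C z z = lone \<and>
        (\<forall>y\<in>GBC n. y \<noteq> z \<longrightarrow> (if len (2 * n) y < len (2 * n) z then \<forall>j\<ge>0. C z y j = 0 else C z y = (\<lambda>_. 0)))))"
  then obtain f where out: "\<And>z. z \<notin> GBC n \<Longrightarrow> C z = (\<lambda>_ _. 0)" and f: "is_bar k n f"
    and C: "\<And>z. z \<in> GBC n \<Longrightarrow> valid n (C z)" "\<And>z. z \<in> GBC n \<Longrightarrow> f (C z) = C z" "\<And>z. z \<in> GBC n \<Longrightarrow> C z z = lone"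
      "\<And>z y. z \<in> GBC n \<Longrightarrow> y \<in> GBC n \<Longrightarrow> y \<noteq> z \<Longrightarrow>
        (if len (2 * n) y < len (2 * n) z then \<forall>j\<ge>0. C z y j = 0 else C z y = (\<lambda>_. 0))"
    by blast
  show "C = (\<lambda>z. if z \<in> GBC n then lft (cbas k n z) else (\<lambda>_ _. 0))"
  proof
    fix z
    show "C z = (if z \<in> GBC n then lft (cbas k n z) else (\<lambda>_ _. 0))"
    proof (cases "z \<in> GBC n")
      case False
      then show ?thesis using out by simp
    next
      case z: True
      obtain c where c: "C z = lft c" "\<And>y. y \<notin> GBC n \<Longrightarrow> c y = 0" using C(1)[OF z] by (metis validE)
      have "fb k n c = c" using is_bar_unique[OF f C(1)[OF z]] C(2)[OF z] c by simp
      moreover have "c z = 1"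
        using C(3)[OF z] c by (intro poly_mapping_eqI) (simp add: lft_def lone_def lookup_one when_def)
      moreover have "ngd (c y) \<and> (c y \<noteq> 0 \<longrightarrow> y \<in> GBC n \<and> len (2 * n) y < len (2 * n) z)" if "y \<noteq> z" for y
      proof (cases "y \<in> GBC n")
        case True
        from C(4)[OF z True that] show ?thesis
        proof (cases "len (2 * n) y < len (2 * n) z")
          case True
          with C(4)[OF z \<open>y \<in> GBC n\<close> that] c show ?thesis using \<open>y \<in> GBC n\<close> by (simp add: ngd_def lft_def)
        next
          case False
          with C(4)[OF z \<open>y \<in> GBC n\<close> that] c have "lft c y = (\<lambda>_. 0)" by simp
          then show ?thesis unfolding lft_zero by (simp add: ngd_def)
        qed
      next
        case False
        then show ?thesis using c by (simp add: ngd_def)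
      qed
      ultimately have "iscan k n z c" by (simp add: iscan_def)
      then show ?thesis using iscan_unique[OF _ iscan_cbas[OF z]] c z by simp
    qed
  qed
qed

section \<open>Duality of the W-graphs\<close>

lemma mu_duality:
  assumes y: "y \<in> GBC n" and z: "z \<in> GBC n" and "y \<noteq> z"
  shows "mu ModN n (iota n y) (iota n z) = mu ModM n z y"
  using canonical_duality[OF assms iscan_cbas[OF y] iscan_cbas[OF iota_opp(1)[OF z]]] y iota_opp(1)[OF z]
  by (simp add: mu_def canon_eq lft_def)

lemma AscN_iota:
  assumes v: "v \<in> GBC n"
  shows "AscN n (iota n v) = Sgens n - AscM n v"
proof -
  have i: "sgen i \<in> AscN n (iota n v) \<longleftrightarrow> sgen i \<notin> AscM n v" if i: "i < n" for i
    using iota_types[OF v i] AscLt_iff[OF v i] AscEq_iff[OF v i] AscLt_iff[OF iota_opp(1)[OF v] i]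
      DesEq_iff[OF iota_opp(1)[OF v] i] eqd_eqa[OF i, of v] by (auto simp: AscN_def AscM_def)
  have "AscN n (iota n v) \<subseteq> Sgens n" by (auto simp: AscN_def AscLt_def DesEq_def)
  then show ?thesis using i by (auto simp: Sgens_def)
qed

theorem mainTheorem5:
  fixes n :: nat
  assumes "n \<ge> 2"
  shows "(\<forall>u\<in>GBC n. \<forall>v\<in>GBC n.
            omega ModN n (iota n u) (iota n v) = omega ModM n v u)
       \<and> (\<forall>v\<in>GBC n. AscN n (iota n v) = Sgens n - AscM n v)"
proof (intro conjI ballI)
  fix u v assume u: "u \<in> GBC n" and v: "v \<in> GBC n"
  have sub: "AscM n w \<subseteq> Sgens n" for w by (auto simp: AscM_def AscLt_def AscEq_def)
  \<comment> \<open>Complements reverse inclusions, which accounts for the exchange of u and v; the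
    two summands of the weight are exchanged as well. For u = v both weights are 0, since a set is
    contained in itself.\<close>
  have "AscN n (iota n u) \<subseteq> AscN n (iota n v) \<longleftrightarrow> AscM n v \<subseteq> AscM n u"
    unfolding AscN_iota[OF u] AscN_iota[OF v] using sub[of v] by blast
  then show "omega ModN n (iota n u) (iota n v) = omega ModM n v u"
    using mu_duality[OF u v] mu_duality[OF v u] by (cases "u = v") (auto simp: omega_def Asck_def)
qed (rule AscN_iota)

end
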